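(* (1) For every $\textsc{FOIL}$ formula $\phi$ there exists $k\ge 0$ such that $\textsc{Eval}(\phi)$ is in the complexity class $\Sigma_k^{\mathrm{P}}$. (2) For every $k\ge 0$ there is a $\textsc{FOIL}$ formula $\phi_k$ such that $\textsc{Eval}(\phi_k)$ is $\Sigma_k^{\mathrm{P}}$-hard.
   Context: A partial instance of dimension $n$ is a tuple in $\{0,1,\bot\}^n$; an instance is one in $\{0,1\}^n$. $\mathbf{e}_1$ is subsumed by $\mathbf{e}_2$ if $\mathbf{e}_1[i]=\mathbf{e}_2[i]$ whenever $\mathbf{e}_1[i]\neq\bot$. A decision tree of dimension $n$ is a rooted directed binary tree whose leaves are labeled $\mathsf{true}$/$\mathsf{false}$, whose internal nodes are labeled by features in $\{1,\dots,n\}$ with outgoing edges labeled $0$ and $1$, with no feature repeated on a root-to-leaf path; an instance $\mathbf{e}$ follows at a node labeled $j$ the edge labeled $\mathbf{e}[j]$, and $\mathcal{T}(\mathbf{e})=1$ iff it reaches a $\mathsf{true}$ leaf. $\textsc{FOIL}$ is first-order logic over $\{\textsc{Pos},\subseteq\}$, interpreted for a decision tree $\mathcal{T}$ of dimension $n$ over the domain $\{0,1,\bot\}^n$, with $\textsc{Pos}$ = the set of instances $\mathbf{e}$ with $\mathcal{T}(\mathbf{e})=1$ (no partial instance with an undefined feature is in $\textsc{Pos}$) and $\subseteq$ = subsumption. For a fixed formula $\varphi(x_1,\dots,x_k)$, the problem $\textsc{Eval}(\varphi)$ takes as input a decision tree $\mathcal{T}$ of dimension $n$ and partial instances $\mathbf{e}_1,\dots,\mathbf{e}_k$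 of dimension $n$, and asks whether $\mathcal{T}\models\varphi(\mathbf{e}_1,\dots,\mathbf{e}_k)$. *)

theory Defs
  imports "HOL-Computational_Algebra.Polynomial"
begin

section \<open>Partial instances and decision trees\<close>

text \<open>A partial instance of dimension n is a list of length n; \<open>None\<close> stands for the undefined
  value, \<open>Some False\<close> for 0 and \<open>Some True\<close> for 1. Features are numbered from 0.\<close>

type_synonym pinstance = "bool option list"

definition pinstances :: "nat \<Rightarrow> pinstance set" where
  "pinstances n = {e. length e = n}"

definition subsumed :: "pinstance \<Rightarrow> pinstance \<Rightarrow> bool" where
  "subsumed e1 e2 \<longleftrightarrow>
     length e1 = length e2 \<and> (\<forall>i<length e1. e1 ! i \<noteq> None \<longrightarrow> e1 ! i = e2 ! i)"

text \<open>In \<open>Node j l r\<close> the subtree \<open>l\<close> is reached by the edge labelled 0 and \<open>r\<close> by the edge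
  labelled 1.\<close>

datatype dtree = Leaf bool | Node nat dtree dtree

text \<open>All features on the tree are in \<open>F\<close> and none is repeated on a root-to-leaf path.\<close>

fun dtree_over :: "nat set \<Rightarrow> dtree \<Rightarrow> bool" where
  "dtree_over F (Leaf b) \<longleftrightarrow> True"
| "dtree_over F (Node j l r) \<longleftrightarrow>
     j \<in> F \<and> dtree_over (F - {j}) l \<and> dtree_over (F - {j}) r"

definition dtree_of_dim :: "nat \<Rightarrow> dtree \<Rightarrow> bool" where
  "dtree_of_dim n T \<longleftrightarrow> dtree_over {..<n} T"

fun classify :: "dtree \<Rightarrow> bool list \<Rightarrow> bool" where
  "classify (Leaf b) e = b"
| "classify (Node j l r) e = (if e ! j then classify r e else classify l e)"

definition positive :: "dtree \<Rightarrow> pinstance \<Rightarrow> bool" where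
  "positive T e \<longleftrightarrow> None \<notin> set e \<and> classify T (map the e)"


section \<open>The logic FOIL\<close>

text \<open>Variables are natural numbers. Equality is part of first-order logic; here it is also
  definable from subsumption.\<close>

datatype foil =
    Pos nat
  | Sub nat nat
  | Eq nat nat
  | Neg foil
  | And foil foil
  | Or foil foil
  | Ex nat foil
  | All nat foil

fun free_vars :: "foil \<Rightarrow> nat set" where
  "free_vars (Pos x) = {x}"
| "free_vars (Sub x y) = {x, y}"
| "free_vars (Eq x y) = {x, y}"
| "free_vars (Neg \<phi>) = free_vars \<phi>"
| "free_vars (And \<phi> \<psi>) = free_vars \<phi> \<union> free_vars \<psi>"
| "free_vars (Or \<phi> \<psi>) = free_vars \<phi> \<union> free_vars \<psi>"
| "free_vars (Ex x \<phi>) = free_vars \<phi> - {x}"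
| "free_vars (All x \<phi>) = free_vars \<phi> - {x}"

fun sat :: "nat \<Rightarrow> dtree \<Rightarrow> (nat \<Rightarrow> pinstance) \<Rightarrow> foil \<Rightarrow> bool" where
  "sat n T \<sigma> (Pos x) \<longleftrightarrow> positive T (\<sigma> x)"
| "sat n T \<sigma> (Sub x y) \<longleftrightarrow> subsumed (\<sigma> x) (\<sigma> y)"
| "sat n T \<sigma> (Eq x y) \<longleftrightarrow> \<sigma> x = \<sigma> y"
| "sat n T \<sigma> (Neg \<phi>) \<longleftrightarrow> \<not> sat n T \<sigma> \<phi>"
| "sat n T \<sigma> (And \<phi> \<psi>) \<longleftrightarrow> sat n T \<sigma> \<phi> \<and> sat n T \<sigma> \<psi>"
| "sat n T \<sigma> (Or \<phi> \<psi>) \<longleftrightarrow> sat n T \<sigma> \<phi> \<or> sat n T \<sigma> \<psi>"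
| "sat n T \<sigma> (Ex x \<phi>) \<longleftrightarrow> (\<exists>e\<in>pinstances n. sat n T (\<sigma>(x := e)) \<phi>)"
| "sat n T \<sigma> (All x \<phi>) \<longleftrightarrow> (\<forall>e\<in>pinstances n. sat n T (\<sigma>(x := e)) \<phi>)"

text \<open>For \<open>\<phi>(x\<^sub>1, \<dots>, x\<^sub>k)\<close>, the list \<open>x\<^sub>1, \<dots>, x\<^sub>k\<close> consists of the free variables of \<open>\<phi>\<close>
  in increasing order.\<close>

definition var_list :: "foil \<Rightarrow> nat list" where
  "var_list \<phi> = sorted_list_of_set (free_vars \<phi>)"

definition models :: "nat \<Rightarrow> dtree \<Rightarrow> foil \<Rightarrow> pinstance list \<Rightarrow> bool" where
  "models n T \<phi> es \<longleftrightarrow> sat n T (\<lambda>x. the (map_of (zip (var_list \<phi>) es) x)) \<phi>"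


section \<open>The evaluation problem as a language over the binary alphabet\<close>

text \<open>The dimension is written in unary: partial instances of dimension n have size n,
  and so do the elements of the domain when \<open>\<phi>\<close> is a sentence. Feature labels are
  below n, so writing them in unary changes the size of the input only polynomially.\<close>

definition enc_nat :: "nat \<Rightarrow> bool list" where
  "enc_nat n = replicate n True @ [False]"

fun enc_dtree :: "dtree \<Rightarrow> bool list" where
  "enc_dtree (Leaf b) = [False, b]"
| "enc_dtree (Node j l r) = True # enc_nat j @ enc_dtree l @ enc_dtree r"

fun enc_value :: "bool option \<Rightarrow> bool list" where
  "enc_value None = [False, False]"
| "enc_value (Some b) = [True, b]"

definition enc_pinstance :: "pinstance \<Rightarrow> bool list" where
  "enc_pinstance e = concat (map enc_value e)"

definition enc_input :: "nat \<Rightarrow> dtree \<Rightarrow> pinstance list \<Rightarrow> bool list" where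
  "enc_input n T es = enc_nat n @ enc_dtree T @ concat (map enc_pinstance es)"

definition Eval :: "foil \<Rightarrow> bool list set" where
  "Eval \<phi> = {enc_input n T es | n T es.
     dtree_of_dim n T \<and> length es = card (free_vars \<phi>) \<and> set es \<subseteq> pinstances n \<and>
     models n T \<phi> es}"

text \<open>Distinct inputs have distinct encodings.\<close>

lemma enc_nat_append_inject: "enc_nat m @ u = enc_nat n @ v \<longleftrightarrow> m = n \<and> u = v"
proof (induction m arbitrary: n)
  case 0
  then show ?case by (cases n) (auto simp: enc_nat_def)
next
  case (Suc m)
  then show ?case by (cases n) (auto simp: enc_nat_def)
qed

lemma enc_dtree_append_inject: "enc_dtree S @ u = enc_dtree T @ v \<longleftrightarrow> S = T \<and> u = v"
proof (induction S arbitrary: T u v)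
  case (Leaf b)
  then show ?case by (cases T) auto
next
  case (Node j l r)
  then show ?case by (cases T) (auto simp: enc_nat_append_inject)
qed

lemma enc_pinstance_append_inject:
  "length d = length e \<Longrightarrow> enc_pinstance d @ u = enc_pinstance e @ v \<longleftrightarrow> d = e \<and> u = v"
proof (induction d e rule: list_induct2)
  case Nil
  then show ?case by (simp add: enc_pinstance_def)
next
  case (Cons a d b e)
  then show ?case by (cases a; cases b) (auto simp: enc_pinstance_def)
qed

lemma enc_input_inject:
  assumes "length ds = length es" "set ds \<subseteq> pinstances m" "set es \<subseteq> pinstances n"
  shows "enc_input m S ds = enc_input n T es \<longleftrightarrow> m = n \<and> S = T \<and> ds = es"
proof -
  have "concat (map enc_pinstance ds) = concat (map enc_pinstance es) \<longleftrightarrow> ds = es" if "m = n"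
    using assms that
  proof (induction ds es rule: list_induct2)
    case Nil
    then show ?case by simp
  next
    case (Cons d ds e es)
    then show ?case by (auto simp: enc_pinstance_append_inject pinstances_def)
  qed
  then show ?thesis
    by (auto simp: enc_input_def enc_nat_append_inject enc_dtree_append_inject)
qed


section \<open>Deterministic multi-tape Turing machines\<close>

datatype move = Move_Left | Stay | Move_Right

text \<open>States and tape symbols are the natural numbers below \<open>num_states\<close> and
  \<open>num_symbols\<close>. Symbol 0 is the blank; 1 and 2 represent the bits 0 and 1. Only the values of
  \<open>delta\<close> on states and on lists of \<open>num_tapes\<close> symbols of the machine matter.\<close>

record tm =
  num_tapes :: nat
  num_symbols :: nat
  num_states :: nat
  start_state :: nat
  halt_state :: nat
  delta :: "nat \<Rightarrow> nat list \<Rightarrow> nat \<times> (nat \<times> move) list"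

definition wf_tm :: "tm \<Rightarrow> bool" where
  "wf_tm M \<longleftrightarrow>
     num_tapes M \<ge> 1 \<and> num_symbols M \<ge> 3 \<and>
     start_state M < num_states M \<and> halt_state M < num_states M \<and>
     (\<forall>q<num_states M. \<forall>ss. length ss = num_tapes M \<and> set ss \<subseteq> {..<num_symbols M} \<longrightarrow>
        fst (delta M q ss) < num_states M \<and>
        length (snd (delta M q ss)) = num_tapes M \<and>
        fst ` set (snd (delta M q ss)) \<subseteq> {..<num_symbols M})"

text \<open>A tape is infinite in both directions and comes with its head position.\<close>

type_synonym tape = "(int \<Rightarrow> nat) \<times> int"
type_synonym config = "nat \<times> tape list"

fun move_head :: "move \<Rightarrow> int \<Rightarrow> int" where
  "move_head Move_Left h = h - 1"
| "move_head Stay h = h"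
| "move_head Move_Right h = h + 1"

fun act :: "nat \<times> move \<Rightarrow> tape \<Rightarrow> tape" where
  "act (s, d) (t, h) = (t(h := s), move_head d h)"

definition step :: "tm \<Rightarrow> config \<Rightarrow> config" where
  "step M c = (case c of (q, tps) \<Rightarrow>
     if q = halt_state M then c
     else case delta M q (map (\<lambda>(t, h). t h) tps) of (q', as) \<Rightarrow> (q', map2 act as tps))"

definition bit_symbol :: "bool \<Rightarrow> nat" where
  "bit_symbol b = (if b then 2 else 1)"

definition tape_of :: "bool list \<Rightarrow> tape" where
  "tape_of w =
     (\<lambda>i. if 0 \<le> i \<and> i < int (length w) then bit_symbol (w ! nat i) else 0, 0)"

text \<open>A machine with several arguments gets the i-th argument on tape i; the other tapes
  are blank. The output is on the last tape, from cell 0 up to the first blank.\<close>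

definition init_config :: "tm \<Rightarrow> bool list list \<Rightarrow> config" where
  "init_config M ws =
     (start_state M, map (\<lambda>i. tape_of (if i < length ws then ws ! i else [])) [0..<num_tapes M])"

definition has_output :: "config \<Rightarrow> bool list \<Rightarrow> bool" where
  "has_output c y \<longleftrightarrow>
     (let t = fst (last (snd c)) in
       (\<forall>i<length y. t (int i) = bit_symbol (y ! i)) \<and> t (int (length y)) = 0)"

text \<open>Halting configurations are fixed points of \<open>step\<close>, so the machine halts after at
  most t steps.\<close>

definition computes_within :: "tm \<Rightarrow> bool list list \<Rightarrow> bool list \<Rightarrow> nat \<Rightarrow> bool" where
  "computes_within M ws y t \<longleftrightarrow>
     (let c = (step M ^^ t) (init_config M ws) in fst c = halt_state M \<and> has_output c y)"


section \<open>Polynomial time and the polynomial hierarchy\<close>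

definition polytime_computable :: "nat \<Rightarrow> (bool list list \<Rightarrow> bool list) \<Rightarrow> bool" where
  "polytime_computable m f \<longleftrightarrow>
     (\<exists>M (p :: nat poly). wf_tm M \<and> m \<le> num_tapes M \<and>
        (\<forall>ws. length ws = m \<longrightarrow>
           computes_within M ws (f ws) (poly p (sum_list (map length ws)))))"

definition polytime_decidable :: "nat \<Rightarrow> (bool list list \<Rightarrow> bool) \<Rightarrow> bool" where
  "polytime_decidable m R \<longleftrightarrow> polytime_computable m (\<lambda>ws. [R ws])"

definition class_P :: "bool list set set" where
  "class_P = {L. polytime_decidable 1 (\<lambda>ws. hd ws \<in> L)}"

text \<open>\<open>alternation True k m R\<close> states that there is \<open>u\<^sub>1\<close> such that for all \<open>u\<^sub>2\<close> there
  is \<open>u\<^sub>3\<close> etc. such that \<open>R [u\<^sub>1, \<dots>, u\<^sub>k]\<close> holds, where all \<open>u\<^sub>i\<close> have length m;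
  \<open>alternation False k m R\<close> starts with a universal quantifier.\<close>

fun alternation :: "bool \<Rightarrow> nat \<Rightarrow> nat \<Rightarrow> (bool list list \<Rightarrow> bool) \<Rightarrow> bool" where
  "alternation b 0 m R \<longleftrightarrow> R []"
| "alternation True (Suc k) m R \<longleftrightarrow>
     (\<exists>u. length u = m \<and> alternation False k m (\<lambda>us. R (u # us)))"
| "alternation False (Suc k) m R \<longleftrightarrow>
     (\<forall>u. length u = m \<longrightarrow> alternation True k m (\<lambda>us. R (u # us)))"

definition Sigma_P :: "nat \<Rightarrow> bool list set set" where
  "Sigma_P k = {L. \<exists>R (q :: nat poly). polytime_decidable (Suc k) R \<and>
     (\<forall>x. x \<in> L \<longleftrightarrow> alternation True k (poly q (length x)) (\<lambda>us. R (x # us)))}"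

lemma Sigma_P_0: "Sigma_P 0 = class_P"
proof -
  have "polytime_decidable 1 (\<lambda>ws. hd ws \<in> L) \<longleftrightarrow> polytime_decidable 1 R"
    if "\<And>x. x \<in> L \<longleftrightarrow> R [x]" for L R
  proof -
    have "(hd ws \<in> L) = R ws" if "length ws = 1" for ws
      using that \<open>\<And>x. x \<in> L \<longleftrightarrow> R [x]\<close> by (cases ws) auto
    then show ?thesis
      by (simp add: polytime_decidable_def polytime_computable_def cong: imp_cong)
  qed
  then have "(\<exists>R. polytime_decidable 1 R \<and> (\<forall>x. x \<in> L \<longleftrightarrow> R [x])) \<longleftrightarrow>
      polytime_decidable 1 (\<lambda>ws. hd ws \<in> L)" for L
    by (metis list.sel(1))
  then show ?thesis
    by (simp add: Sigma_P_def class_P_def)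
qed

definition polytime_reducible :: "bool list set \<Rightarrow> bool list set \<Rightarrow> bool" where
  "polytime_reducible L L' \<longleftrightarrow>
     (\<exists>f. polytime_computable 1 (\<lambda>ws. f (hd ws)) \<and> (\<forall>x. x \<in> L \<longleftrightarrow> f x \<in> L'))"

definition Sigma_P_hard :: "nat \<Rightarrow> bool list set \<Rightarrow> bool" where
  "Sigma_P_hard k L \<longleftrightarrow> (\<forall>L'\<in>Sigma_P k. polytime_reducible L' L)"

end

theory Submission
  imports Defs
begin

text \<open>Polynomial-time computability is obtained from a small language of bit list generators whose
  loops and recursions are polynomially bounded by their syntax; generators are compiled to
  multi-tape machines once and for all.

  Membership: the prenex form of a formula is an alternating prefix, and partial instances of
  dimension n are words of length 2n; the matrix is decided by a scan of the encoded tree.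

  Hardness: a bit of a word, and a cell of the tableau of a machine run, is a feature. Each local
  constraint on the tableau has a further feature as its selector, and the positive instances of the
  tree are those that violate the constraint of their first selector with value 0: the tree is a
  chain of tests of the selectors, and below each of them a full tree reads the boundedly many
  features of the constraint. The formula quantifies a word as a partial instance below a given
  one that has the value 1 on the features of the word and is undefined elsewhere. Negative
  information is recovered by the requirement that a full instance y meets this block exactly in
  the quantified instance, so that every feature of the block that is undefined there has the value
  0 in y. The innermost existential block is the tableau, and the formula says that no such y is
  positive, that is, that no constraint is violated.\<close>

section \<open>Structured tape programs\<close>

text \<open>The formula is fixed and FOIL cannot name a feature, so everything about the input must
  sit in the tree and the parameters; a quantified bit can only be the choice to keep or drop a
  feature with value 1. Decision trees are weak as well: with polynomially many nodes and no feature
  repeated on a path, they cannot in general test many constraints that share features one after the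
  other. The selectors avoid this, since a path reads the features of one constraint only, and the
  universal quantifier over y, which ranges over all settings of the selectors, turns a test of one
  constraint into a test of all. With several tapes the next state depends on cells far apart, which
  would spoil locality; hence column 0 of each row repeats the scanned symbols, and the windows at
  the heads confirm them. The run is deterministic, so guessing its tableau adds no power. The
  formula has more alternations than k, as a lower bound permits. In the generators, the cap of
  \<open>Iter\<close> keeps values polynomial: an uncapped update could double its state in every
  round.\<close>

type_synonym store = "nat \<Rightarrow> tape"

text \<open>\<open>Do w c h\<close> is a single machine step: it reads tapes w and c and acts on tape c.
  \<open>While i c\<close> repeats c as long as tape i shows a non-blank symbol.\<close>

datatype cmd =
    Do nat nat "nat \<Rightarrow> nat \<Rightarrow> nat \<times> move"
  | Then cmd cmd (infixr ";;" 60)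
  | While nat cmd

definition rd :: "tape \<Rightarrow> nat" where
  "rd tp = fst tp (snd tp)"

inductive exec :: "cmd \<Rightarrow> store \<Rightarrow> nat \<Rightarrow> store \<Rightarrow> bool" where
  exec_Do: "exec (Do w c h) s (Suc 0) (s(c := act (h (rd (s w)) (rd (s c))) (s c)))"
| exec_Then: "exec a s n s' \<Longrightarrow> exec b s' n' s'' \<Longrightarrow> exec (a ;; b) s (n + n') s''"
| exec_stop: "rd (s i) = 0 \<Longrightarrow> exec (While i a) s (Suc 0) s"
| exec_loop: "rd (s i) \<noteq> 0 \<Longrightarrow> exec a s n s' \<Longrightarrow> exec (While i a) s' n' s'' \<Longrightarrow>
    exec (While i a) s (Suc (n + n')) s''"

fun cmd_tapes :: "cmd \<Rightarrow> nat set" where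
  "cmd_tapes (Do w c h) = {w, c}"
| "cmd_tapes (a ;; b) = cmd_tapes a \<union> cmd_tapes b"
| "cmd_tapes (While i a) = insert i (cmd_tapes a)"

fun cmd_ok :: "cmd \<Rightarrow> bool" where
  "cmd_ok (Do w c h) \<longleftrightarrow> (\<forall>a<3. \<forall>b<3. fst (h a b) < 3)"
| "cmd_ok (a ;; b) \<longleftrightarrow> cmd_ok a \<and> cmd_ok b"
| "cmd_ok (While i a) \<longleftrightarrow> cmd_ok a"

fun cmd_states :: "cmd \<Rightarrow> nat" where
  "cmd_states (Do w c h) = Suc 0"
| "cmd_states (a ;; b) = cmd_states a + cmd_states b"
| "cmd_states (While i a) = Suc (cmd_states a)"

text \<open>The states of \<open>a\<close> are numbered from \<open>e\<close>, its entry; it leaves to state \<open>x\<close>.\<close>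

fun transit :: "cmd \<Rightarrow> nat \<Rightarrow> nat \<Rightarrow> nat \<Rightarrow> (nat \<Rightarrow> nat) \<Rightarrow> nat \<times> (nat \<Rightarrow> nat \<times> move)" where
  "transit (Do w c h) e x q r = (x, \<lambda>i. if i = c then h (r w) (r c) else (r i, Stay))"
| "transit (a ;; b) e x q r =
     (if q < e + cmd_states a then transit a e (e + cmd_states a) q r
      else transit b (e + cmd_states a) x q r)"
| "transit (While j a) e x q r =
     (if q = e then (if r j = 0 then x else Suc e, \<lambda>i. (r i, Stay))
      else transit a (Suc e) e q r)"

definition tm_of :: "nat \<Rightarrow> cmd \<Rightarrow> tm" where
  "tm_of K a = \<lparr>num_tapes = K, num_symbols = 3, num_states = Suc (cmd_states a),
     start_state = 0, halt_state = cmd_states a,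
     delta = \<lambda>q ss. case transit a 0 (cmd_states a) q (\<lambda>i. ss ! i) of (q', f) \<Rightarrow> (q', map f [0..<K])\<rparr>"

section \<open>Simulation of tape programs by machines\<close>

lemma cmd_states_pos: "0 < cmd_states a"
  by (induction a) auto

lemma trans_state_le: "x \<le> N \<Longrightarrow> e + cmd_states a \<le> N \<Longrightarrow> fst (transit a e x q r) \<le> N"
  by (induction a arbitrary: e x) auto

lemma trans_symbol_less:
  assumes "cmd_ok a" "cmd_tapes a \<subseteq> {..<K}" "\<And>i. i < K \<Longrightarrow> r i < 3" "i < K"
  shows "fst (snd (transit a e x q r) i) < 3"
  using assms(1,2)
proof (induction a arbitrary: e x)
  case (Do w c h)
  then show ?case using assms(3,4) by auto
qed (use assms(3,4) in auto)

lemma wf_tm_of: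
  assumes "cmd_ok a" "cmd_tapes a \<subseteq> {..<K}" "1 \<le> K"
  shows "wf_tm (tm_of K a)"
proof -
  have "fst (transit a 0 (cmd_states a) q r) < Suc (cmd_states a)" for q r
    using trans_state_le[of "cmd_states a" "cmd_states a" 0 a] by (simp add: less_Suc_eq_le)
  moreover have "fst (snd (transit a 0 (cmd_states a) q ((!) ss)) i) < 3"
    if "length ss = K" "set ss \<subseteq> {..<3}" "i < K" for q ss i
    using that by (intro trans_symbol_less[OF assms(1,2)]) (auto simp: subset_iff)
  ultimately show ?thesis
    using assms(3) cmd_states_pos[of a]
    by (auto simp: wf_tm_def tm_of_def split_beta)
qed

lemma act_rd_Stay: "act (rd tp, Stay) tp = tp"
  by (cases tp) (simp add: rd_def)

text \<open>\<open>delta\<close> is compared with \<open>transit\<close> on the states of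
  \<open>a\<close> only, so that the induction can pass to subprograms with a shifted entry and
  exit. The halting state has to lie outside this interval because \<open>step\<close> freezes
  there; the exit \<open>x\<close> may be the halting state.\<close>

lemma exec_simulated:
  assumes "exec a s n s'" "cmd_tapes a \<subseteq> {..<K}" "num_tapes M = K"
    "\<And>q ss. e \<le> q \<Longrightarrow> q < e + cmd_states a \<Longrightarrow>
      delta M q ss = (case transit a e x q (\<lambda>i. ss ! i) of (q', f) \<Rightarrow> (q', map f [0..<K]))"
    "halt_state M \<notin> {e..<e + cmd_states a}"
  shows "(step M ^^ n) (e, map s [0..<K]) = (x, map s' [0..<K])"
  using assms
proof (induction a s n s' arbitrary: e x rule: exec.induct)
  case (exec_Do w c h s)
  have *: "map (\<lambda>(t, h). t h) (map s [0..<K]) = map (\<lambda>i. rd (s i)) [0..<K]"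
    by (auto simp: rd_def split_beta)
  have "c < K" "w < K" using exec_Do by auto
  then show ?case using exec_Do(3)[of e] exec_Do(4)
    by (auto simp: step_def * simp del: map_map intro!: nth_equalityI) (auto simp: act_rd_Stay)
next
  case (exec_Then a s n s' b n' s'')
  have "(step M ^^ n) (e, map s [0..<K]) = (e + cmd_states a, map s' [0..<K])"
    using exec_Then.prems by (intro exec_Then.IH(1)) auto
  moreover have "(step M ^^ n') (e + cmd_states a, map s' [0..<K]) = (x, map s'' [0..<K])"
    using exec_Then.prems by (intro exec_Then.IH(2)) auto
  ultimately show ?case
    by (subst add.commute) (simp add: funpow_add)
next
  case (exec_stop s i a)
  have *: "map (\<lambda>(t, h). t h) (map s [0..<K]) = map (\<lambda>i. rd (s i)) [0..<K]"
    by (auto simp: rd_def split_beta)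
  show ?case using exec_stop
    by (auto simp: step_def * simp del: map_map intro!: nth_equalityI) (auto simp: act_rd_Stay)
next
  case (exec_loop s i a n s' n' s'')
  have *: "map (\<lambda>(t, h). t h) (map s [0..<K]) = map (\<lambda>i. rd (s i)) [0..<K]"
    by (auto simp: rd_def split_beta)
  have "step M (e, map s [0..<K]) = (Suc e, map s [0..<K])"
    using exec_loop.hyps(1) exec_loop.prems
    by (auto simp: step_def * simp del: map_map intro!: nth_equalityI) (auto simp: act_rd_Stay)
  moreover have "(step M ^^ n) (Suc e, map s [0..<K]) = (e, map s' [0..<K])"
    using exec_loop.prems by (intro exec_loop.IH(1)) auto
  moreover have "(step M ^^ n') (e, map s' [0..<K]) = (x, map s'' [0..<K])"
    using exec_loop.prems by (intro exec_loop.IH(2)) auto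
  moreover have "Suc (n + n') = n' + (n + 1)" by simp
  ultimately show ?case
    by (simp only: funpow_add o_apply) simp
qed

lemma step_funpow_halted: "fst c = halt_state M \<Longrightarrow> (step M ^^ t) c = c"
  by (induction t) (auto simp: step_def split: prod.splits)

lemma halted_mono:
  assumes "fst ((step M ^^ t) c) = halt_state M" "t \<le> t'"
  shows "(step M ^^ t') c = (step M ^^ t) c"
proof -
  have "(step M ^^ t') c = (step M ^^ (t' - t)) ((step M ^^ t) c)"
    using assms(2) by (simp flip: funpow_add[unfolded o_def, THEN fun_cong])
  then show ?thesis
    using step_funpow_halted[OF assms(1)] by simp
qed

lemma computes_within_mono:
  "computes_within M ws y t \<Longrightarrow> t \<le> t' \<Longrightarrow> computes_within M ws y t'"
  using halted_mono[where M = M and t = t and c = "init_config M ws" and t' = t'] by (simp add: computes_within_def Let_def)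

lemma tm_of_computes:
  assumes "exec a s n s'" "n \<le> t" "cmd_tapes a \<subseteq> {..<K}" "1 \<le> K"
    "\<And>i. i < K \<Longrightarrow> s i = tape_of (if i < length ws then ws ! i else [])"
    "\<And>i. i < length y \<Longrightarrow> fst (s' (K - 1)) (int i) = bit_symbol (y ! i)"
    "fst (s' (K - 1)) (int (length y)) = 0"
  shows "computes_within (tm_of K a) ws y t"
proof -
  have "(step (tm_of K a) ^^ n) (0, map s [0..<K]) = (cmd_states a, map s' [0..<K])"
    using assms by (intro exec_simulated) (auto simp: tm_of_def)
  moreover have "init_config (tm_of K a) ws = (0, map s [0..<K])"
    using assms by (auto simp: init_config_def tm_of_def)
  moreover have "last (map s' [0..<K]) = s' (K - 1)"
    using assms(4) by (simp add: last_map)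
  ultimately have "computes_within (tm_of K a) ws y n"
    using assms(6,7) by (simp add: computes_within_def has_output_def tm_of_def)
  then show ?thesis using assms(2) computes_within_mono by blast
qed

section \<open>A language of polynomial-time generators\<close>

text \<open>A program emits a bit list; where a number is expected, the length of that list counts.
  All loop bounds and all values of \<open>Iter\<close> are polynomially bounded by construction: the state v
  of the iteration starts with \<open>g0\<close>, is updated to the value of \<open>h\<close> in round i, and is capped by
  \<open>b\<close>.\<close>

datatype gen =
    Emit bool
  | Cat gen gen
  | Var nat
  | Len nat
  | Bit nat gen
  | Monus gen gen
  | For nat gen gen
  | Iter nat nat gen gen gen gen

fun sem :: "bool list list \<Rightarrow> (nat \<Rightarrow> nat) \<Rightarrow> gen \<Rightarrow> bool list" where
  "sem ws \<rho> (Emit b) = [b]"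
| "sem ws \<rho> (Cat g h) = sem ws \<rho> g @ sem ws \<rho> h"
| "sem ws \<rho> (Var v) = replicate (\<rho> v) True"
| "sem ws \<rho> (Len w) = replicate (length (ws ! w)) True"
| "sem ws \<rho> (Bit w g) =
     (let p = length (sem ws \<rho> g) in if p < length (ws ! w) \<and> ws ! w ! p then [True] else [])"
| "sem ws \<rho> (Monus g h) = replicate (length (sem ws \<rho> g) - length (sem ws \<rho> h)) True"
| "sem ws \<rho> (For v g h) =
     concat (map (\<lambda>i. sem ws (\<rho>(v := i)) h) [0..<length (sem ws \<rho> g)])"
| "sem ws \<rho> (Iter i v g0 b n h) =
     replicate (rec_nat (length (sem ws \<rho> g0))
       (\<lambda>j x. min (length (sem ws \<rho> b)) (length (sem ws (\<rho>(i := j, v := x)) h)))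
       (length (sem ws \<rho> n))) True"

fun word_indices :: "gen \<Rightarrow> nat set" where
  "word_indices (Emit b) = {}"
| "word_indices (Cat g h) = word_indices g \<union> word_indices h"
| "word_indices (Var v) = {}"
| "word_indices (Len w) = {w}"
| "word_indices (Bit w g) = insert w (word_indices g)"
| "word_indices (Monus g h) = word_indices g \<union> word_indices h"
| "word_indices (For v g h) = word_indices g \<union> word_indices h"
| "word_indices (Iter i v g0 b n h) =
     word_indices g0 \<union> word_indices b \<union> word_indices n \<union> word_indices h"

text \<open>\<open>len_bound\<close> bounds the length of the output and \<open>time_bound\<close> the running time in terms of a
  common bound on the variables and the lengths of the words.\<close>

abbreviation idp :: "nat poly" where "idp \<equiv> [:0, 1:]"

fun len_bound :: "gen \<Rightarrow> nat poly" where
  "len_bound (Emit b) = 1"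
| "len_bound (Cat g h) = len_bound g + len_bound h"
| "len_bound (Var v) = idp"
| "len_bound (Len w) = idp"
| "len_bound (Bit w g) = 1"
| "len_bound (Monus g h) = len_bound g"
| "len_bound (For v g h) = len_bound g * pcompose (len_bound h) (idp + len_bound g)"
| "len_bound (Iter i v g0 b n h) = len_bound g0 + len_bound b"

fun time_bound :: "gen \<Rightarrow> nat poly" where
  "time_bound (Emit b) = 2"
| "time_bound (Cat g h) = time_bound g + time_bound h"
| "time_bound (Var v) = 10 * idp + 2"
| "time_bound (Len w) = 9 * idp + 2"
| "time_bound (Bit w g) = time_bound g + 8 * len_bound g + 4"
| "time_bound (Monus g h) =
     time_bound g + time_bound h + 3 * len_bound h + 4 * len_bound g + 2"
| "time_bound (For v g h) =
     time_bound g + len_bound g * (pcompose (time_bound h) (idp + len_bound g) + 4)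
     + 2 * len_bound g + 2"
| "time_bound (Iter i v g0 b n h) =
     time_bound n + time_bound g0 + 4 * len_bound g0 +
     len_bound n * (pcompose (time_bound h) (idp + len_bound n + len_bound g0 + len_bound b)
       + time_bound b
       + 5 * pcompose (len_bound h) (idp + len_bound n + len_bound g0 + len_bound b)
       + 2 * len_bound g0 + 4 * len_bound b + 7)
     + 2 * len_bound n + 4 * (len_bound g0 + len_bound b) + 4"

lemma rec_nat_min_le: "rec_nat a (\<lambda>j x. min b (f j x)) n \<le> a + (b::nat)"
  by (cases n) auto

text \<open>In the body of \<open>For\<close> the loop variable may exceed L but stays below the
  number of rounds. The induction hypothesis is therefore used at L plus the bound on the rounds,
  which is the argument that \<open>pcompose\<close> supplies in \<open>len_bound\<close>.\<close>

lemma sem_length_le: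
  assumes "\<And>v. \<rho> v \<le> L" "\<And>w. w \<in> word_indices g \<Longrightarrow> length (ws ! w) \<le> L"
  shows "length (sem ws \<rho> g) \<le> poly (len_bound g) L"
  using assms
proof (induction g arbitrary: \<rho> L)
  case (Cat g h)
  then show ?case by (simp add: add_mono)
next
  case (Monus g h)
  then have "length (sem ws \<rho> g) \<le> poly (len_bound g) L" by simp
  then show ?case by simp
next
  case (For v g h)
  let ?N = "length (sem ws \<rho> g)"
  have N: "?N \<le> poly (len_bound g) L" using For by simp
  let ?L = "L + poly (len_bound g) L"
  have "length (sem ws (\<rho>(v := i)) h) \<le> poly (len_bound h) ?L" if "i < ?N" for i
    using For.prems that N by (intro For.IH(2)) (auto simp: trans_le_add1 add_increasing2)
  then have "(\<Sum>i\<leftarrow>[0..<?N]. length (sem ws (\<rho>(v := i)) h)) \<le> (\<Sum>i\<leftarrow>[0..<?N]. poly (len_bound h) ?L)"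
    by (intro sum_list_mono) auto
  also have "\<dots> = ?N * poly (len_bound h) ?L"
    by (simp add: sum_list_triv)
  also have "\<dots> \<le> poly (len_bound g) L * poly (len_bound h) ?L"
    using N by simp
  finally show ?case
    by (simp add: length_concat o_def poly_pcompose)
next
  case (Iter i v g0 b n h)
  have "length (sem ws \<rho> g0) + length (sem ws \<rho> b) \<le> poly (len_bound g0) L + poly (len_bound b) L"
    using Iter by (intro add_mono) auto
  then show ?case
    by (simp add: order_trans[OF rec_nat_min_le])
qed (auto simp: Let_def)

text \<open>A strict bound on all variables that the generator reads. Bound ones are counted as
  well, which is harmless: \<open>fresh\<close> serves to choose loop variables that capture
  nothing.\<close>

fun fresh :: "gen \<Rightarrow> nat" where
  "fresh (Emit b) = 0"
| "fresh (Cat g h) = max (fresh g) (fresh h)"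
| "fresh (Var v) = Suc v"
| "fresh (Len w) = 0"
| "fresh (Bit w g) = fresh g"
| "fresh (Monus g h) = max (fresh g) (fresh h)"
| "fresh (For v g h) = max (fresh g) (fresh h)"
| "fresh (Iter i v g0 b n h) = max (max (fresh g0) (fresh b)) (max (fresh n) (fresh h))"

lemma sem_cong: "(\<And>v. v < fresh g \<Longrightarrow> \<rho> v = \<rho>' v) \<Longrightarrow> sem ws \<rho> g = sem ws \<rho>' g"
proof (induction g arbitrary: \<rho> \<rho>')
  case (Cat g h)
  have "sem ws \<rho> g = sem ws \<rho>' g" "sem ws \<rho> h = sem ws \<rho>' h"
    using Cat.prems by (auto intro!: Cat.IH)
  then show ?case by simp
next
  case (Bit w g)
  have "sem ws \<rho> g = sem ws \<rho>' g"
    using Bit.prems by (auto intro!: Bit.IH)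
  then show ?case by simp
next
  case (Monus g h)
  have "sem ws \<rho> g = sem ws \<rho>' g" "sem ws \<rho> h = sem ws \<rho>' h"
    using Monus.prems by (auto intro!: Monus.IH)
  then show ?case by simp
next
  case (For v g h)
  have "sem ws \<rho> g = sem ws \<rho>' g" "\<And>i. sem ws (\<rho>(v := i)) h = sem ws (\<rho>'(v := i)) h"
    using For.prems by (auto intro!: For.IH)
  then show ?case by simp
next
  case (Iter i v g0 b n h)
  have "sem ws \<rho> g0 = sem ws \<rho>' g0" "sem ws \<rho> b = sem ws \<rho>' b" "sem ws \<rho> n = sem ws \<rho>' n"
    "\<And>j x. sem ws (\<rho>(i := j, v := x)) h = sem ws (\<rho>'(i := j, v := x)) h"
    using Iter.prems by (auto intro!: Iter.IH)
  then show ?case by simp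
qed auto

lemma sem_fresh [simp]: "fresh g \<le> v \<Longrightarrow> sem ws (\<rho>(v := i)) g = sem ws \<rho> g"
  by (rule sem_cong) auto

section \<open>Compiling generators to tape programs\<close>

definition runs :: "cmd \<Rightarrow> store \<Rightarrow> nat \<Rightarrow> store \<Rightarrow> bool" where
  "runs a s n s' \<longleftrightarrow> (\<exists>n'\<le>n. exec a s n' s')"

lemma runs_mono: "runs a s n s' \<Longrightarrow> n \<le> n' \<Longrightarrow> runs a s n' s'"
  unfolding runs_def using le_trans by blast

lemma runs_Then: "runs a s n s' \<Longrightarrow> runs b s' n' s'' \<Longrightarrow> runs (a ;; b) s (n + n') s''"
  unfolding runs_def using exec_Then add_mono by blast

lemma runs_Do: "s' = s(c := act (h (rd (s w)) (rd (s c))) (s c)) \<Longrightarrow> runs (Do w c h) s 1 s'"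
  unfolding runs_def using exec_Do by fastforce

text \<open>The invariant is the sequence \<open>S\<close> of the stores after 0, ..., N rounds, so
  that the final store comes out explicitly. A round costs one step for the test besides the
  body.\<close>

lemma runs_While:
  assumes "\<And>i. i < N \<Longrightarrow> rd (S i x) \<noteq> 0" "\<And>i. i < N \<Longrightarrow> runs a (S i) B (S (Suc i))"
    "rd (S N x) = 0"
  shows "runs (While x a) (S 0) (N * (B + 1) + 1) (S N)"
  using assms
proof (induction N arbitrary: S)
  case 0
  then show ?case by (auto simp: runs_def intro!: exI[of _ 1] exec_stop[unfolded One_nat_def[symmetric]])
next
  case (Suc N)
  have "runs (While x a) (S (Suc 0)) (N * (B + 1) + 1) (S (Suc N))"
    using Suc.prems Suc.IH[of "\<lambda>i. S (Suc i)"] by auto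
  then obtain n where n: "n \<le> N * (B + 1) + 1" "exec (While x a) (S (Suc 0)) n (S (Suc N))"
    by (auto simp: runs_def)
  obtain n' where n': "n' \<le> B" "exec a (S 0) n' (S (Suc 0))"
    using Suc.prems(2)[of 0] by (auto simp: runs_def)
  have "exec (While x a) (S 0) (Suc (n' + n)) (S (Suc N))"
    using Suc.prems(1)[of 0] n n' exec_loop by blast
  moreover have "Suc (n' + n) \<le> Suc N * (B + 1) + 1"
    using n n' by simp
  ultimately show ?case unfolding runs_def by blast
qed

lemma runs_Then_eq:
  "runs a s n s' \<Longrightarrow> runs b s' n' s'' \<Longrightarrow> n + n' = N \<Longrightarrow> runs (a ;; b) s N s''"
  using runs_Then by blast

text \<open>\<open>act\<close> writes before it moves: to push, the head must first step off the top
  and write afterwards, whereas \<open>pop\<close> can erase and retreat at once.\<close>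

definition push :: "nat \<Rightarrow> bool \<Rightarrow> cmd" where
  "push c b = Do c c (\<lambda>_ s. (s, Move_Right)) ;; Do c c (\<lambda>_ _. (bit_symbol b, Stay))"

definition push_if :: "(nat \<Rightarrow> bool) \<Rightarrow> nat \<Rightarrow> nat \<Rightarrow> cmd" where
  "push_if P w c = Do w c (\<lambda>a s. (s, if P a then Move_Right else Stay)) ;;
     Do w c (\<lambda>a s. (if P a then 2 else s, Stay))"

definition pop :: "nat \<Rightarrow> cmd" where
  "pop c = Do c c (\<lambda>_ s. (0, if s = 0 then Stay else Move_Left))"

definition go :: "nat \<Rightarrow> move \<Rightarrow> cmd" where
  "go w d = Do w w (\<lambda>_ s. (s, d))"

definition clear :: "nat \<Rightarrow> cmd" where
  "clear c = While c (pop c)"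

definition drain :: "nat \<Rightarrow> nat \<Rightarrow> cmd" where
  "drain k c = While k (pop k ;; push c True)"

text \<open>\<open>compile g c vs k\<close> pushes the output of \<open>g\<close> onto tape c; the variables are kept on the tapes
  given by \<open>vs\<close>, and the scratch tapes from k on are empty before and after.\<close>

fun compile :: "gen \<Rightarrow> nat \<Rightarrow> (nat \<Rightarrow> nat) \<Rightarrow> nat \<Rightarrow> cmd" where
  "compile (Emit b) c vs k = push c b"
| "compile (Cat g h) c vs k = compile g c vs k ;; compile h c vs k"
| "compile (Var v) c vs k =
     While (vs v) (pop (vs v) ;; push k True ;; push c True) ;; drain k (vs v)"
| "compile (Len w) c vs k =
     While w (go w Move_Right ;; push k True ;; push c True) ;;
     While k (pop k ;; go w Move_Left)"
| "compile (Bit w g) c vs k =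
     compile g k vs (k + 2) ;;
     While k (pop k ;; push (k + 1) True ;; go w Move_Right) ;;
     push_if (\<lambda>a. a = 2) w c ;;
     While (k + 1) (pop (k + 1) ;; go w Move_Left)"
| "compile (Monus g h) c vs k =
     compile g k vs (k + 2) ;; compile h (k + 1) vs (k + 2) ;;
     While (k + 1) (pop (k + 1) ;; pop k) ;; drain k c"
| "compile (For v g h) c vs k =
     compile g k vs (k + 2) ;;
     While k (pop k ;; compile h c (vs(v := k + 1)) (k + 2) ;; push (k + 1) True) ;;
     clear (k + 1)"
| "compile (Iter i v g0 b n h) c vs k =
     compile n k vs (k + 5) ;; compile g0 (k + 3) vs (k + 5) ;; drain (k + 3) (k + 2) ;;
     While k (pop k ;; compile h (k + 3) (vs(i := k + 1, v := k + 2)) (k + 5) ;;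
       compile b (k + 4) vs (k + 5) ;; (clear (k + 2) ;;
       While (k + 3) (pop (k + 3) ;; push_if (\<lambda>a. a \<noteq> 0) (k + 4) (k + 2) ;; pop (k + 4)) ;;
       clear (k + 4)) ;; push (k + 1) True) ;;
     clear (k + 1) ;; drain (k + 2) c"

fun scratch :: "gen \<Rightarrow> nat" where
  "scratch (Emit b) = 0"
| "scratch (Cat g h) = max (scratch g) (scratch h)"
| "scratch (Var v) = 1"
| "scratch (Len w) = 1"
| "scratch (Bit w g) = scratch g + 2"
| "scratch (Monus g h) = max (scratch g) (scratch h) + 2"
| "scratch (For v g h) = max (scratch g) (scratch h) + 2"
| "scratch (Iter i v g0 b n h) =
     max (max (scratch g0) (scratch b)) (max (scratch n) (scratch h)) + 5"

lemmas cmd_macro_defs = push_def push_if_def pop_def go_def clear_def drain_def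

lemma cmd_ok_compile: "cmd_ok (compile g c vs k)"
  by (induction g arbitrary: c vs k) (auto simp: cmd_macro_defs bit_symbol_def)

lemma cmd_tapes_compile:
  "c < K \<Longrightarrow> (\<And>v. vs v < K) \<Longrightarrow> k + scratch g \<le> K \<Longrightarrow> word_indices g \<subseteq> {..<K} \<Longrightarrow>
     cmd_tapes (compile g c vs k) \<subseteq> {..<K}"
proof (induction g arbitrary: c vs k)
  case (For v g h)
  have "cmd_tapes (compile g k vs (k + 2)) \<subseteq> {..<K}"
    "cmd_tapes (compile h c (vs(v := k + 1)) (k + 2)) \<subseteq> {..<K}"
    by (intro For.IH; use For.prems in auto)+
  with For.prems show ?case by (simp add: cmd_macro_defs)
next
  case (Iter i v g0 b n h)
  have "cmd_tapes (compile n k vs (k + 5)) \<subseteq> {..<K}"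
    "cmd_tapes (compile g0 (k + 3) vs (k + 5)) \<subseteq> {..<K}"
    "cmd_tapes (compile b (k + 4) vs (k + 5)) \<subseteq> {..<K}"
    "cmd_tapes (compile h (k + 3) (vs(i := k + 1, v := k + 2)) (k + 5)) \<subseteq> {..<K}"
    by (intro Iter.IH; use Iter.prems in auto)+
  with Iter.prems show ?case by (simp add: cmd_macro_defs)
qed (auto simp: cmd_macro_defs)

text \<open>A stack, read from left to right, that starts in the cell after b; the head is on its top.\<close>

definition stack_tape :: "int \<Rightarrow> bool list \<Rightarrow> tape" where
  "stack_tape b s = (\<lambda>p. if b < p \<and> p \<le> b + int (length s)
     then bit_symbol (s ! nat (p - b - 1)) else 0, b + int (length s))"

lemma rd_stack_tape: "rd (stack_tape b s) = (if s = [] then 0 else bit_symbol (last s))"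
proof (cases s rule: rev_cases)
  case (snoc s' a)
  have "nat (b + (1 + int (length s')) - b - 1) = length s'" by simp
  with snoc show ?thesis by (simp add: rd_def stack_tape_def)
qed (simp add: rd_def stack_tape_def)

lemma stack_tape_snoc:
  "stack_tape b (s @ [a]) =
     ((fst (stack_tape b s))(b + int (length s) + 1 := bit_symbol a), b + int (length s) + 1)"
  by (auto simp: stack_tape_def nth_append fun_eq_iff)

lemma bit_symbol_simps [simp]: "bit_symbol True = 2" "0 < bit_symbol b" "bit_symbol b \<noteq> 0"
  by (auto simp: bit_symbol_def)

lemma stack_tape_right:
  "act (rd (stack_tape b s), Move_Right) (stack_tape b s) =
     (fst (stack_tape b s), b + int (length s) + 1)"
  by (simp add: stack_tape_def rd_def fun_eq_iff)

lemma stack_tape_pop: "act (0, if s = [] then Stay else Move_Left) (stack_tape b s) = stack_tape b (butlast s)"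
proof (cases s rule: rev_cases)
  case (snoc s' a)
  then show ?thesis
    by (simp only: snoc stack_tape_snoc) (auto simp: stack_tape_def fun_eq_iff)
qed (simp add: stack_tape_def fun_eq_iff)

text \<open>Words on the first m tapes, with the heads at \<open>hp\<close>, and stacks on the others. The stack on
  tape \<open>out\<close> starts in cell 0, where the output of a machine is expected.\<close>

locale layout =
  fixes ws :: "bool list list" and m out :: nat
begin

definition conf :: "(nat \<Rightarrow> int) \<Rightarrow> (nat \<Rightarrow> bool list) \<Rightarrow> store" where
  "conf hp st = (\<lambda>i. if i < m then (fst (tape_of (ws ! i)), hp i)
     else stack_tape (if i = out then - 1 else 0) (st i))"

section \<open>Effect and cost of the basic tape operations\<close>

lemma rd_conf_stack: "m \<le> i \<Longrightarrow> rd (conf hp st i) = (if st i = [] then 0 else bit_symbol (last (st i)))"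
  by (simp add: conf_def rd_stack_tape)

lemma rd_conf_word:
  "w < m \<Longrightarrow> hp w = int p \<Longrightarrow>
     rd (conf hp st w) = (if p < length (ws ! w) then bit_symbol (ws ! w ! p) else 0)"
  by (simp add: conf_def rd_def tape_of_def)

lemma conf_upd_stack:
  "m \<le> c \<Longrightarrow> (conf hp st)(c := stack_tape (if c = out then - 1 else 0) s) = conf hp (st(c := s))"
  by (auto simp: conf_def fun_eq_iff)

lemma runs_push:
  assumes "m \<le> c"
  shows "runs (push c b) (conf hp st) 2 (conf hp (st(c := st c @ [b])))"
proof -
  let ?b = "if c = out then - 1 else 0 :: int"
  \<comment> \<open>Halfway through a push the head is on the blank above the stack; this tape is
    not a \<open>stack_tape\<close>.\<close>
  let ?t = "(fst (stack_tape ?b (st c)), ?b + int (length (st c)) + 1)"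
  have c: "conf hp st c = stack_tape ?b (st c)"
    using assms by (simp add: conf_def)
  have "runs (push c b) (conf hp st) (1 + 1)
      ((conf hp st)(c := stack_tape ?b (st c @ [b])))"
    unfolding push_def
  proof (rule runs_Then; rule runs_Do)
    show "(conf hp st)(c := ?t) =
        (conf hp st)(c := act (rd (conf hp st c), Move_Right) (conf hp st c))"
      by (simp only: c stack_tape_right)
  qed (simp only: stack_tape_snoc fun_upd_same fun_upd_upd act.simps move_head.simps)
  then show ?thesis
    using assms by (simp only: conf_upd_stack one_add_one)
qed

lemma runs_push_if:
  assumes "m \<le> c" "c \<noteq> w"
  shows "runs (push_if P w c) (conf hp st) 2
     (conf hp (if P (rd (conf hp st w)) then st(c := st c @ [True]) else st))"
proof (cases "P (rd (conf hp st w))")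
  case True
  let ?b = "if c = out then - 1 else 0 :: int"
  let ?t = "(fst (stack_tape ?b (st c)), ?b + int (length (st c)) + 1)"
  have c: "conf hp st c = stack_tape ?b (st c)"
    using assms by (simp add: conf_def)
  have "runs (push_if P w c) (conf hp st) (1 + 1)
      ((conf hp st)(c := stack_tape ?b (st c @ [True])))"
    unfolding push_if_def
  proof (rule runs_Then; rule runs_Do)
    show "(conf hp st)(c := ?t) =
        (conf hp st)(c := act (rd (conf hp st c), if P (rd (conf hp st w)) then Move_Right else Stay)
          (conf hp st c))"
      by (simp only: c stack_tape_right True refl if_True)
  qed (use assms True in \<open>simp only: stack_tape_snoc fun_upd_same fun_upd_other fun_upd_upd act.simps
      move_head.simps refl if_True bit_symbol_simps not_False_eq_True\<close>)
  then show ?thesis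
    using assms True by (simp only: conf_upd_stack one_add_one refl if_True)
next
  case False
  have "runs (push_if P w c) (conf hp st) (1 + 1) (conf hp st)"
    unfolding push_if_def
    by (rule runs_Then[where s' = "conf hp st"]; rule runs_Do) (simp_all add: False act_rd_Stay)
  then show ?thesis
    using False by (simp only: one_add_one if_False)
qed

lemma runs_pop:
  assumes "m \<le> c"
  shows "runs (pop c) (conf hp st) 1 (conf hp (st(c := butlast (st c))))"
proof -
  have "rd (conf hp st c) = 0 \<longleftrightarrow> st c = []"
    using assms by (simp add: rd_conf_stack)
  then show ?thesis
    unfolding pop_def conf_upd_stack[OF assms, symmetric] using assms
    by (intro runs_Do) (simp add: stack_tape_pop conf_def)
qed

lemma runs_go:
  assumes "w < m"
  shows "runs (go w d) (conf hp st) 1 (conf (hp(w := move_head d (hp w))) st)"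
  unfolding go_def by (rule runs_Do) (use assms in \<open>auto simp: conf_def rd_def fun_eq_iff\<close>)

lemma runs_clear:
  assumes "m \<le> c"
  shows "runs (clear c) (conf hp st) (2 * length (st c) + 1) (conf hp (st(c := [])))"
proof -
  let ?S = "\<lambda>i. conf hp (st(c := take (length (st c) - i) (st c)))"
  have "runs (While c (pop c)) (?S 0) (length (st c) * (1 + 1) + 1) (?S (length (st c)))"
  proof (rule runs_While[where S = ?S])
    fix i assume "i < length (st c)"
    then show "runs (pop c) (?S i) 1 (?S (Suc i))"
      using runs_pop[OF assms, of hp "st(c := take (length (st c) - i) (st c))"]
      by (simp add: butlast_take)
  qed (use assms in \<open>auto simp: rd_conf_stack\<close>)
  then show ?thesis by (simp add: clear_def mult_2 mult_2_right)
qed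

lemma runs_drain:
  assumes "m \<le> k" "m \<le> c" "k \<noteq> c"
  shows "runs (drain k c) (conf hp st) (4 * length (st k) + 1)
    (conf hp (st(k := [], c := st c @ replicate (length (st k)) True)))"
proof -
  let ?N = "length (st k)"
  let ?f = "\<lambda>i. st(k := take (?N - i) (st k), c := st c @ replicate i True)"
  let ?S = "\<lambda>i. conf hp (?f i)"
  have "runs (While k (pop k ;; push c True)) (?S 0) (?N * (3 + 1) + 1) (?S ?N)"
  proof (rule runs_While[where S = ?S])
    fix i assume i: "i < ?N"
    have "?f (Suc i) = (?f i)(k := butlast (?f i k), c := (?f i) c @ [True])"
      using i assms by (auto simp: butlast_take replicate_append_same fun_eq_iff)
    then show "runs (pop k ;; push c True) (?S i) 3 (?S (Suc i))"
      using runs_Then_eq[where N = 3, OF runs_pop[of k hp "?f i"] runs_push[of c True]] assms by simp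
  qed (use assms in \<open>auto simp: rd_conf_stack\<close>)
  then show ?thesis by (simp add: drain_def mult.commute)
qed

text \<open>The output tape may lie below the scratch tapes, as for subprograms, or beyond them, as
  for the last tape of a machine. Variables may share a tape as long as they have the same value;
  initially all of them are 0 and share one blank tape.\<close>

definition room :: "gen \<Rightarrow> nat \<Rightarrow> (nat \<Rightarrow> nat) \<Rightarrow> nat \<Rightarrow> (nat \<Rightarrow> nat) \<Rightarrow> (nat \<Rightarrow> bool list) \<Rightarrow> bool" where
  "room g c vs k \<rho> st \<longleftrightarrow> m \<le> k \<and> m \<le> c \<and> (c < k \<or> k + scratch g \<le> c) \<and>
     (\<forall>v. m \<le> vs v \<and> vs v < k \<and> vs v \<noteq> c \<and> st (vs v) = replicate (\<rho> v) True) \<and>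
     (\<forall>i. k \<le> i \<and> i < k + scratch g \<longrightarrow> st i = [])"

abbreviation "heads0 \<equiv> (\<lambda>_. 0) :: nat \<Rightarrow> int"

lemma runs_step:
  assumes "runs a (conf hp st) n (conf hp' st')" "runs b (conf hp' st') n' s"
  shows "runs (a ;; b) (conf hp st) (n + n') s"
  using assms by (rule runs_Then)

lemma runs_conf_eq: "runs a s n (conf hp st) \<Longrightarrow> n = n' \<Longrightarrow> st = st' \<Longrightarrow> runs a s n' (conf hp st')"
  by simp

text \<open>A stack can only be read by popping it, so the value is moved to tape k while it is
  output, and drained back afterwards.\<close>

lemma runs_Var:
  assumes "m \<le> k" "m \<le> c" "m \<le> u" "u \<noteq> k" "u \<noteq> c" "k \<noteq> c" "st k = []" "st u = replicate n True"
  shows "runs (While u (pop u ;; push k True ;; push c True) ;; drain k u)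
    (conf hp st) (10 * n + 2) (conf hp (st(c := st c @ replicate n True)))"
proof -
  let ?f = "\<lambda>i. st(u := replicate (n - i) True, k := replicate i True, c := st c @ replicate i True)"
  let ?S = "\<lambda>i. conf hp (?f i)"
  have "runs (While u (pop u ;; push k True ;; push c True)) (?S 0) (n * ((1 + (2 + 2)) + 1) + 1) (?S n)"
  proof (rule runs_While[where S = ?S])
    fix i assume i: "i < n"
    have "runs (pop u ;; push k True ;; push c True) (?S i) (1 + (2 + 2))
      (conf hp ((?f i)(u := butlast (?f i u), k := ?f i k @ [True], c := ?f i c @ [True])))"
      by (rule runs_conf_eq, (rule runs_step runs_pop runs_push assms)+)
        (use assms in \<open>auto simp: fun_eq_iff\<close>)
    moreover have "(?f i)(u := butlast (?f i u), k := ?f i k @ [True], c := ?f i c @ [True]) = ?f (Suc i)"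
      using i assms by (auto simp: fun_eq_iff replicate_append_same butlast_conv_take)
    ultimately show "runs (pop u ;; push k True ;; push c True) (?S i) (1 + (2 + 2)) (?S (Suc i))"
      by simp
  qed (use assms in \<open>auto simp: rd_conf_stack\<close>)
  moreover have "?S 0 = conf hp st"
    using assms by (intro arg_cong[where f = "conf hp"]) (auto simp: fun_eq_iff)
  ultimately have "runs (While u (pop u ;; push k True ;; push c True)) (conf hp st) (6 * n + 1) (?S n)"
    by (simp add: mult.commute)
  from runs_step[OF this runs_drain[of k u]] assms
  have "runs (While u (pop u ;; push k True ;; push c True) ;; drain k u) (conf hp st)
      (6 * n + 1 + (4 * n + 1))
      (conf hp ((?f n)(k := [], u := replicate n True)))"
    by simp
  moreover have "(?f n)(k := [], u := replicate n True) = st(c := st c @ replicate n True)"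
    using assms by (auto simp: fun_eq_iff)
  ultimately show ?thesis by (simp add: algebra_simps)
qed

text \<open>The height of stack k is the distance of the head on tape w from cell 0.\<close>

lemma runs_back:
  assumes "w < m" "m \<le> k" "hp w = int (length (st k))"
  shows "runs (While k (pop k ;; go w Move_Left)) (conf hp st) (3 * length (st k) + 1)
    (conf (hp(w := 0)) (st(k := [])))"
proof -
  let ?N = "length (st k)"
  let ?S = "\<lambda>i. conf (hp(w := int (?N - i))) (st(k := take (?N - i) (st k)))"
  have "runs (While k (pop k ;; go w Move_Left)) (?S 0) (?N * (2 + 1) + 1) (?S ?N)"
  proof (rule runs_While[where S = ?S])
    fix i assume i: "i < ?N"
    show "runs (pop k ;; go w Move_Left) (?S i) 2 (?S (Suc i))"
      using runs_Then_eq[where N = 2, OF runs_pop[of k "hp(w := int (?N - i))" "st(k := take (?N - i) (st k))"]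
          runs_go[of w Move_Left]] i assms by (simp add: butlast_take of_nat_diff algebra_simps)
  qed (use assms in \<open>auto simp: rd_conf_stack\<close>)
  moreover have "hp(w := int ?N) = hp" using assms by auto
  ultimately show ?thesis by (simp add: mult.commute)
qed

lemma runs_Len:
  assumes "w < m" "m \<le> k" "m \<le> c" "k \<noteq> c" "st k = []" "hp w = 0"
  shows "runs (While w (go w Move_Right ;; push k True ;; push c True) ;;
      While k (pop k ;; go w Move_Left)) (conf hp st) (9 * length (ws ! w) + 2)
    (conf hp (st(c := st c @ replicate (length (ws ! w)) True)))"
proof -
  let ?n = "length (ws ! w)"
  let ?f = "\<lambda>i. st(k := replicate i True, c := st c @ replicate i True)"
  let ?S = "\<lambda>i. conf (hp(w := int i)) (?f i)"
  have "runs (While w (go w Move_Right ;; push k True ;; push c True)) (?S 0)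
    (?n * ((1 + (2 + 2)) + 1) + 1) (?S ?n)"
  proof (rule runs_While[where S = ?S])
    fix i assume i: "i < ?n"
    then show "rd (?S i w) \<noteq> 0"
      using assms by (simp add: rd_conf_word[where p = i])
    have "runs (go w Move_Right ;; push k True ;; push c True) (?S i) (1 + (2 + 2))
      (conf (hp(w := int (Suc i))) ((?f i)(k := ?f i k @ [True], c := ?f i c @ [True])))"
      using runs_Then[OF runs_go[of w Move_Right "hp(w := int i)" "?f i"]
        runs_Then[OF runs_push[of k True] runs_push[of c True]]] assms
      by (simp add: add.commute)
    moreover have "(?f i)(k := ?f i k @ [True], c := ?f i c @ [True]) = ?f (Suc i)"
      using assms by (auto simp: fun_eq_iff replicate_append_same)
    ultimately show "runs (go w Move_Right ;; push k True ;; push c True) (?S i) (1 + (2 + 2)) (?S (Suc i))"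
      by simp
  next
    show "rd (?S ?n w) = 0"
      using assms by (simp add: rd_conf_word[where p = ?n])
  qed
  moreover have "?S 0 = conf hp st"
    using assms by (intro arg_cong2[where f = conf]) (auto simp: fun_eq_iff)
  ultimately have "runs (While w (go w Move_Right ;; push k True ;; push c True)) (conf hp st)
      (6 * ?n + 1) (?S ?n)"
    by (simp add: mult.commute)
  from runs_step[OF this runs_back[of w k]] assms
  have "runs (While w (go w Move_Right ;; push k True ;; push c True) ;;
      While k (pop k ;; go w Move_Left)) (conf hp st) (6 * ?n + 1 + (3 * ?n + 1))
      (conf (hp(w := 0)) ((?f ?n)(k := [])))"
    by simp
  moreover have "(?f ?n)(k := []) = st(c := st c @ replicate ?n True)" "hp(w := 0) = hp"
    using assms by (auto simp: fun_eq_iff)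
  ultimately show ?thesis by (simp add: algebra_simps)
qed

end

context layout begin

text \<open>The position, in unary on tape k, drives the head to the right while tape k + 1 counts
  the moves for the way back. Past the end of the word the head sees a blank, which differs from 2,
  so that positions out of range yield no output.\<close>

lemma runs_read_bit:
  assumes "w < m" "m \<le> k" "m \<le> c" "c \<noteq> k" "c \<noteq> Suc k" "st k = s" "st (Suc k) = []"
  shows "runs (While k (pop k ;; push (Suc k) True ;; go w Move_Right) ;;
     push_if (\<lambda>a. a = 2) w c ;; While (Suc k) (pop (Suc k) ;; go w Move_Left))
    (conf heads0 st) (8 * length s + 4)
    (conf heads0 (st(k := [],
       c := st c @ (if length s < length (ws ! w) \<and> ws ! w ! length s then [True] else []))))"
proof -
  let ?N = "length s"
  let ?f = "\<lambda>i. st(k := take (?N - i) s, Suc k := replicate i True)"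
  let ?h = "\<lambda>i. heads0(w := int i)"
  let ?S = "\<lambda>i. conf (?h i) (?f i)"
  let ?o = "if length s < length (ws ! w) \<and> ws ! w ! length s then [True] else []"
  have "runs (While k (pop k ;; push (Suc k) True ;; go w Move_Right)) (?S 0) (?N * (4 + 1) + 1) (?S ?N)"
  proof (rule runs_While[where S = ?S])
    fix i assume i: "i < ?N"
    have "?f (Suc i) = (?f i)(k := butlast (?f i k), Suc k := ?f i (Suc k) @ [True])"
      using i by (auto simp: fun_eq_iff replicate_append_same butlast_take)
    then show "runs (pop k ;; push (Suc k) True ;; go w Move_Right) (?S i) 4 (?S (Suc i))"
      using runs_Then_eq[where N = 4, OF runs_pop[of k "?h i" "?f i"]
        runs_Then_eq[where N = 3, OF runs_push[of "Suc k" True] runs_go[of w Move_Right]]] assms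
      by (simp add: add.commute)
  qed (use assms in \<open>auto simp: rd_conf_stack\<close>)
  moreover have "?S 0 = conf heads0 st"
    using assms by (intro arg_cong2[where f = conf]) (auto simp: fun_eq_iff)
  ultimately have 1: "runs (While k (pop k ;; push (Suc k) True ;; go w Move_Right))
      (conf heads0 st) (5 * ?N + 1) (?S ?N)"
    by (simp add: mult.commute)
  have "rd (?S ?N w) = 2 \<longleftrightarrow> ?o = [True]"
    using assms(1) by (simp add: rd_conf_word[where p = ?N] bit_symbol_def)
  then have "(if rd (?S ?N w) = 2 then (?f ?N)(c := ?f ?N c @ [True]) else ?f ?N)
      = (?f ?N)(c := ?f ?N c @ ?o)"
    by (auto simp: fun_eq_iff)
  then have 2: "runs (push_if (\<lambda>a. a = 2) w c) (?S ?N) 2 (conf (?h ?N) ((?f ?N)(c := ?f ?N c @ ?o)))"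
    using runs_push_if[of c w "\<lambda>a. a = 2" "?h ?N" "?f ?N"] assms by simp
  have 3: "runs (While (Suc k) (pop (Suc k) ;; go w Move_Left))
      (conf (?h ?N) ((?f ?N)(c := ?f ?N c @ ?o))) (3 * ?N + 1)
      (conf heads0 ((?f ?N)(c := ?f ?N c @ ?o, Suc k := [])))"
    using runs_back[of w "Suc k" "?h ?N" "(?f ?N)(c := ?f ?N c @ ?o)"] assms
    by (simp add: fun_upd_idem split del: if_split)
  have "(?f ?N)(c := ?f ?N c @ ?o, Suc k := []) = st(k := [], c := st c @ ?o)"
    using assms by (auto simp: fun_eq_iff)
  then show ?thesis
    using runs_Then_eq[OF 1 runs_Then_eq[OF 2 3], where N = "8 * ?N + 4"] by simp
qed

lemma runs_monus:
  assumes "m \<le> k" "m \<le> l" "m \<le> c" "distinct [k, l, c]"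
  shows "runs (While l (pop l ;; pop k) ;; drain k c) (conf hp st)
    (3 * length (st l) + 4 * length (st k) + 2)
    (conf hp (st(k := [], l := [], c := st c @ replicate (length (st k) - length (st l)) True)))"
proof -
  let ?M = "length (st k)" and ?N = "length (st l)"
  let ?f = "\<lambda>i. st(k := take (?M - i) (st k), l := take (?N - i) (st l))"
  let ?S = "\<lambda>i. conf hp (?f i)"
  have "runs (While l (pop l ;; pop k)) (?S 0) (?N * (2 + 1) + 1) (?S ?N)"
  proof (rule runs_While[where S = ?S])
    fix i assume i: "i < ?N"
    have "?f (Suc i) = (?f i)(l := butlast (?f i l), k := butlast (?f i k))"
      using i assms by (auto simp: fun_eq_iff butlast_take)
    then show "runs (pop l ;; pop k) (?S i) 2 (?S (Suc i))"
      using runs_Then_eq[where N = 2, OF runs_pop[of l hp "?f i"] runs_pop[of k]] assms by simp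
  qed (use assms in \<open>auto simp: rd_conf_stack\<close>)
  then have 1: "runs (While l (pop l ;; pop k)) (conf hp st) (3 * ?N + 1) (?S ?N)"
    by (simp add: mult.commute)
  have 2: "runs (drain k c) (?S ?N) (4 * (?M - ?N) + 1)
      (conf hp (st(k := [], l := [], c := st c @ replicate (?M - ?N) True)))"
    using runs_drain[of k c hp "?f ?N"] assms by (simp add: fun_upd_twist)
  show ?thesis
    using runs_mono[OF runs_Then[OF 1 2]] by simp
qed

text \<open>Each round pops y and adds a mark to x only while z is not exhausted. \<open>pop\<close>
  leaves an empty stack alone, so z may run out first; the final \<open>clear z\<close> handles the
  opposite case.\<close>

lemma runs_min:
  assumes "m \<le> x" "m \<le> y" "m \<le> z" "distinct [x, y, z]"
  shows "runs (clear x ;; While y (pop y ;; push_if (\<lambda>a. a \<noteq> 0) z x ;; pop z) ;; clear z) (conf hp st)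
    (2 * length (st x) + 5 * length (st y) + 2 * length (st z) + 3)
    (conf hp (st(x := replicate (min (length (st z)) (length (st y))) True, y := [], z := [])))"
proof -
  let ?M = "length (st z)" and ?N = "length (st y)"
  let ?f = "\<lambda>i. st(x := replicate (min ?M i) True, y := take (?N - i) (st y), z := take (?M - i) (st z))"
  let ?S = "\<lambda>i. conf hp (?f i)"
  have "runs (While y (pop y ;; push_if (\<lambda>a. a \<noteq> 0) z x ;; pop z)) (?S 0) (?N * (4 + 1) + 1) (?S ?N)"
  proof (rule runs_While[where S = ?S])
    fix i assume i: "i < ?N"
    let ?g = "(?f i)(y := butlast (?f i y))"
    let ?g' = "if i < ?M then ?g(x := ?g x @ [True]) else ?g"
    have "rd (conf hp ?g z) \<noteq> 0 \<longleftrightarrow> i < ?M"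
      using assms by (auto simp: rd_conf_stack)
    then have *: "runs (push_if (\<lambda>a. a \<noteq> 0) z x) (conf hp ?g) 2 (conf hp ?g')"
      using runs_push_if[of x z "\<lambda>a. a \<noteq> 0" hp ?g] assms by (simp only: distinct.simps list.set) simp
    have "min ?M (Suc i) = (if i < ?M then Suc (min ?M i) else min ?M i)"
      by simp
    then have "?f (Suc i) = ?g'(z := butlast (?g' z))"
      using i assms by (auto simp: fun_eq_iff butlast_take replicate_append_same)
    then show "runs (pop y ;; push_if (\<lambda>a. a \<noteq> 0) z x ;; pop z) (?S i) 4 (?S (Suc i))"
      using runs_Then_eq[where N = 4, OF runs_pop[of y hp "?f i"]
        runs_Then_eq[where N = 3, OF * runs_pop[of z hp ?g']]] assms
      by (simp del: fun_upd_apply)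
  qed (use assms in \<open>auto simp: rd_conf_stack\<close>)
  moreover have "?f 0 = st(x := [])"
    using assms by (auto simp: fun_eq_iff)
  ultimately have 2: "runs (While y (pop y ;; push_if (\<lambda>a. a \<noteq> 0) z x ;; pop z))
      (conf hp (st(x := []))) (5 * ?N + 1) (?S ?N)"
    by (simp add: mult.commute)
  have 3: "runs (clear z) (?S ?N) (2 * (?M - ?N) + 1)
      (conf hp (st(x := replicate (min ?M ?N) True, y := [], z := [])))"
    using runs_clear[of z hp "?f ?N"] assms by simp
  show ?thesis
    using runs_mono[OF runs_Then[OF runs_clear[of x hp st] runs_Then[OF 2 3]]] assms by simp
qed

text \<open>The contents of the output tape, the assignment of tapes to variables and the bound L
  are all general: loop bodies append to what earlier rounds wrote, with rebound variables and under
  a larger bound.\<close>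

lemma runs_compile:
  assumes "room g c vs k \<rho> st" "word_indices g \<subseteq> {..<m}" "\<And>v. \<rho> v \<le> L"
    "\<And>w. w < m \<Longrightarrow> length (ws ! w) \<le> L"
  shows "runs (compile g c vs k) (conf heads0 st) (poly (time_bound g) L)
    (conf heads0 (st(c := st c @ sem ws \<rho> g)))"
  using assms
proof (induction g arbitrary: c vs k \<rho> st L)
  case (Emit b)
  then show ?case
    using runs_push[of c b heads0 st] by (simp add: room_def fun_upd_def)
next
  case (Cat g h)
  have 1: "runs (compile g c vs k) (conf heads0 st) (poly (time_bound g) L)
    (conf heads0 (st(c := st c @ sem ws \<rho> g)))"
    using Cat.prems by (intro Cat.IH(1)) (auto simp: room_def)
  have "runs (compile h c vs k) (conf heads0 (st(c := st c @ sem ws \<rho> g))) (poly (time_bound h) L)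
    (conf heads0 (st(c := st c @ sem ws \<rho> g, c := (st(c := st c @ sem ws \<rho> g)) c @ sem ws \<rho> h)))"
    using Cat.prems by (intro Cat.IH(2)) (auto simp: room_def)
  from runs_Then[OF 1 this] show ?case by (simp, simp add: fun_upd_def)
next
  case (Var v)
  then have "runs (compile (Var v) c vs k) (conf heads0 st) (10 * \<rho> v + 2)
    (conf heads0 (st(c := st c @ replicate (\<rho> v) True)))"
    unfolding compile.simps by (intro runs_Var) (auto simp: room_def)
  then show ?case
    by (rule runs_conf_eq[OF runs_mono]) (use Var.prems(3)[of v] in auto)
next
  case (Len w)
  then have "runs (compile (Len w) c vs k) (conf heads0 st) (9 * length (ws ! w) + 2)
    (conf heads0 (st(c := st c @ replicate (length (ws ! w)) True)))"
    unfolding compile.simps by (intro runs_Len) (auto simp: room_def)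
  then show ?case
    by (rule runs_conf_eq[OF runs_mono]) (use Len.prems in auto)
next
  case (Bit w g)
  let ?s = "sem ws \<rho> g"
  have s: "length ?s \<le> poly (len_bound g) L"
    using Bit.prems by (intro sem_length_le) auto
  have 1: "runs (compile g k vs (k + 2)) (conf heads0 st) (poly (time_bound g) L)
      (conf heads0 (st(k := st k @ ?s)))"
    using Bit.prems by (intro Bit.IH) (auto simp: room_def trans_less_add1 less_imp_neq less_SucI)
  have "st k = []" using Bit.prems by (simp add: room_def)
  with 1 have 1: "runs (compile g k vs (k + 2)) (conf heads0 st) (poly (time_bound g) L)
      (conf heads0 (st(k := ?s)))" by simp
  have "runs (While k (pop k ;; push (Suc k) True ;; go w Move_Right) ;;
     push_if (\<lambda>a. a = 2) w c ;; While (Suc k) (pop (Suc k) ;; go w Move_Left))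
    (conf heads0 (st(k := ?s))) (8 * length ?s + 4)
    (conf heads0 (st(k := ?s, k := [], c := (st(k := ?s)) c @ sem ws \<rho> (Bit w g))))"
    unfolding sem.simps Let_def using Bit.prems by (intro runs_read_bit) (auto simp: room_def)
  moreover have "st(k := ?s, k := [], c := (st(k := ?s)) c @ sem ws \<rho> (Bit w g)) =
      st(c := st c @ sem ws \<rho> (Bit w g))"
    using Bit.prems by (auto simp: room_def fun_eq_iff)
  ultimately have "runs (compile (Bit w g) c vs k) (conf heads0 st)
      (poly (time_bound g) L + (8 * length ?s + 4)) (conf heads0 (st(c := st c @ sem ws \<rho> (Bit w g))))"
    using runs_Then[OF 1] by simp
  then show ?case
    by (rule runs_mono) (use s in simp)
next
  case (Monus g h)
  let ?s = "sem ws \<rho> g" and ?t = "sem ws \<rho> h"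
  have s: "length ?s \<le> poly (len_bound g) L" "length ?t \<le> poly (len_bound h) L"
    using Monus.prems by (auto intro!: sem_length_le)
  have e: "st k = []" "st (Suc k) = []" using Monus.prems by (auto simp: room_def)
  have 1: "runs (compile g k vs (k + 2)) (conf heads0 st) (poly (time_bound g) L)
      (conf heads0 (st(k := st k @ ?s)))"
    using Monus.prems by (intro Monus.IH) (auto simp: room_def trans_less_add1 less_imp_neq less_SucI)
  have 2: "runs (compile h (k + 1) vs (k + 2)) (conf heads0 (st(k := ?s))) (poly (time_bound h) L)
      (conf heads0 (st(k := ?s, k + 1 := (st(k := ?s)) (k + 1) @ ?t)))"
    using Monus.prems by (intro Monus.IH) (auto simp: room_def trans_less_add1 less_imp_neq less_SucI)
  let ?st = "st(k := ?s, k + 1 := ?t)"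
  have "runs (While (k + 1) (pop (k + 1) ;; pop k) ;; drain k c) (conf heads0 ?st)
    (3 * length (?st (k + 1)) + 4 * length (?st k) + 2)
    (conf heads0 (?st(k := [], k + 1 := [],
       c := ?st c @ replicate (length (?st k) - length (?st (k + 1))) True)))"
    using Monus.prems by (intro runs_monus) (auto simp: room_def)
  moreover have "?st(k := [], k + 1 := [],
       c := ?st c @ replicate (length (?st k) - length (?st (k + 1))) True) =
      st(c := st c @ sem ws \<rho> (Monus g h))"
    using Monus.prems e by (auto simp: room_def fun_eq_iff)
  ultimately have 3: "runs (While (k + 1) (pop (k + 1) ;; pop k) ;; drain k c) (conf heads0 ?st)
    (3 * length ?t + 4 * length ?s + 2) (conf heads0 (st(c := st c @ sem ws \<rho> (Monus g h))))"
    by simp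
  have "runs (compile (Monus g h) c vs k) (conf heads0 st)
      (poly (time_bound g) L + (poly (time_bound h) L + (3 * length ?t + 4 * length ?s + 2)))
      (conf heads0 (st(c := st c @ sem ws \<rho> (Monus g h))))"
    unfolding compile.simps by (rule runs_Then[OF _ runs_Then[OF _ 3]]) (use 1 2 e in simp_all)
  then show ?case
    by (rule runs_mono) (use s in simp)
next
  case (For v g h)
  let ?s = "sem ws \<rho> g"
  let ?N = "length ?s" and ?L = "L + poly (len_bound g) L"
  let ?o = "\<lambda>i. concat (map (\<lambda>i. sem ws (\<rho>(v := i)) h) [0..<i])"
  have s: "?N \<le> poly (len_bound g) L"
    using For.prems by (intro sem_length_le) auto
  have 1: "runs (compile g k vs (k + 2)) (conf heads0 st) (poly (time_bound g) L)
      (conf heads0 (st(k := st k @ ?s)))"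
    using For.prems by (intro For.IH) (auto simp: room_def trans_less_add1 less_imp_neq less_SucI)
  have e: "st k = []" "st (k + 1) = []" using For.prems by (auto simp: room_def)
  let ?f = "\<lambda>i. st(k := take (?N - i) ?s, k + 1 := replicate i True, c := st c @ ?o i)"
  let ?S = "\<lambda>i. conf heads0 (?f i)"
  let ?body = "pop k ;; compile h c (vs(v := k + 1)) (k + 2) ;; push (k + 1) True"
  let ?T = "poly (time_bound h) ?L + 3"
  have c: "c \<noteq> k" "c \<noteq> Suc k" "m \<le> k" using For.prems by (auto simp: room_def)
  have "runs (While k ?body) (?S 0) (?N * (?T + 1) + 1) (?S ?N)"
  proof (rule runs_While[where S = ?S])
    fix i assume i: "i < ?N"
    let ?g = "(?f i)(k := butlast (?f i k))"
    have 2: "runs (compile h c (vs(v := k + 1)) (k + 2)) (conf heads0 ?g) (poly (time_bound h) ?L)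
       (conf heads0 (?g(c := ?g c @ sem ws (\<rho>(v := i)) h)))"
    proof (rule For.IH)
      show "room h c (vs(v := k + 1)) (k + 2) (\<rho>(v := i)) ?g"
        using For.prems(1) by (auto simp: room_def less_imp_neq less_SucI)
      show "(\<rho>(v := i)) u \<le> ?L" for u
        using For.prems(3)[of u] i s by (auto intro: trans_le_add1)
      show "length (ws ! w) \<le> ?L" if "w < m" for w
        using For.prems(4)[OF that] by simp
    qed (use For.prems in auto)
    let ?g' = "?g(c := ?g c @ sem ws (\<rho>(v := i)) h)"
    have "?f (Suc i) = ?g'(k + 1 := ?g' (k + 1) @ [True])"
      using c i by (auto simp: fun_eq_iff butlast_take replicate_append_same)
    then show "runs ?body (?S i) ?T (?S (Suc i))"
      using runs_Then_eq[where N = ?T, OF runs_pop[of k heads0 "?f i"]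
          runs_Then[OF 2 runs_push[of "k + 1" True]]] c
      by (simp del: fun_upd_apply)
  qed (use c in \<open>auto simp: rd_conf_stack\<close>)
  moreover have "?f 0 = st(k := ?s)"
    using c e by (auto simp: fun_eq_iff)
  ultimately have 2: "runs (While k ?body) (conf heads0 (st(k := ?s))) (?N * (?T + 1) + 1) (?S ?N)"
    by (simp only: )
  have "runs (clear (k + 1)) (?S ?N) (2 * length (?f ?N (k + 1)) + 1)
      (conf heads0 ((?f ?N)(k + 1 := [])))"
    using c by (intro runs_clear) simp
  moreover have "(?f ?N)(k + 1 := []) = st(c := st c @ sem ws \<rho> (For v g h))"
    using c e by (auto simp: fun_eq_iff)
  ultimately have 3: "runs (clear (k + 1)) (?S ?N) (2 * ?N + 1)
      (conf heads0 (st(c := st c @ sem ws \<rho> (For v g h))))"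
    using c by simp
  have "runs (compile (For v g h) c vs k) (conf heads0 st)
      (poly (time_bound g) L + ((?N * (?T + 1) + 1) + (2 * ?N + 1)))
      (conf heads0 (st(c := st c @ sem ws \<rho> (For v g h))))"
    unfolding compile.simps by (intro runs_Then[OF 1] runs_Then[OF _ 3]) (use 2 e in simp)
  moreover have "?N * (?T + 1) \<le> poly (len_bound g) L * (?T + 1)"
    using s by (rule mult_le_mono1)
  ultimately show ?case
    by (elim runs_mono) (use s in \<open>simp add: poly_pcompose algebra_simps\<close>)
next
  case (Iter i v g0 b n h)
  let ?s = "sem ws \<rho> n" and ?init = "sem ws \<rho> g0" and ?b = "sem ws \<rho> b"
  let ?h = "\<lambda>j x. sem ws (\<rho>(i := j, v := x)) h"
  define X where "X = rec_nat (length ?init) (\<lambda>j x. min (length ?b) (length (?h j x)))"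
  let ?N = "length ?s"
  let ?L = "L + poly (len_bound n) L + poly (len_bound g0) L + poly (len_bound b) L"
  have len: "?N \<le> poly (len_bound n) L" "length ?init \<le> poly (len_bound g0) L"
      "length ?b \<le> poly (len_bound b) L"
    by (intro sem_length_le; use Iter.prems in auto)+
  have X: "X j \<le> length ?init + length ?b" for j
    unfolding X_def by (rule rec_nat_min_le)
  have e: "st k = []" "st (k + 1) = []" "st (k + 2) = []" "st (k + 3) = []" "st (k + 4) = []"
    using Iter.prems by (auto simp: room_def)
  have c: "c \<noteq> k" "c \<noteq> k + 1" "c \<noteq> k + 2" "c \<noteq> k + 3" "c \<noteq> k + 4" "m \<le> k" "m \<le> c"
    using Iter.prems by (auto simp: room_def)
  have vs: "m \<le> vs u" "vs u < k" "vs u \<noteq> c" "st (vs u) = replicate (\<rho> u) True" for u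
    using Iter.prems by (auto simp: room_def)
  have vs_neq: "vs u \<noteq> k + a" "vs u \<noteq> k" "vs u \<noteq> Suc k" "vs u \<noteq> Suc (Suc k)" for u a
    using vs(2)[of u] by auto
  have free: "st u = []" if "k \<le> u" "u < k + scratch (Iter i v g0 b n h)" for u
    using Iter.prems(1) that unfolding room_def by blast
  have 1: "runs (compile n k vs (k + 5)) (conf heads0 st) (poly (time_bound n) L)
      (conf heads0 (st(k := st k @ ?s)))"
    using Iter.prems(2-) vs vs_neq c free by (intro Iter.IH) (auto simp: room_def trans_less_add1)
  have 2: "runs (compile g0 (k + 3) vs (k + 5)) (conf heads0 (st(k := ?s))) (poly (time_bound g0) L)
      (conf heads0 (st(k := ?s, k + 3 := (st(k := ?s)) (k + 3) @ ?init)))"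
    using Iter.prems(2-) vs vs_neq c free by (intro Iter.IH) (auto simp: room_def trans_less_add1)
  have "runs (drain (k + 3) (k + 2)) (conf heads0 (st(k := ?s, k + 3 := ?init))) (4 * length ?init + 1)
      (conf heads0 (st(k := ?s, k + 3 := [], k + 2 := replicate (X 0) True)))"
    using runs_drain[of "k + 3" "k + 2" heads0 "st(k := ?s, k + 3 := ?init)"] c e by (simp add: X_def)
  moreover have "st(k := ?s, k + 3 := [], k + 2 := replicate (X 0) True) =
      st(k := ?s, k + 2 := replicate (X 0) True)"
    using e by (auto simp: fun_eq_iff)
  ultimately have 3: "runs (drain (k + 3) (k + 2)) (conf heads0 (st(k := ?s, k + 3 := ?init)))
      (4 * length ?init + 1) (conf heads0 (st(k := ?s, k + 2 := replicate (X 0) True)))"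
    by simp
  \<comment> \<open>Tape k counts the remaining rounds, k + 1 holds the index and k + 2 the value;
    within a round, k + 3 and k + 4 take the outputs of h and b.\<close>
  let ?f = "\<lambda>j. st(k := take (?N - j) ?s, k + 1 := replicate j True, k + 2 := replicate (X j) True)"
  let ?S = "\<lambda>j. conf heads0 (?f j)"
  let ?min = "clear (k + 2) ;;
     While (k + 3) (pop (k + 3) ;; push_if (\<lambda>a. a \<noteq> 0) (k + 4) (k + 2) ;; pop (k + 4)) ;;
     clear (k + 4)"
  let ?body = "pop k ;; compile h (k + 3) (vs(i := k + 1, v := k + 2)) (k + 5) ;;
     compile b (k + 4) vs (k + 5) ;; ?min ;; push (k + 1) True"
  let ?T = "poly (time_bound h) ?L + poly (time_bound b) L + 5 * poly (len_bound h) ?L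
    + 2 * poly (len_bound g0) L + 4 * poly (len_bound b) L + 6"
  have loop: "runs (While k ?body) (?S 0) (?N * (?T + 1) + 1) (?S ?N)"
  proof (rule runs_While[where S = ?S])
    fix j assume j: "j < ?N"
    let ?\<rho> = "\<rho>(i := j, v := X j)"
    let ?g = "(?f j)(k := butlast (?f j k))"
    have \<rho>: "?\<rho> u \<le> ?L" for u
      using Iter.prems(3)[of u] j len X[of j] by auto
    have L: "length (ws ! w) \<le> ?L" if "w < m" for w
      using Iter.prems(4)[OF that] by simp
    have h: "length (?h j (X j)) \<le> poly (len_bound h) ?L"
      using Iter.prems(2) \<rho> L by (intro sem_length_le) auto
    have "room h (k + 3) (vs(i := k + 1, v := k + 2)) (k + 5) ?\<rho> ?g"
      using vs vs_neq c free by (auto simp: room_def trans_less_add1)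
    then have b1: "runs (compile h (k + 3) (vs(i := k + 1, v := k + 2)) (k + 5)) (conf heads0 ?g)
       (poly (time_bound h) ?L) (conf heads0 (?g(k + 3 := ?g (k + 3) @ ?h j (X j))))"
    proof (rule Iter.IH(4)[OF _ _ \<rho> L])
      show "word_indices h \<subseteq> {..<m}" using Iter.prems(2) by simp
    qed
    let ?g1 = "?g(k + 3 := ?h j (X j))"
    have "room b (k + 4) vs (k + 5) \<rho> ?g1"
      using vs vs_neq c free by (auto simp: room_def trans_less_add1)
    then have b2: "runs (compile b (k + 4) vs (k + 5)) (conf heads0 ?g1)
       (poly (time_bound b) L) (conf heads0 (?g1(k + 4 := ?g1 (k + 4) @ ?b)))"
    proof (rule Iter.IH(2)[OF _ _ Iter.prems(3,4)])
      show "word_indices b \<subseteq> {..<m}" using Iter.prems(2) by simp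
    qed
    let ?g2 = "?g1(k + 4 := ?b)"
    have "runs ?min (conf heads0 ?g2)
      (2 * length (?g2 (k + 2)) + 5 * length (?g2 (k + 3)) + 2 * length (?g2 (k + 4)) + 3)
      (conf heads0 (?g2(k + 2 := replicate (min (length (?g2 (k + 4))) (length (?g2 (k + 3)))) True,
         k + 3 := [], k + 4 := [])))"
      using c by (intro runs_min) auto
    moreover have "?g2(k + 2 := replicate (min (length (?g2 (k + 4))) (length (?g2 (k + 3)))) True,
         k + 3 := [], k + 4 := []) = ?g(k + 2 := replicate (X (Suc j)) True)"
      using e by (auto simp: fun_eq_iff X_def)
    ultimately have b3: "runs ?min (conf heads0 ?g2)
      (2 * X j + 5 * length (?h j (X j)) + 2 * length ?b + 3)
      (conf heads0 (?g(k + 2 := replicate (X (Suc j)) True)))"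
      by simp
    have b4: "runs (push (k + 1) True) (conf heads0 (?g(k + 2 := replicate (X (Suc j)) True))) 2
      (conf heads0 (?g(k + 2 := replicate (X (Suc j)) True, k + 1 := replicate (Suc j) True)))"
      using runs_push[of "k + 1" True heads0 "?g(k + 2 := replicate (X (Suc j)) True)"] c
      by (simp add: replicate_append_same)
    have "?g(k + 2 := replicate (X (Suc j)) True, k + 1 := replicate (Suc j) True) = ?f (Suc j)"
      using j by (auto simp: fun_eq_iff butlast_take)
    with b4 have b4: "runs (push (k + 1) True)
       (conf heads0 (?g(k + 2 := replicate (X (Suc j)) True))) 2 (?S (Suc j))"
      by simp
    have "runs ?body (?S j) (1 + (poly (time_bound h) ?L + (poly (time_bound b) L +
       ((2 * X j + 5 * length (?h j (X j)) + 2 * length ?b + 3) + 2)))) (?S (Suc j))"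
      by (rule runs_Then[OF _ runs_Then[OF _ runs_Then[OF _ runs_Then[OF b3 b4]]]])
        (use b1 b2 runs_pop[of k heads0 "?f j"] c e in simp_all)
    then show "runs ?body (?S j) ?T (?S (Suc j))"
      by (rule runs_mono) (use len X[of j] h in linarith)
  qed (use c in \<open>auto simp: rd_conf_stack\<close>)
  have "?f 0 = st(k := ?s, k + 2 := replicate (X 0) True)"
    using e by (auto simp: fun_eq_iff)
  with loop have 4: "runs (While k ?body) (conf heads0 (st(k := ?s, k + 2 := replicate (X 0) True)))
      (?N * (?T + 1) + 1) (?S ?N)"
    by simp
  have 5: "runs (clear (k + 1)) (?S ?N) (2 * ?N + 1) (conf heads0 ((?f ?N)(k + 1 := [])))"
    using runs_clear[of "k + 1" heads0 "?f ?N"] c by simp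
  have "runs (drain (k + 2) c) (conf heads0 ((?f ?N)(k + 1 := []))) (4 * X ?N + 1)
     (conf heads0 ((?f ?N)(k + 1 := [], k + 2 := [], c := st c @ replicate (X ?N) True)))"
    using runs_drain[of "k + 2" c heads0 "(?f ?N)(k + 1 := [])"] c by simp
  moreover have "(?f ?N)(k + 1 := [], k + 2 := [], c := st c @ replicate (X ?N) True) =
      st(c := st c @ sem ws \<rho> (Iter i v g0 b n h))"
    using c e by (auto simp: fun_eq_iff X_def)
  ultimately have 6: "runs (drain (k + 2) c) (conf heads0 ((?f ?N)(k + 1 := []))) (4 * X ?N + 1)
      (conf heads0 (st(c := st c @ sem ws \<rho> (Iter i v g0 b n h))))"
    by simp
  have "runs (compile (Iter i v g0 b n h) c vs k) (conf heads0 st)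
      (poly (time_bound n) L + (poly (time_bound g0) L + ((4 * length ?init + 1) +
        ((?N * (?T + 1) + 1) + ((2 * ?N + 1) + (4 * X ?N + 1))))))
      (conf heads0 (st(c := st c @ sem ws \<rho> (Iter i v g0 b n h))))"
    unfolding compile.simps
    by (rule runs_Then[OF _ runs_Then[OF _ runs_Then[OF 3 runs_Then[OF 4 runs_Then[OF 5 6]]]]])
      (use 1 2 e in simp_all)
  \<comment> \<open>Stated for separate natural numbers, so that the nonlinear cost of the loop
    enters as the single quantity A, bounded by B, and the rest is linear.\<close>
  moreover have arith: "tn + (tg + ((4 * I + 1) + ((A + 1) + ((2 * N + 1) + (4 * x + 1))))) \<le> Q"
    if "A \<le> B" "N \<le> n" "I \<le> g" "x \<le> I + c" "c \<le> d"
      "Q = tn + tg + 4 * g + B + 2 * n + 4 * (g + d) + 4" for tn tg I A B N x n g c d Q :: nat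
    using that(1-5) unfolding that(6) by arith
  moreover have "?N * (?T + 1) \<le> poly (len_bound n) L * (?T + 1)"
    using len(1) by (rule mult_le_mono1)
  moreover have "poly (time_bound (Iter i v g0 b n h)) L =
      poly (time_bound n) L + poly (time_bound g0) L + 4 * poly (len_bound g0) L +
      poly (len_bound n) L * (?T + 1) + 2 * poly (len_bound n) L +
      4 * (poly (len_bound g0) L + poly (len_bound b) L) + 4"
    by (simp add: poly_pcompose algebra_simps)
  ultimately show ?case
    by (elim runs_mono) (rule arith[OF _ len(1,2) X len(3)])
qed

end

text \<open>The output has to start in cell 0, where the head is at first. One move to the left
  turns the blank tape into the empty stack that begins there.\<close>

definition machine :: "nat \<Rightarrow> gen \<Rightarrow> cmd" where
  "machine m g = (let out = m + 1 + scratch g in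
     go out Move_Left ;; compile g out (\<lambda>_. m) (m + 1))"

lemma cmd_tapes_machine:
  assumes "word_indices g \<subseteq> {..<m}"
  shows "cmd_tapes (machine m g) \<subseteq> {..<m + 2 + scratch g}"
proof -
  have "word_indices g \<subseteq> {..<m + 2 + scratch g}"
    using assms by (rule order_trans) auto
  then have "cmd_tapes (compile g (m + 1 + scratch g) (\<lambda>_. m) (m + 1)) \<subseteq> {..<m + 2 + scratch g}"
    by (intro cmd_tapes_compile) simp_all
  then show ?thesis by (simp add: machine_def go_def Let_def)
qed

context layout begin

lemma machine_computes:
  assumes "word_indices g \<subseteq> {..<m}" "length ws = m" "out = m + 1 + scratch g"
  shows "computes_within (tm_of (m + 2 + scratch g) (machine m g))
    ws (sem ws (\<lambda>_. 0) g) (poly (time_bound g + 1) (sum_list (map length ws)))"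
proof -
  define L where "L = sum_list (map length ws)"
  let ?s = "\<lambda>i. tape_of (if i < length ws then ws ! i else [])"
  let ?o = "sem ws (\<lambda>_. 0) g"
  have blank: "tape_of [] = stack_tape 0 []"
    by (auto simp: tape_of_def stack_tape_def fun_eq_iff)
  have start: "act (rd (?s out), Move_Left) (?s out) = stack_tape (-1) []"
    using assms(2,3) by (auto simp: tape_of_def stack_tape_def fun_eq_iff rd_def)
  have others: "?s i = conf heads0 (\<lambda>_. []) i" if "i \<noteq> out" for i
    using that by (cases "i < m") (simp_all add: conf_def blank prod_eq_iff assms(2), simp add: tape_of_def)
  have outt: "conf heads0 (\<lambda>_. []) out = stack_tape (- 1) []"
    unfolding conf_def using assms(3) by simp
  have "conf heads0 (\<lambda>_. []) = ?s(out := act (rd (?s out), Move_Left) (?s out))"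
  proof
    fix i
    show "conf heads0 (\<lambda>_. []) i = (?s(out := act (rd (?s out), Move_Left) (?s out))) i"
      using others[of i] unfolding start outt[symmetric] by (cases "i = out") simp_all
  qed
  then have 1: "runs (go out Move_Left) ?s 1 (conf heads0 (\<lambda>_. []))"
    unfolding go_def by (rule runs_Do)
  have "runs (compile g out (\<lambda>_. m) (m + 1)) (conf heads0 (\<lambda>_. [])) (poly (time_bound g) L)
      (conf heads0 ((\<lambda>_. [])(out := [] @ ?o)))"
  proof (rule runs_compile)
    show "length (ws ! w) \<le> L" if "w < m" for w
      unfolding L_def using that assms(2) by (intro member_le_sum_list) auto
  qed (use assms(1,3) in \<open>auto simp: room_def\<close>)
  from runs_Then[OF 1 this]
  have "runs (machine m g) ?s (1 + poly (time_bound g) L) (conf heads0 ((\<lambda>_. [])(out := ?o)))"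
    by (simp only: machine_def Let_def assms(3)[symmetric] append_Nil)
  then obtain n where n: "exec (machine m g) ?s n (conf heads0 ((\<lambda>_. [])(out := ?o)))"
    "n \<le> 1 + poly (time_bound g) L"
    unfolding runs_def by blast
  have tp: "conf heads0 ((\<lambda>_. [])(out := ?o)) out = stack_tape (- 1) ?o"
    unfolding conf_def using assms(3) by simp
  show ?thesis
  proof (rule tm_of_computes[OF n(1)])
    show "cmd_tapes (machine m g) \<subseteq> {..<m + 2 + scratch g}"
      by (rule cmd_tapes_machine) fact
    have out: "m + 2 + scratch g - 1 = out" by (simp add: assms(3))
    show "fst (conf heads0 ((\<lambda>_. [])(out := ?o)) (m + 2 + scratch g - 1)) (int i) = bit_symbol (?o ! i)"
      if "i < length ?o" for i
      unfolding out tp using that by (simp add: stack_tape_def)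
    show "fst (conf heads0 ((\<lambda>_. [])(out := ?o)) (m + 2 + scratch g - 1)) (int (length ?o)) = 0"
      unfolding out tp by (simp add: stack_tape_def)
  qed (use n(2) in \<open>simp_all add: L_def\<close>)
qed

end

theorem polytime_computable_sem:
  assumes "word_indices g \<subseteq> {..<m}"
  shows "polytime_computable m (\<lambda>ws. sem ws (\<lambda>_. 0) g)"
proof -
  have "wf_tm (tm_of (m + 2 + scratch g) (machine m g))"
    by (rule wf_tm_of) (simp_all add: cmd_tapes_machine[OF assms, simplified],
      simp add: machine_def cmd_ok_compile go_def Let_def)
  then show ?thesis
    unfolding polytime_computable_def using layout.machine_computes[OF assms _ refl]
    by (intro exI[of _ "tm_of (m + 2 + scratch g) (machine m g)"] exI[of _ "time_bound g + 1"])
      (simp add: tm_of_def)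
qed

section \<open>Derived generator constructs\<close>

definition val :: "bool list list \<Rightarrow> (nat \<Rightarrow> nat) \<Rightarrow> gen \<Rightarrow> nat" where
  "val ws \<rho> g = length (sem ws \<rho> g)"

definition tr :: "bool list list \<Rightarrow> (nat \<Rightarrow> nat) \<Rightarrow> gen \<Rightarrow> bool" where
  "tr ws \<rho> g \<longleftrightarrow> 0 < val ws \<rho> g"

definition bit_at :: "bool list \<Rightarrow> nat \<Rightarrow> bool" where
  "bit_at w p \<longleftrightarrow> p < length w \<and> w ! p"

text \<open>Truth is nonempty output. So conjunction is repetition, disjunction is concatenation,
  and \<open>gnot\<close> yields length 0 or 1; \<open>gif\<close> negates its condition twice so
  that a true condition repeats the branch exactly once.\<close>

definition grep :: "gen \<Rightarrow> gen \<Rightarrow> gen" where "grep g h = For (fresh h) g h"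
definition gzero :: gen where "gzero = Monus (Emit True) (Emit True)"
definition gnot :: "gen \<Rightarrow> gen" where "gnot g = Monus (Emit True) g"
definition gif :: "gen \<Rightarrow> gen \<Rightarrow> gen \<Rightarrow> gen" where
  "gif c g h = Cat (grep (gnot (gnot c)) g) (grep (gnot c) h)"
definition gand :: "gen \<Rightarrow> gen \<Rightarrow> gen" where "gand g h = grep g h"
definition gor :: "gen \<Rightarrow> gen \<Rightarrow> gen" where "gor g h = Cat g h"
definition gimp :: "gen \<Rightarrow> gen \<Rightarrow> gen" where "gimp g h = Cat (gnot g) h"
definition gleq :: "gen \<Rightarrow> gen \<Rightarrow> gen" where "gleq g h = gnot (Monus g h)"
definition glt :: "gen \<Rightarrow> gen \<Rightarrow> gen" where "glt g h = Monus h g"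
definition geq :: "gen \<Rightarrow> gen \<Rightarrow> gen" where "geq g h = gand (gleq g h) (gleq h g)"
definition gex :: "nat \<Rightarrow> gen \<Rightarrow> gen \<Rightarrow> gen" where "gex v n g = For v n g"
definition gall :: "nat \<Rightarrow> gen \<Rightarrow> gen \<Rightarrow> gen" where "gall v n g = gnot (For v n (gnot g))"

fun gnum :: "nat \<Rightarrow> gen" where
  "gnum 0 = gzero"
| "gnum (Suc n) = Cat (gnum n) (Emit True)"

lemmas gen_macro_defs = grep_def gzero_def gnot_def gif_def gand_def gor_def gimp_def gleq_def
  glt_def geq_def gex_def gall_def

lemma fresh_macros [simp]:
  "fresh (grep g h) = max (fresh g) (fresh h)" "fresh gzero = 0" "fresh (gnot g) = fresh g"
  "fresh (gif c g h) = max (fresh c) (max (fresh g) (fresh h))"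
  "fresh (gand g h) = max (fresh g) (fresh h)" "fresh (gor g h) = max (fresh g) (fresh h)"
  "fresh (gimp g h) = max (fresh g) (fresh h)" "fresh (gleq g h) = max (fresh g) (fresh h)"
  "fresh (glt g h) = max (fresh g) (fresh h)" "fresh (geq g h) = max (fresh g) (fresh h)"
  "fresh (gex v g h) = max (fresh g) (fresh h)" "fresh (gall v g h) = max (fresh g) (fresh h)"
  "fresh (gnum k) = 0"
  by (induction k) (auto simp: gen_macro_defs max_def)

lemma word_indices_macros [simp]:
  "word_indices (grep g h) = word_indices g \<union> word_indices h" "word_indices gzero = {}"
  "word_indices (gnot g) = word_indices g"
  "word_indices (gif c g h) = word_indices c \<union> word_indices g \<union> word_indices h"
  "word_indices (gand g h) = word_indices g \<union> word_indices h"
  "word_indices (gor g h) = word_indices g \<union> word_indices h"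
  "word_indices (gimp g h) = word_indices g \<union> word_indices h"
  "word_indices (gleq g h) = word_indices g \<union> word_indices h"
  "word_indices (glt g h) = word_indices g \<union> word_indices h"
  "word_indices (geq g h) = word_indices g \<union> word_indices h"
  "word_indices (gex v g h) = word_indices g \<union> word_indices h"
  "word_indices (gall v g h) = word_indices g \<union> word_indices h"
  "word_indices (gnum k) = {}"
  by (induction k) (auto simp: gen_macro_defs)

lemma val_fresh [simp]: "fresh g \<le> v \<Longrightarrow> val ws (\<rho>(v := i)) g = val ws \<rho> g"
  by (simp add: val_def)

lemma sem_grep [simp]: "sem ws \<rho> (grep g h) = concat (replicate (val ws \<rho> g) (sem ws \<rho> h))"
  by (simp add: grep_def val_def map_replicate_const cong: map_cong)

lemma val_simps [simp]:
  "val ws \<rho> (Emit a) = 1"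
  "val ws \<rho> (Cat g h) = val ws \<rho> g + val ws \<rho> h"
  "val ws \<rho> (Var v) = \<rho> v"
  "val ws \<rho> (Len w) = length (ws ! w)"
  "val ws \<rho> (Bit w g) = of_bool (bit_at (ws ! w) (val ws \<rho> g))"
  "val ws \<rho> (Monus g h) = val ws \<rho> g - val ws \<rho> h"
  "val ws \<rho> (For v g h) = (\<Sum>i<val ws \<rho> g. val ws (\<rho>(v := i)) h)"
  "val ws \<rho> (Iter i v g0 b n h) = rec_nat (val ws \<rho> g0)
     (\<lambda>j x. min (val ws \<rho> b) (val ws (\<rho>(i := j, v := x)) h)) (val ws \<rho> n)"
  "val ws \<rho> (grep g h) = val ws \<rho> g * val ws \<rho> h"
  "val ws \<rho> gzero = 0"
  "val ws \<rho> (gnum k) = k"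
  by (induction k)
    (auto simp: val_def bit_at_def Let_def length_concat o_def sum_list_triv sum_list_replicate gzero_def
      interv_sum_list_conv_sum_set_nat atLeast0LessThan)

lemma tr_Bit [simp]: "tr ws \<rho> (Bit w g) \<longleftrightarrow> bit_at (ws ! w) (val ws \<rho> g)"
  by (simp add: tr_def)

lemma val_gnot [simp]: "val ws \<rho> (gnot g) = of_bool (\<not> tr ws \<rho> g)"
  by (simp add: gnot_def tr_def)

lemma val_gif [simp]: "val ws \<rho> (gif c g h) = (if tr ws \<rho> c then val ws \<rho> g else val ws \<rho> h)"
  by (simp add: gif_def tr_def)

lemma tr_simps [simp]:
  "tr ws \<rho> (gnot g) \<longleftrightarrow> \<not> tr ws \<rho> g"
  "tr ws \<rho> (gif c g h) \<longleftrightarrow> (if tr ws \<rho> c then tr ws \<rho> g else tr ws \<rho> h)"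
  "tr ws \<rho> (gand g h) \<longleftrightarrow> tr ws \<rho> g \<and> tr ws \<rho> h"
  "tr ws \<rho> (gor g h) \<longleftrightarrow> tr ws \<rho> g \<or> tr ws \<rho> h"
  "tr ws \<rho> (gimp g h) \<longleftrightarrow> (tr ws \<rho> g \<longrightarrow> tr ws \<rho> h)"
  "tr ws \<rho> (gleq g h) \<longleftrightarrow> val ws \<rho> g \<le> val ws \<rho> h"
  "tr ws \<rho> (glt g h) \<longleftrightarrow> val ws \<rho> g < val ws \<rho> h"
  "tr ws \<rho> (geq g h) \<longleftrightarrow> val ws \<rho> g = val ws \<rho> h"
  "tr ws \<rho> (gex v g h) \<longleftrightarrow> (\<exists>i<val ws \<rho> g. tr ws (\<rho>(v := i)) h)"
  "tr ws \<rho> (gall v g h) \<longleftrightarrow> (\<forall>i<val ws \<rho> g. tr ws (\<rho>(v := i)) h)"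
proof -
  show not: "tr ws \<rho> (gnot g) \<longleftrightarrow> \<not> tr ws \<rho> g" for \<rho> g
    by (simp add: tr_def gnot_def)
  show "tr ws \<rho> (gex v g h) \<longleftrightarrow> (\<exists>i<val ws \<rho> g. tr ws (\<rho>(v := i)) h)"
    unfolding tr_def gex_def val_simps(7) neq0_conv[symmetric] by auto
  show "tr ws \<rho> (gall v g h) \<longleftrightarrow> (\<forall>i<val ws \<rho> g. tr ws (\<rho>(v := i)) h)"
    unfolding gall_def not unfolding tr_def val_simps(7) val_gnot by auto
  show leq: "tr ws \<rho> (gleq g h) \<longleftrightarrow> val ws \<rho> g \<le> val ws \<rho> h" for g h
    unfolding gleq_def not by (simp add: tr_def not_less)
  show "tr ws \<rho> (geq g h) \<longleftrightarrow> val ws \<rho> g = val ws \<rho> h"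
    using leq[of g h] leq[of h g] by (auto simp: geq_def gand_def tr_def)
qed (auto simp: tr_def gand_def gor_def gimp_def glt_def)

lemma sem_gif [simp]: "sem ws \<rho> (gif c g h) = (if tr ws \<rho> c then sem ws \<rho> g else sem ws \<rho> h)"
  by (simp add: gif_def)

lemma polytime_decidable_tr:
  assumes "word_indices g \<subseteq> {..<m}" "\<And>ws. length ws = m \<Longrightarrow> R ws \<longleftrightarrow> tr ws (\<lambda>_. 0) g"
  shows "polytime_decidable m R"
proof -
  have "polytime_computable m (\<lambda>ws. sem ws (\<lambda>_. 0) (gif g (Emit True) (Emit False)))"
    using assms(1) by (intro polytime_computable_sem) simp
  moreover have "sem ws (\<lambda>_. 0) (gif g (Emit True) (Emit False)) = [R ws]" if "length ws = m" for ws
    using assms(2)[OF that] by simp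
  ultimately show ?thesis
    by (simp add: polytime_decidable_def polytime_computable_def)
qed

section \<open>Scanning encoded decision trees\<close>

datatype token = Nd nat | Lf bool

fun toks :: "dtree \<Rightarrow> token list" where
  "toks (Leaf b) = [Lf b]"
| "toks (Node j l r) = Nd j # toks l @ toks r"

fun enc_token :: "token \<Rightarrow> bool list" where
  "enc_token (Nd j) = True # enc_nat j"
| "enc_token (Lf b) = [False, b]"

abbreviation enc_tokens :: "token list \<Rightarrow> bool list" where
  "enc_tokens ts \<equiv> concat (map enc_token ts)"

lemma enc_dtree_toks: "enc_dtree T = enc_tokens (toks T)"
  by (induction T) auto

lemma toks_snoc: "\<exists>ts b. toks T = ts @ [Lf b]"
proof (induction T)
  case (Leaf b)
  then show ?case by simp
next
  case (Node j l r)
  then obtain ts b where "toks r = ts @ [Lf b]" by blast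
  then have "toks (Node j l r) = (Nd j # toks l @ ts) @ [Lf b]" by simp
  then show ?case by blast
qed

lemma length_enc_tokens_ge: "length ts \<le> length (enc_tokens ts)"
  by (induction ts) (auto simp: enc_nat_def split: token.splits, case_tac a, auto simp: enc_nat_def)

text \<open>\<open>need_step\<close> counts the subtrees that are still to be read.\<close>

fun need_step :: "nat \<Rightarrow> token \<Rightarrow> nat" where
  "need_step 0 a = 0"
| "need_step (Suc c) (Nd j) = c + 2"
| "need_step (Suc c) (Lf b) = c"

lemma foldl_need_0 [simp]: "foldl need_step 0 ts = 0"
  by (induction ts) auto

lemma foldl_need_toks [simp]: "foldl need_step (Suc c) (toks T) = c"
  by (induction T arbitrary: c) auto

lemma foldl_need_le: "foldl need_step c ts \<le> c + length ts"
proof (induction ts arbitrary: c)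
  case (Cons a ts)
  have "need_step c a \<le> c + 1" by (cases c; cases a) auto
  with Cons[of "need_step c a"] show ?case by simp
qed simp

text \<open>One more leaf closes the only subtree that is still open. In the induction from the
  front, a node fuses the first two trees of the forest that follows it.\<close>

lemma foldl_need_forest:
  "foldl need_step c ts = 1 \<Longrightarrow> \<exists>Ts. length Ts = c \<and> ts @ [Lf b] = concat (map toks Ts)"
proof (induction ts arbitrary: c)
  case Nil
  then show ?case by (auto intro!: exI[of _ "[Leaf b]"])
next
  case (Cons a ts)
  then obtain c' where c: "c = Suc c'" by (cases c) auto
  show ?case
  proof (cases a)
    case (Nd j)
    with Cons c obtain Ts where Ts: "length Ts = c' + 2" "ts @ [Lf b] = concat (map toks Ts)"
      by fastforce
    then obtain T1 T2 Ts' where "Ts = T1 # T2 # Ts'" by (auto simp: length_Suc_conv)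
    with Ts Nd c show ?thesis by (intro exI[of _ "Node j T1 T2 # Ts'"]) simp
  next
    case (Lf b')
    with Cons c obtain Ts where "length Ts = c'" "ts @ [Lf b] = concat (map toks Ts)"
      by fastforce
    with Lf c show ?thesis by (intro exI[of _ "Leaf b' # Ts"]) simp
  qed
qed

lemma foldl_need_tree: "foldl need_step 1 ts = 1 \<Longrightarrow> \<exists>T. ts @ [Lf b] = toks T"
  using foldl_need_forest[of 1 ts b] by (auto simp: length_Suc_conv)

lemma foldl_need_last: "toks T = ts @ [Lf b] \<Longrightarrow> foldl need_step (Suc c) ts = Suc c"
proof (induction T arbitrary: ts c)
  case (Node j l r)
  obtain rs b' where r: "toks r = rs @ [Lf b']" using toks_snoc by blast
  with Node.prems have "b' = b" "ts = Nd j # toks l @ rs" by auto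
  with Node.IH(2)[of rs c] r show ?case by simp
qed simp

text \<open>Evaluation: in state 0 the subtree that is read next is evaluated, in the states 1 and 2 the
  result is known to be negative or positive, and in state \<open>s + 3\<close> there are \<open>s + 1\<close> subtrees to
  skip.\<close>

fun scan_step :: "(nat \<Rightarrow> bool) \<Rightarrow> nat \<Rightarrow> token \<Rightarrow> nat" where
  "scan_step e s (Nd j) =
     (if s = 0 then (if e j then 3 else 0) else if s \<le> 2 then s else Suc s)"
| "scan_step e s (Lf b) =
     (if s = 0 then (if b then 2 else 1) else if s \<le> 2 then s else if s = 3 then 0 else s - 1)"

lemma scan_step_done: "s = 1 \<or> s = 2 \<Longrightarrow> scan_step e s a = s"
  by (cases a) auto

lemma foldl_scan_done: "s = 1 \<or> s = 2 \<Longrightarrow> foldl (scan_step e) s ts = s"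
  by (induction ts) (auto simp: scan_step_done)

text \<open>A whole subtree lowers the number of subtrees to skip by one; after the last one the
  state is 0 and not 2, since evaluation resumes. This is how a test with value 1 passes over the
  left subtree.\<close>

lemma foldl_scan_skip: "foldl (scan_step e) (s + 3) (toks T) = (if s = 0 then 0 else s + 2)"
proof (induction T arbitrary: s)
  case (Node j l r)
  have "scan_step e (s + 3) (Nd j) = Suc s + 3" by simp
  then have "foldl (scan_step e) (s + 3) (toks (Node j l r)) =
      foldl (scan_step e) (foldl (scan_step e) (Suc s + 3) (toks l)) (toks r)"
    by (simp only: toks.simps foldl_Cons foldl_append)
  also have "foldl (scan_step e) (Suc s + 3) (toks l) = s + 3"
    by (subst Node.IH(1)) simp
  finally show ?case using Node.IH(2) by simp
qed auto

fun labels :: "dtree \<Rightarrow> nat set" where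
  "labels (Leaf b) = {}"
| "labels (Node j l r) = insert j (labels l \<union> labels r)"

text \<open>A test with value 0 evaluates the left subtree in place; this ends in state 1 or 2, in
  which the right subtree is ignored.\<close>

lemma foldl_scan_toks:
  "(\<And>j. j \<in> labels T \<Longrightarrow> f j = e ! j) \<Longrightarrow>
     foldl (scan_step f) 0 (toks T) = (if classify T e then 2 else 1)"
proof (induction T)
  case (Node j l r)
  then show ?case
    using foldl_scan_skip[of f 0 l] foldl_scan_done[of _ f "toks r"] by auto
qed auto

lemma foldl_scan_le: "foldl (scan_step e) s ts \<le> max s 3 + length ts"
proof (induction ts arbitrary: s)
  case (Cons a ts)
  have "scan_step e s a \<le> max s 3 + 1" by (cases a) auto
  with Cons[of "scan_step e s a"] show ?case by simp
qed simp

lemma dtree_over_remove: "dtree_over (F - {j}) T \<longleftrightarrow> dtree_over F T \<and> j \<notin> labels T"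
proof (induction T arbitrary: F)
  case (Node i l r)
  have "F - {j} - {i} = F - {i} - {j}" by auto
  then show ?case using Node by auto
qed auto

text \<open>Token i heads a node; the tokens of its subtree that follow are those before the need that
  starts with 2 drops to 0.\<close>

definition no_repetition :: "token list \<Rightarrow> bool" where
  "no_repetition ts \<longleftrightarrow> (\<forall>i<length ts. \<forall>j. ts ! i = Nd j \<longrightarrow>
     (\<forall>d. i + 1 + d < length ts \<longrightarrow> 0 < foldl need_step 2 (take d (drop (i + 1) ts)) \<longrightarrow>
        ts ! (i + 1 + d) \<noteq> Nd j))"

text \<open>The inner condition of \<open>no_repetition\<close> with an arbitrary need c in place of
  2, so that it can be followed token by token.\<close>

definition label_free :: "nat \<Rightarrow> nat \<Rightarrow> token list \<Rightarrow> bool" where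
  "label_free j c ts \<longleftrightarrow>
     (\<forall>d<length ts. 0 < foldl need_step c (take d ts) \<longrightarrow> ts ! d \<noteq> Nd j)"

lemma label_free_simps [simp]:
  "label_free j 0 ts" "label_free j c []"
  "label_free j (Suc c) (a # ts) \<longleftrightarrow> a \<noteq> Nd j \<and> label_free j (need_step (Suc c) a) ts"
proof -
  show "label_free j (Suc c) (a # ts) \<longleftrightarrow> a \<noteq> Nd j \<and> label_free j (need_step (Suc c) a) ts"
  proof
    assume l: "label_free j (Suc c) (a # ts)"
    have "a \<noteq> Nd j" using l[unfolded label_free_def, rule_format, of 0] by simp
    moreover have "label_free j (need_step (Suc c) a) ts"
      unfolding label_free_def using l[unfolded label_free_def, rule_format, of "Suc _"] by simp
    ultimately show "a \<noteq> Nd j \<and> label_free j (need_step (Suc c) a) ts" ..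
  next
    assume r: "a \<noteq> Nd j \<and> label_free j (need_step (Suc c) a) ts"
    show "label_free j (Suc c) (a # ts)"
      unfolding label_free_def
    proof (intro allI impI)
      fix d assume "d < length (a # ts)" "0 < foldl need_step (Suc c) (take d (a # ts))"
      with r show "(a # ts) ! d \<noteq> Nd j"
        by (cases d) (auto simp: label_free_def)
    qed
  qed
qed (auto simp: label_free_def)

lemma label_free_toks:
  "label_free j (Suc c) (toks T @ ts) \<longleftrightarrow> j \<notin> labels T \<and> label_free j c ts"
  by (induction T arbitrary: c ts) auto

lemma no_repetition_Nil [simp]: "no_repetition []"
  by (simp add: no_repetition_def)

lemma no_repetition_Cons [simp]:
  "no_repetition (a # ts) \<longleftrightarrow> (\<forall>j. a = Nd j \<longrightarrow> label_free j 2 ts) \<and> no_repetition ts"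
  unfolding no_repetition_def length_Cons All_less_Suc2 by (auto simp: label_free_def)

text \<open>The remainder \<open>ts\<close> carries the induction: behind the left subtree of a node
  stands the right one.\<close>

lemma no_repetition_toks:
  "no_repetition (toks T @ ts) \<and> labels T \<subseteq> F \<longleftrightarrow> dtree_over F T \<and> no_repetition ts"
proof (induction T arbitrary: ts)
  case (Node j l r)
  have "no_repetition (toks (Node j l r) @ ts) \<and> labels (Node j l r) \<subseteq> F \<longleftrightarrow>
     j \<in> F \<and> j \<notin> labels l \<and> j \<notin> labels r \<and> (no_repetition (toks l @ (toks r @ ts)) \<and> labels l \<subseteq> F) \<and>
     labels r \<subseteq> F"
    using label_free_toks[of j 1 l "toks r @ ts"] label_free_toks[of j 0 r ts]
    by (auto simp: numeral_2_eq_2)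
  also have "\<dots> \<longleftrightarrow> j \<in> F \<and> j \<notin> labels l \<and> j \<notin> labels r \<and> dtree_over F l \<and>
     (no_repetition (toks r @ ts) \<and> labels r \<subseteq> F)"
    by (subst Node.IH(1)) blast
  also have "\<dots> \<longleftrightarrow> dtree_over F (Node j l r) \<and> no_repetition ts"
    by (subst Node.IH(2)) (auto simp: dtree_over_remove)
  finally show ?case .
qed auto

lemma labels_toks: "j \<in> labels T \<longleftrightarrow> Nd j \<in> set (toks T)"
  by (induction T) auto

lemma dtree_over_toks: "dtree_over F T \<longleftrightarrow>
    no_repetition (toks T) \<and> (\<forall>i<length (toks T). \<forall>j. toks T ! i = Nd j \<longrightarrow> j \<in> F)"
  using no_repetition_toks[of T "[]" F] by (auto simp: labels_toks subset_iff in_set_conv_nth)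

section \<open>Access to the tokens of an encoded tree\<close>

definition ones_from :: "bool list \<Rightarrow> nat \<Rightarrow> nat" where
  "ones_from x p = length (takeWhile id (drop p x))"

text \<open>A leaf takes two bits; a node takes its head bit, the 1s of its label and the closing 0.
  The cap makes this an instance of \<open>Iter\<close>: valid inputs do not reach it, and a capped
  position lies beyond the end of x, where it is recognised.\<close>

definition token_pos :: "bool list \<Rightarrow> nat \<Rightarrow> nat" where
  "token_pos x t = rec_nat (ones_from x 0 + 1) (\<lambda>_ p. min (length x + 5)
     (p + (if bit_at x p then 2 + ones_from x (p + 1) else 2))) t"

definition token_head :: "bool list \<Rightarrow> nat \<Rightarrow> bool" where
  "token_head x t \<longleftrightarrow> bit_at x (token_pos x t)"

definition token_label :: "bool list \<Rightarrow> nat \<Rightarrow> nat" where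
  "token_label x t = ones_from x (token_pos x t + 1)"

definition token_bit :: "bool list \<Rightarrow> nat \<Rightarrow> bool" where
  "token_bit x t \<longleftrightarrow> bit_at x (token_pos x t + 1)"

definition token_needs :: "bool list \<Rightarrow> nat \<Rightarrow> nat \<Rightarrow> nat \<Rightarrow> nat" where
  "token_needs x c b d = rec_nat c (\<lambda>i c. min (length x + 5)
     (if 0 < c then if token_head x (b + i) then c + 1 else c - 1 else 0)) d"

text \<open>The number of tokens is unknown here, so the scan makes \<open>length x\<close> rounds.
  The surplus ones read arbitrary bits, but the states 1 and 2 are absorbing.\<close>

definition tree_scan :: "bool list \<Rightarrow> (nat \<Rightarrow> bool) \<Rightarrow> nat" where
  "tree_scan x e = rec_nat 0 (\<lambda>t s. min (length x + 5)
     (if s = 0 then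
        if token_head x t then if e (token_label x t) then 3 else 0
        else if token_bit x t then 2 else 1
      else if s \<le> 2 then s
      else if token_head x t then s + 1 else if s = 3 then 0 else s - 1)) (length x)"

definition gcap :: gen where "gcap = Cat (Len 0) (gnum 5)"

text \<open>Counts the d for which the d + 1 bits from p on are all 1; there are as many of them as
  1s in the leading run.\<close>

definition gones :: "gen \<Rightarrow> gen" where
  "gones p = (let d = fresh p in
     For d (Len 0) (gall (Suc d) (Cat (Var d) (Emit True)) (Bit 0 (Cat p (Var (Suc d))))))"

definition gdim :: gen where "gdim = gones gzero"

text \<open>The fixed variables 0 and 1 capture nothing in t: \<open>Iter\<close> evaluates its
  initial value, its cap and its number of rounds outside their scope.\<close>

definition gtoken_pos :: "gen \<Rightarrow> gen" where
  "gtoken_pos t = Iter 0 1 (Cat gdim (Emit True)) gcap t (Cat (Var 1)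
     (gif (Bit 0 (Var 1)) (Cat (gnum 2) (gones (Cat (Var 1) (Emit True)))) (gnum 2)))"

definition gtoken_head :: "gen \<Rightarrow> gen" where "gtoken_head t = Bit 0 (gtoken_pos t)"
definition gtoken_label :: "gen \<Rightarrow> gen" where
  "gtoken_label t = gones (Cat (gtoken_pos t) (Emit True))"
definition gtoken_bit :: "gen \<Rightarrow> gen" where
  "gtoken_bit t = Bit 0 (Cat (gtoken_pos t) (Emit True))"

definition gtoken_needs :: "gen \<Rightarrow> gen \<Rightarrow> gen \<Rightarrow> gen" where
  "gtoken_needs c b d = (let i = fresh b; v = Suc i in
     Iter i v c gcap d (gif (Var v)
       (gif (gtoken_head (Cat b (Var i))) (Cat (Var v) (Emit True)) (Monus (Var v) (Emit True)))
       gzero))"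

text \<open>A pair \<open>(w, o)\<close> stands for the instance that is encoded in word w from position o on.\<close>

definition gdef :: "nat \<times> gen \<Rightarrow> gen \<Rightarrow> gen" where
  "gdef s f = Bit (fst s) (Cat (snd s) (Cat f f))"
definition gval :: "nat \<times> gen \<Rightarrow> gen \<Rightarrow> gen" where
  "gval s f = Bit (fst s) (Cat (snd s) (Cat f (Cat f (Emit True))))"

definition gtree_scan :: "nat \<times> gen \<Rightarrow> gen" where
  "gtree_scan s = (let i = fresh (snd s); v = Suc i in
     Iter i v gzero gcap (Len 0)
       (gif (geq (Var v) gzero)
         (gif (gtoken_head (Var i)) (gif (gval s (gtoken_label (Var i))) (gnum 3) gzero)
           (gif (gtoken_bit (Var i)) (gnum 2) (gnum 1)))
         (gif (gleq (Var v) (gnum 2)) (Var v)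
           (gif (gtoken_head (Var i)) (Cat (Var v) (Emit True))
             (gif (geq (Var v) (gnum 3)) gzero (Monus (Var v) (Emit True)))))))"

lemma tr_Var [simp]: "tr ws \<rho> (Var v) \<longleftrightarrow> 0 < \<rho> v"
  by (simp add: tr_def)

lemma ones_from_less: "i < ones_from x p \<Longrightarrow> bit_at x (p + i)"
  using nth_length_takeWhile[of id "drop p x"] takeWhile_nth[of i id "drop p x"]
    set_takeWhileD[OF nth_mem, of i id "drop p x"] length_takeWhile_le[of id "drop p x"]
  by (auto simp: ones_from_def bit_at_def)

lemma not_bit_at_ones_from: "\<not> bit_at x (p + ones_from x p)"
  using nth_length_takeWhile[of id "drop p x"] by (auto simp: ones_from_def bit_at_def)

lemma sum_ones_from:
  "(\<Sum>d<length x. of_bool (\<forall>i<Suc d. bit_at x (p + i))) = ones_from x p"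
proof -
  have "(\<forall>i<Suc d. bit_at x (p + i)) \<longleftrightarrow> d < ones_from x p" for d
    using ones_from_less[of _ x p] not_bit_at_ones_from[of x p]
    by (metis lessI less_Suc_eq_le linorder_not_le order_less_le_trans)
  moreover have "{d. d < length x \<and> d < ones_from x p} = {..<ones_from x p}"
    using length_takeWhile_le[of id "drop p x"] by (auto simp: ones_from_def)
  ultimately show ?thesis
    by (simp add: of_bool_def sum.If_cases Collect_conj_eq[symmetric] lessThan_def Int_def)
qed

lemma val_gcap [simp]: "val ws \<rho> gcap = length (ws ! 0) + 5"
  by (simp add: gcap_def)

lemma val_gall [simp]: "val ws \<rho> (gall v g h) = of_bool (\<forall>i<val ws \<rho> g. tr ws (\<rho>(v := i)) h)"
  unfolding tr_simps(10)[symmetric] by (simp add: gall_def)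

lemma val_gones [simp]: "val ws \<rho> (gones p) = ones_from (ws ! 0) (val ws \<rho> p)"
  unfolding sum_ones_from[symmetric]
  by (simp add: gones_def Let_def)

lemma val_gdim [simp]: "val ws \<rho> gdim = ones_from (ws ! 0) 0"
  by (simp add: gdim_def)

lemma val_gtoken_pos [simp]: "val ws \<rho> (gtoken_pos t) = token_pos (ws ! 0) (val ws \<rho> t)"
  by (simp add: gtoken_pos_def token_pos_def cong: if_cong)

lemma gtoken_simps [simp]:
  "tr ws \<rho> (gtoken_head t) \<longleftrightarrow> token_head (ws ! 0) (val ws \<rho> t)"
  "val ws \<rho> (gtoken_label t) = token_label (ws ! 0) (val ws \<rho> t)"
  "tr ws \<rho> (gtoken_bit t) \<longleftrightarrow> token_bit (ws ! 0) (val ws \<rho> t)"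
  by (simp_all add: gtoken_head_def gtoken_label_def gtoken_bit_def token_head_def token_label_def
      token_bit_def)

lemma val_gtoken_needs [simp]:
  "val ws \<rho> (gtoken_needs c b d) = token_needs (ws ! 0) (val ws \<rho> c) (val ws \<rho> b) (val ws \<rho> d)"
  by (simp add: gtoken_needs_def token_needs_def Let_def cong: if_cong)

lemma tr_gdef [simp]: "tr ws \<rho> (gdef s f) \<longleftrightarrow>
    bit_at (ws ! fst s) (val ws \<rho> (snd s) + 2 * val ws \<rho> f)"
  by (simp add: gdef_def mult_2)

lemma tr_gval [simp]: "tr ws \<rho> (gval s f) \<longleftrightarrow>
    bit_at (ws ! fst s) (val ws \<rho> (snd s) + 2 * val ws \<rho> f + 1)"
  by (simp add: gval_def mult_2 add.assoc)

lemma val_gtree_scan [simp]: "val ws \<rho> (gtree_scan s) =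
    tree_scan (ws ! 0) (\<lambda>j. bit_at (ws ! fst s) (val ws \<rho> (snd s) + 2 * j + 1))"
  by (simp add: gtree_scan_def tree_scan_def Let_def cong: if_cong)

locale token_string =
  fixes x :: "bool list" and n :: nat and ts :: "token list" and post :: "bool list"
  assumes x: "x = enc_nat n @ enc_tokens ts @ post"
begin

lemma ones_from_append_enc_nat: "ones_from (us @ enc_nat j @ vs) (length us) = j"
  by (simp add: ones_from_def enc_nat_def takeWhile_append2 takeWhile_tail)

lemma dim: "ones_from x 0 = n"
  using ones_from_append_enc_nat[of "[]"] x by simp

lemma tokens_take: "t < length ts \<Longrightarrow>
    enc_tokens ts = enc_tokens (take t ts) @ enc_token (ts ! t) @ enc_tokens (drop (Suc t) ts)"
  by (metis Cons_nth_drop_Suc append_take_drop_id concat.simps(2) concat_append list.simps(9) map_append)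

text \<open>The position is an assumption because \<open>token_pos_eq\<close> needs this lemma in
  its induction step to know the length of the token.\<close>

lemma token_head_at:
  assumes "t < length ts" "token_pos x t = n + 1 + length (enc_tokens (take t ts))"
  shows "case ts ! t of Nd j \<Rightarrow> token_head x t \<and> token_label x t = j
    | Lf b \<Rightarrow> \<not> token_head x t \<and> (token_bit x t \<longleftrightarrow> b)"
proof -
  define us where "us = enc_nat n @ enc_tokens (take t ts)"
  define vs where "vs = enc_tokens (drop (Suc t) ts) @ post"
  have x': "x = us @ enc_token (ts ! t) @ vs"
    using x tokens_take[OF assms(1)] by (simp add: us_def vs_def)
  have p: "token_pos x t = length us"
    using assms(2) by (simp add: us_def enc_nat_def)
  show ?thesis
  proof (cases "ts ! t")
    case (Nd j)
    then show ?thesis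
      using p x' ones_from_append_enc_nat[of "us @ [True]" j vs]
      by (simp add: token_head_def token_label_def bit_at_def nth_append)
  next
    case (Lf b)
    then show ?thesis
      using p x' by (simp add: token_head_def token_bit_def bit_at_def nth_append)
  qed
qed

lemma token_pos_eq: "t \<le> length ts \<Longrightarrow> token_pos x t = n + 1 + length (enc_tokens (take t ts))"
proof (induction t)
  case 0
  then show ?case using dim by (simp add: token_pos_def)
next
  case (Suc t)
  then have IH: "token_pos x t = n + 1 + length (enc_tokens (take t ts))" by simp
  have l: "length (enc_tokens (take (Suc t) ts)) = length (enc_tokens (take t ts)) + length (enc_token (ts ! t))"
    using Suc.prems by (simp add: take_Suc_conv_app_nth)
  have "length x = n + 1 + length (enc_tokens ts) + length post"
    using x by (simp add: enc_nat_def)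
  then have "n + 1 + length (enc_tokens (take t ts)) + length (enc_token (ts ! t)) \<le> length x"
    using tokens_take[of t] Suc.prems by simp
  moreover have "token_pos x (Suc t) = min (length x + 5) (token_pos x t +
      (if token_head x t then 2 + token_label x t else 2))"
    by (simp add: token_pos_def token_head_def token_label_def)
  moreover have "(if token_head x t then 2 + token_label x t else 2) = length (enc_token (ts ! t))"
    using token_head_at[OF _ IH] Suc.prems by (cases "ts ! t") (auto simp: enc_nat_def)
  ultimately show ?case
    using IH l by simp
qed

lemma token_head_Nd: "t < length ts \<Longrightarrow> token_head x t \<longleftrightarrow> (\<exists>j. ts ! t = Nd j)"
  using token_head_at[OF _ token_pos_eq, of t] by (cases "ts ! t") auto

lemma token_label_Nd: "t < length ts \<Longrightarrow> ts ! t = Nd j \<Longrightarrow> token_label x t = j"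
  using token_head_at[OF _ token_pos_eq, of t] by auto

lemma token_bit_Lf: "t < length ts \<Longrightarrow> ts ! t = Lf b \<Longrightarrow> token_bit x t \<longleftrightarrow> b"
  using token_head_at[OF _ token_pos_eq, of t] by auto

lemma length_tokens: "length ts + n + 1 + length post \<le> length x"
  using x length_enc_tokens_ge[of ts] by (simp add: enc_nat_def)

lemma token_needs_eq:
  "b + d \<le> length ts \<Longrightarrow> c \<le> 4 \<Longrightarrow> token_needs x c b d = foldl need_step c (take d (drop b ts))"
proof (induction d)
  case (Suc d)
  then have IH: "token_needs x c b d = foldl need_step c (take d (drop b ts))" by simp
  let ?c = "foldl need_step c (take d (drop b ts))"
  have "?c \<le> c + d"
    using foldl_need_le[of c "take d (drop b ts)"] Suc.prems by simp
  then have c: "?c + 1 \<le> length x + 5"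
    using length_tokens Suc.prems by simp
  have "take (Suc d) (drop b ts) = take d (drop b ts) @ [ts ! (b + d)]"
    using Suc.prems by (simp add: take_Suc_conv_app_nth)
  moreover have "token_needs x c b (Suc d) = need_step ?c (ts ! (b + d))"
    using token_head_Nd[of "b + d"] Suc.prems IH c
    by (cases ?c; cases "ts ! (b + d)") (auto simp: token_needs_def)
  ultimately show ?case by simp
qed (simp add: token_needs_def)

lemma tree_scan_eq:
  assumes "ts = toks T"
    and f: "\<And>j. j \<in> labels T \<Longrightarrow> f j = e ! j"
  shows "tree_scan x f = (if classify T e then 2 else 1)"
proof -
  define g where "g = (\<lambda>t s. min (length x + 5)
     (if s = 0 then
        if token_head x t then if f (token_label x t) then 3 else 0
        else if token_bit x t then 2 else 1
      else if s \<le> 2 then s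
      else if token_head x t then s + 1 else if s = 3 then 0 else s - 1))"
  have take: "rec_nat 0 g t = foldl (scan_step f) 0 (take t ts)" if "t \<le> length ts" for t
    using that
  proof (induction t)
    case (Suc t)
    let ?s = "foldl (scan_step f) 0 (take t ts)"
    have "?s \<le> 3 + t" using foldl_scan_le[of f 0 "take t ts"] Suc.prems by simp
    then have c: "?s + 1 \<le> length x + 5" using length_tokens Suc.prems by simp
    have "g t ?s = scan_step f ?s (ts ! t)"
      using token_head_Nd[of t] token_label_Nd[of t] token_bit_Lf[of t] Suc.prems c
      by (cases "ts ! t") (auto simp: g_def)
    with Suc show ?case by (simp add: take_Suc_conv_app_nth)
  qed simp
  let ?r = "if classify T e then 2 else 1 :: nat"
  have "rec_nat 0 g (length ts + d) = ?r" for d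
  proof (induction d)
    case 0
    then show ?case using take[of "length ts"] foldl_scan_toks[OF f] assms by simp
  next
    case (Suc d)
    have "g t ?r = ?r" for t by (simp add: g_def)
    with Suc show ?case by simp
  qed
  from this[of "length x - length ts"] show ?thesis
    using length_tokens by (simp add: tree_scan_def g_def)
qed

end

section \<open>Evaluation is in the polynomial hierarchy\<close>

text \<open>Decoding is total: bits beyond the end count as 0, and both 00 and 01 stand for an
  undefined feature. So every word can be read as an instance.\<close>

definition inst :: "bool list \<Rightarrow> nat \<Rightarrow> nat \<Rightarrow> pinstance" where
  "inst w p n = map (\<lambda>f. if bit_at w (p + 2 * f) then Some (bit_at w (p + 2 * f + 1)) else None) [0..<n]"

lemma length_inst [simp]: "length (inst w p n) = n"
  by (simp add: inst_def)

lemma inst_in_pinstances [simp]: "inst w p n \<in> pinstances n"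
  by (simp add: pinstances_def)

lemma length_enc_pinstance [simp]: "length (enc_pinstance e) = 2 * length e"
proof (induction e)
  case (Cons a e)
  then show ?case by (cases a) (auto simp: enc_pinstance_def)
qed (simp add: enc_pinstance_def)

lemma bits_enc_pinstance:
  "f < length e \<Longrightarrow> (if bit_at (us @ enc_pinstance e @ vs) (length us + 2 * f)
     then Some (bit_at (us @ enc_pinstance e @ vs) (length us + 2 * f + 1)) else None) = e ! f"
proof (induction e arbitrary: us f)
  case (Cons a e)
  have e: "us @ enc_pinstance (a # e) @ vs = (us @ enc_value a) @ enc_pinstance e @ vs"
    by (simp add: enc_pinstance_def)
  show ?case
  proof (cases f)
    case 0
    then show ?thesis
      unfolding e by (cases a) (auto simp: bit_at_def nth_append)
  next
    case (Suc f')
    have "length us + 2 * f = length (us @ enc_value a) + 2 * f'"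
      using Suc by (cases a) auto
    then show ?thesis
      unfolding e using Cons.IH[of f' "us @ enc_value a"] Cons.prems Suc by (simp cong: if_cong)
  qed
qed simp

lemma inst_enc_pinstance: "length e = n \<Longrightarrow> inst (us @ enc_pinstance e @ vs) (length us) n = e"
  using bits_enc_pinstance[of _ e us vs] by (intro nth_equalityI) (simp_all add: inst_def cong: if_cong)

text \<open>Lets a quantifier over words of one common length replace the quantifier over partial
  instances; surplus bits are ignored.\<close>

lemma inst_surj:
  assumes "2 * n \<le> m"
  shows "(\<lambda>u. inst u 0 n) ` {u. length u = m} = pinstances n"
proof -
  have "e \<in> (\<lambda>u. inst u 0 n) ` {u. length u = m}" if "length e = n" for e
    using inst_enc_pinstance[of e n "[]"] that assms
    by (intro image_eqI[of _ _ "enc_pinstance e @ replicate (m - 2 * n) False"]) auto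
  then show ?thesis
    by (auto simp: pinstances_def)
qed

lemma bit_at_append [simp]: "bit_at (us @ w) (length us + k) = bit_at w k"
  by (simp add: bit_at_def)

lemma bit_at_drop: "bit_at (drop p w) k = bit_at w (p + k)"
  by (auto simp: bit_at_def)

lemma enc_pinstance_canonical:
  "f < length e \<Longrightarrow> \<not> bit_at (enc_pinstance e) (2 * f) \<Longrightarrow> \<not> bit_at (enc_pinstance e) (2 * f + 1)"
proof (induction e arbitrary: f)
  case (Cons a e)
  have e: "enc_pinstance (a # e) = enc_value a @ enc_pinstance e" "length (enc_value a) = 2"
    by (cases a; simp add: enc_pinstance_def)+
  show ?case
  proof (cases f)
    case 0
    then show ?thesis
      using Cons.prems by (cases a) (auto simp: enc_pinstance_def bit_at_def)
  next
    case (Suc f')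
    then have "2 * f = length (enc_value a) + 2 * f'" "2 * f + 1 = length (enc_value a) + (2 * f' + 1)"
      using e(2) by auto
    then show ?thesis
      unfolding e(1) using Cons.IH[of f'] Cons.prems Suc by (simp only: e(1) bit_at_append) simp
  qed
qed simp

lemma enc_pinstances_concat: "concat (map enc_pinstance es) = enc_pinstance (concat es)"
  by (induction es) (auto simp: enc_pinstance_def)

text \<open>The pair 01 decodes to an undefined feature and would be encoded again as 00; where it
  does not occur, decoding loses nothing. The input check tests for it.\<close>

lemma enc_pinstance_inst:
  assumes "length v = 2 * n" "\<And>f. f < n \<Longrightarrow> \<not> bit_at v (2 * f) \<Longrightarrow> \<not> bit_at v (2 * f + 1)"
  shows "enc_pinstance (inst v 0 n) = v"
  using assms
proof (induction n arbitrary: v)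
  case (Suc n)
  then obtain a b v' where v: "v = a # b # v'"
    by (auto simp: length_Suc_conv eval_nat_numeral)
  have "enc_pinstance (inst v' 0 n) = v'"
  proof (rule Suc.IH)
    fix f assume "f < n" "\<not> bit_at v' (2 * f)"
    then show "\<not> bit_at v' (2 * f + 1)"
      using Suc.prems(2)[of "Suc f"] v by (simp add: bit_at_def)
  qed (use Suc.prems v in simp)
  moreover have "inst v 0 (Suc n) = (if a then Some b else None) # inst v' 0 n"
  proof -
    have "[0..<Suc n] = 0 # map Suc [0..<n]"
      by (simp only: upt_conv_Cons map_Suc_upt zero_less_Suc)
    then show ?thesis by (simp add: inst_def v bit_at_def del: upt_Suc)
  qed
  moreover have "a \<or> \<not> b"
    using Suc.prems(2)[of 0] v by (auto simp: bit_at_def)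
  ultimately show ?case
    using v by (cases a) (auto simp: enc_pinstance_def)
qed (simp add: inst_def enc_pinstance_def)

lemma concat_uniform:
  "length v = n * l \<Longrightarrow> \<exists>es. length es = l \<and> (\<forall>e\<in>set es. length e = n) \<and> concat es = v"
proof (induction l arbitrary: v)
  case (Suc l)
  then obtain es where "length es = l" "\<forall>e\<in>set es. length e = n" "concat es = drop n v"
    by (metis add_diff_cancel_left' length_drop mult_Suc_right)
  then show ?case
    using Suc.prems by (intro exI[of _ "take n v # es"]) auto
qed simp

text \<open>Here t is the index of the last token of the tree, a leaf in front of which exactly one
  subtree is missing. Behind it there must be l * n pairs, none of them 01; the nodes need labels
  below the dimension that do not recur in their subtrees. The variables 10, 11 and 12 stay clear of
  those bound in \<open>gtoken_pos\<close>.\<close>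

definition gcheck :: "nat \<Rightarrow> gen" where
  "gcheck l = (let t = Var 10; i = Var 11; p = gtoken_pos (Cat t (Emit True));
      k = Cat (Cat i (Emit True)) (Var 12) in
    gex 10 (Len 0) (gand (geq (Cat p (grep (gnum (2 * l)) gdim)) (Len 0))
     (gand (geq (gtoken_needs (Emit True) gzero t) (Emit True))
     (gand (gnot (gtoken_head t))
     (gand (gall 11 t (gimp (gtoken_head i) (gand (glt (gtoken_label i) gdim)
        (gall 12 (Monus t i) (gimp (gtoken_needs (gnum 2) (Cat i (Emit True)) (Var 12))
           (gimp (gtoken_head k) (gnot (geq (gtoken_label k) (gtoken_label i)))))))))
     (gall 11 (grep (gnum l) gdim) (gimp (gnot (gdef (0, p) i)) (gnot (gval (0, p) i)))))))))"

definition valid_input :: "nat \<Rightarrow> nat \<Rightarrow> dtree \<Rightarrow> pinstance list \<Rightarrow> bool" where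
  "valid_input l n T es \<longleftrightarrow> dtree_of_dim n T \<and> length es = l \<and> set es \<subseteq> pinstances n"

lemma tr_gcheck: "tr ws \<rho> (gcheck l) \<longleftrightarrow> (let x = ws ! 0; n = ones_from x 0 in
   \<exists>t<length x. token_pos x (Suc t) + 2 * l * n = length x \<and> token_needs x 1 0 t = 1 \<and>
     \<not> token_head x t \<and>
     (\<forall>i<t. token_head x i \<longrightarrow> token_label x i < n \<and>
        (\<forall>d<t - i. 0 < token_needs x 2 (Suc i) d \<longrightarrow> token_head x (Suc (i + d)) \<longrightarrow>
           token_label x (Suc (i + d)) \<noteq> token_label x i)) \<and>
     (\<forall>f<l * n. \<not> bit_at x (token_pos x (Suc t) + 2 * f) \<longrightarrow>
        \<not> bit_at x (token_pos x (Suc t) + 2 * f + 1)))"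
proof -
  have "tr ws \<rho> (gtoken_needs c b d) \<longleftrightarrow> 0 < val ws \<rho> (gtoken_needs c b d)" for \<rho> c b d
    by (simp add: tr_def)
  then show ?thesis
    by (simp add: gcheck_def Let_def)
qed

lemma valid_input_token_string:
  "valid_input l n T es \<Longrightarrow>
     token_string (enc_input n T es) n (toks T) (concat (map enc_pinstance es))"
  by unfold_locales (simp add: enc_input_def enc_dtree_toks)

lemma length_enc_pinstances:
  assumes "set es \<subseteq> pinstances n"
  shows "length (concat (map enc_pinstance es)) = 2 * length es * n"
  using assms by (induction es) (auto simp: pinstances_def algebra_simps)

text \<open>Positions are counted back from the end of the input, which avoids computing the length
  of the encoded tree.\<close>

lemma inst_valid_input:
  assumes "valid_input l n T es" "i < l"
  shows "inst (enc_input n T es) (length (enc_input n T es) - 2 * (l - i) * n) n = es ! i"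
proof -
  let ?us = "enc_nat n @ enc_dtree T @ concat (map enc_pinstance (take i es))"
  let ?vs = "concat (map enc_pinstance (drop (Suc i) es))"
  have es: "length es = l" "set es \<subseteq> pinstances n" "length (es ! i) = n"
    using assms by (auto simp: valid_input_def pinstances_def subset_iff)
  have split: "enc_input n T es = ?us @ enc_pinstance (es ! i) @ ?vs"
    using assms(2) es(1) unfolding enc_input_def
    by (subst id_take_nth_drop[of i es]) (auto simp del: append_take_drop_id)
  have "set (drop i es) \<subseteq> pinstances n"
    using es(2) set_drop_subset by fast
  then have "length (concat (map enc_pinstance (drop i es))) = 2 * (l - i) * n"
    using length_enc_pinstances[of "drop i es" n] es(1) by simp
  moreover have "concat (map enc_pinstance (drop i es)) = enc_pinstance (es ! i) @ ?vs"
    using assms(2) es(1) by (simp flip: Cons_nth_drop_Suc)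
  ultimately have "length (enc_input n T es) - 2 * (l - i) * n = length ?us"
    unfolding split by simp
  then show ?thesis
    using inst_enc_pinstance[OF es(3), of ?us ?vs] unfolding split by simp
qed

lemma valid_input_gcheck:
  assumes "valid_input l n T es" "ws ! 0 = enc_input n T es"
  shows "tr ws \<rho> (gcheck l)"
proof -
  let ?x = "ws ! 0" and ?ts = "toks T" and ?post = "concat (map enc_pinstance es)"
  interpret token_string ?x n ?ts ?post
    using valid_input_token_string[OF assms(1)] assms(2) by simp
  have es: "length es = l" "set es \<subseteq> pinstances n" and T: "dtree_over {..<n} T"
    using assms by (auto simp: valid_input_def dtree_of_dim_def)
  obtain us b where us: "?ts = us @ [Lf b]" using toks_snoc by blast
  define t where "t = length us"
  have l: "length ?ts = Suc t" using us by (simp add: t_def)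
  have last: "?ts ! t = Lf b" using us by (simp add: t_def)
  have p: "token_pos ?x (Suc t) = length (enc_nat n @ enc_dtree T)"
    using token_pos_eq[of "Suc t"] l by (simp add: enc_dtree_toks enc_nat_def)
  have "length ?x = token_pos ?x (Suc t) + 2 * l * n"
    using p es length_enc_pinstances[OF es(2)] by (simp add: assms(2) enc_input_def)
  moreover have "t < length ?x" using length_tokens l by simp
  moreover have "token_needs ?x 1 0 t = 1"
    using token_needs_eq[of 0 t 1] foldl_need_last[OF us, of 0] l us by (simp add: t_def)
  moreover have "\<not> token_head ?x t"
    using token_head_Nd[of t] last l by simp
  moreover have "token_label ?x i < n \<and> (\<forall>d<t - i. 0 < token_needs ?x 2 (Suc i) d \<longrightarrow>
      token_head ?x (Suc (i + d)) \<longrightarrow> token_label ?x (Suc (i + d)) \<noteq> token_label ?x i)"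
    if i: "i < t" "token_head ?x i" for i
  proof -
    obtain j where j: "?ts ! i = Nd j" "token_label ?x i = j"
      using token_head_Nd[of i] token_label_Nd[of i] i l by auto
    have "i < length ?ts" using i l by simp
    then have rep: "no_repetition ?ts" and lab: "j < n"
      using T j(1) unfolding dtree_over_toks by blast+
    have "token_label ?x (Suc (i + d)) \<noteq> j"
      if d: "d < t - i" "0 < token_needs ?x 2 (Suc i) d" "token_head ?x (Suc (i + d))" for d
    proof -
      obtain j' where j': "?ts ! Suc (i + d) = Nd j'" "token_label ?x (Suc (i + d)) = j'"
        using token_head_Nd[of "Suc (i + d)"] token_label_Nd[of "Suc (i + d)"] d(3) i(1) l
          less_diff_conv[THEN iffD1, OF d(1)] by (auto simp: add.commute)
      have "0 < foldl need_step 2 (take d (drop (i + 1) ?ts))"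
        using d token_needs_eq[of "Suc i" d 2] l by simp
      then have "?ts ! (i + 1 + d) \<noteq> Nd j"
        using rep[unfolded no_repetition_def, rule_format, of i j d] i d l j(1) by simp
      with j' show ?thesis by auto
    qed
    with j lab show ?thesis by simp
  qed
  moreover have "\<not> bit_at ?x (token_pos ?x (Suc t) + 2 * f + 1)"
    if "f < l * n" "\<not> bit_at ?x (token_pos ?x (Suc t) + 2 * f)" for f
  proof -
    let ?es = "concat es"
    have "length ?es = l * n"
      using length_enc_pinstances[OF es(2)] es(1) by (simp add: enc_pinstances_concat)
    moreover have "bit_at ?x (token_pos ?x (Suc t) + k) = bit_at (enc_pinstance ?es) k" for k
      unfolding p using bit_at_append[of "enc_nat n @ enc_dtree T" "enc_pinstance ?es" k]
      by (simp only: assms(2) enc_input_def enc_pinstances_concat append_assoc)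
    ultimately show ?thesis
      using enc_pinstance_canonical[of f ?es] that by (simp only: add.assoc simp_thms not_False_eq_True)
  qed
  ultimately show ?thesis
    unfolding tr_gcheck dim Let_def by (intro exI[of _ t]) simp
qed

text \<open>The strict bound provides the 0 that closes the unary number.\<close>

lemma drop_ones_from:
  assumes "p + ones_from x p < length x"
  shows "drop p x = enc_nat (ones_from x p) @ drop (p + ones_from x p + 1) x"
proof -
  let ?j = "ones_from x p"
  have "takeWhile id (drop p x) = replicate ?j True"
    by (rule replicate_eqI) (auto simp: ones_from_def dest: set_takeWhileD)
  moreover have "dropWhile id (drop p x) = drop ?j (drop p x)"
    by (simp add: ones_from_def dropWhile_eq_drop)
  ultimately have "drop p x = replicate ?j True @ drop (p + ?j) x"
    by (metis add.commute drop_drop takeWhile_dropWhile_id)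
  moreover have "drop (p + ?j) x = False # drop (p + ?j + 1) x"
    using assms not_bit_at_ones_from[of x p] by (simp add: bit_at_def flip: Cons_nth_drop_Suc)
  ultimately show ?thesis by (simp add: enc_nat_def)
qed

text \<open>Any bits parse as tokens, since the head bit alone decides the kind of token. The bound
  excludes a token cut off by the end of x, for which \<open>token_pos\<close> would
  overshoot.\<close>

lemma tokens_exist:
  assumes "token_pos x t \<le> length x"
  shows "\<exists>ts. length ts = t \<and> x = enc_nat (ones_from x 0) @ enc_tokens ts @ drop (token_pos x t) x"
  using assms
proof (induction t)
  case 0
  then have "0 + ones_from x 0 < length x" by (simp add: token_pos_def)
  then have "drop 0 x = enc_nat (ones_from x 0) @ drop (token_pos x 0) x"
    by (subst drop_ones_from) (simp_all add: token_pos_def)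
  then show ?case
    by (intro exI[of _ "[]"]) (simp only: list.map concat.simps append_Nil drop_0 list.size simp_thms)
next
  case (Suc t)
  define p where "p = token_pos x t"
  define k where "k = (if bit_at x p then 2 + ones_from x (p + 1) else 2)"
  have "token_pos x (Suc t) = min (length x + 5) (p + k)"
    by (simp add: token_pos_def p_def k_def)
  with Suc.prems have k: "token_pos x (Suc t) = p + k" "p + k \<le> length x" by auto
  then obtain ts where ts: "length ts = t" "x = enc_nat (ones_from x 0) @ enc_tokens ts @ drop p x"
    using Suc.IH p_def by auto
  have "\<exists>a. drop p x = enc_token a @ drop (p + k) x"
  proof (cases "bit_at x p")
    case True
    then have "drop p x = True # drop (p + 1) x"
      by (auto simp: bit_at_def Cons_nth_drop_Suc[symmetric])
    moreover have "drop (p + 1) x = enc_nat (ones_from x (p + 1)) @ drop (p + k) x"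
      using drop_ones_from[of "p + 1" x] k True by (simp add: k_def)
    ultimately show ?thesis
      by (intro exI[of _ "Nd (ones_from x (p + 1))"]) simp
  next
    case False
    have "p + 1 < length x" using k False by (simp add: k_def)
    then have "drop p x = x ! p # x ! (p + 1) # drop (p + 2) x"
      by (simp add: Cons_nth_drop_Suc)
    then show ?thesis
      using False \<open>p + 1 < length x\<close> by (intro exI[of _ "Lf (x ! (p + 1))"]) (simp add: k_def bit_at_def)
  qed
  then obtain a where "drop p x = enc_token a @ drop (p + k) x" ..
  then have "enc_nat (ones_from x 0) @ enc_tokens ts @ drop p x =
      enc_nat (ones_from x 0) @ enc_tokens (ts @ [a]) @ drop (token_pos x (Suc t)) x"
    by (simp add: k(1))
  with ts show ?case
    by (intro exI[of _ "ts @ [a]"]) (simp only: length_append_singleton simp_thms)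
qed

text \<open>Need 1 in front of a leaf makes the parsed tokens a tree by
  \<open>foldl_need_tree\<close>, the conditions on nodes give it dimension n, and the absence of
  pairs 01 makes the rest the encoding of l instances.\<close>

lemma gcheck_valid_input:
  assumes "tr ws \<rho> (gcheck l)"
  shows "\<exists>n T es. valid_input l n T es \<and> ws ! 0 = enc_input n T es"
proof -
  define x where "x = ws ! 0"
  define n where "n = ones_from x 0"
  obtain t where t: "t < length x" "token_pos x (Suc t) + 2 * l * n = length x"
      "token_needs x 1 0 t = 1" "\<not> token_head x t"
    and nodes: "\<And>i. i < t \<Longrightarrow> token_head x i \<Longrightarrow> token_label x i < n"
      "\<And>i d. i < t \<Longrightarrow> token_head x i \<Longrightarrow> d < t - i \<Longrightarrow> 0 < token_needs x 2 (Suc i) d \<Longrightarrow>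
         token_head x (Suc (i + d)) \<Longrightarrow> token_label x (Suc (i + d)) \<noteq> token_label x i"
    and vals: "\<And>f. f < l * n \<Longrightarrow> \<not> bit_at x (token_pos x (Suc t) + 2 * f) \<Longrightarrow>
        \<not> bit_at x (token_pos x (Suc t) + 2 * f + 1)"
    using assms unfolding tr_gcheck Let_def x_def[symmetric] n_def[symmetric] by blast
  let ?v = "drop (token_pos x (Suc t)) x"
  obtain ts where ts: "length ts = Suc t" "x = enc_nat n @ enc_tokens ts @ ?v"
    using tokens_exist[of x "Suc t"] t(2) n_def by auto
  interpret token_string x n ts ?v
    by unfold_locales (rule ts)
  obtain b where "ts ! t = Lf b"
    using token_head_Nd[of t] t(4) ts(1) by (cases "ts ! t") auto
  then have split: "ts = take t ts @ [Lf b]"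
    using ts(1) take_Suc_conv_app_nth[of t ts] by simp
  have "foldl need_step 1 (take t ts) = 1"
    using token_needs_eq[of 0 t 1] t(3) ts(1) by simp
  then obtain T where T: "toks T = ts"
    using foldl_need_tree split by metis
  have "dtree_over {..<n} T"
    unfolding dtree_over_toks T no_repetition_def
  proof (intro conjI allI impI)
    fix i j assume i: "i < length ts" "ts ! i = Nd j"
    then have "i < t"
      using \<open>ts ! t = Lf b\<close> ts(1) by (cases "i = t") auto
    moreover have hd: "token_head x i" "token_label x i = j"
      using i token_head_Nd token_label_Nd by auto
    ultimately show "j \<in> {..<n}" using nodes(1) by auto
    fix d assume d: "i + 1 + d < length ts" "0 < foldl need_step 2 (take d (drop (i + 1) ts))"
    have "d < t - i" using d(1) ts(1) by simp
    have "0 < token_needs x 2 (Suc i) d"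
      using d token_needs_eq[of "Suc i" d 2] by simp
    show "ts ! (i + 1 + d) \<noteq> Nd j"
    proof
      assume "ts ! (i + 1 + d) = Nd j"
      then have "token_head x (Suc (i + d))" "token_label x (Suc (i + d)) = j"
        using d(1) token_head_Nd[of "Suc (i + d)"] token_label_Nd[of "Suc (i + d)"] by auto
      with nodes(2)[OF \<open>i < t\<close> hd(1) \<open>d < t - i\<close> \<open>0 < token_needs x 2 (Suc i) d\<close>] hd(2)
      show False by auto
    qed
  qed
  obtain es where es: "length es = l" "\<forall>e\<in>set es. length e = n" "concat es = inst ?v 0 (n * l)"
    using concat_uniform[of "inst ?v 0 (n * l)" n l] by auto
  have "enc_pinstance (inst ?v 0 (n * l)) = ?v"
  proof (rule enc_pinstance_inst)
    show "length ?v = 2 * (n * l)" using t(2) by (simp add: mult_ac)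
    show "\<not> bit_at ?v (2 * f + 1)" if "f < n * l" "\<not> bit_at ?v (2 * f)" for f
      using vals[of f] that by (simp add: bit_at_drop mult.commute)
  qed
  then have "concat (map enc_pinstance es) = ?v"
    by (simp only: enc_pinstances_concat es(3))
  then have "enc_input n T es = enc_nat n @ enc_tokens ts @ ?v"
    by (simp only: enc_input_def enc_dtree_toks T)
  with ts(2) have "x = enc_input n T es"
    by (rule trans[OF _ sym])
  moreover have "valid_input l n T es"
    using \<open>dtree_over {..<n} T\<close> es by (auto simp: valid_input_def dtree_of_dim_def pinstances_def)
  ultimately show ?thesis unfolding x_def by blast
qed

section \<open>Atoms, prenex form and matrix of a formula\<close>

definition gpos :: "nat \<times> gen \<Rightarrow> gen" where
  "gpos s = (let v = fresh (snd s) in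
     gand (gall v gdim (gdef s (Var v))) (geq (gtree_scan s) (gnum 2)))"

definition gsub :: "nat \<times> gen \<Rightarrow> nat \<times> gen \<Rightarrow> gen" where
  "gsub s s' = (let v = max (fresh (snd s)) (fresh (snd s')) in
     gall v gdim (gimp (gdef s (Var v)) (gand (gdef s' (Var v))
       (gand (gimp (gval s (Var v)) (gval s' (Var v))) (gimp (gval s' (Var v)) (gval s (Var v)))))))"

lemma labels_subset: "dtree_over F T \<Longrightarrow> labels T \<subseteq> F"
  using no_repetition_toks[of T "[]" F] by simp

lemma tr_gpos:
  assumes "valid_input l n T es" "ws ! 0 = enc_input n T es"
  shows "tr ws \<rho> (gpos s) \<longleftrightarrow> positive T (inst (ws ! fst s) (val ws \<rho> (snd s)) n)"
proof -
  interpret token_string "ws ! 0" n "toks T" "concat (map enc_pinstance es)"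
    using valid_input_token_string[OF assms(1)] assms(2) by simp
  let ?p = "val ws \<rho> (snd s)" and ?w = "ws ! fst s"
  let ?e = "inst ?w ?p n"
  have all: "None \<notin> set ?e \<longleftrightarrow> (\<forall>f<n. bit_at ?w (?p + 2 * f))"
    by (auto simp: inst_def image_iff)
  have "tree_scan (ws ! 0) (\<lambda>j. bit_at ?w (?p + 2 * j + 1)) = (if classify T (map the ?e) then 2 else 1)"
    if "\<forall>f<n. bit_at ?w (?p + 2 * f)"
  proof (rule tree_scan_eq[OF refl])
    fix j assume "j \<in> labels T"
    then have "j < n"
      using labels_subset assms(1) by (auto simp: valid_input_def dtree_of_dim_def)
    then show "bit_at ?w (?p + 2 * j + 1) = map the ?e ! j"
      using that by (simp add: inst_def)
  qed
  then show ?thesis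
    unfolding positive_def all using dim by (auto simp: gpos_def Let_def split: if_splits)
qed

lemma tr_gsub:
  assumes "ones_from (ws ! 0) 0 = n"
  shows "tr ws \<rho> (gsub s s') \<longleftrightarrow>
    subsumed (inst (ws ! fst s) (val ws \<rho> (snd s)) n) (inst (ws ! fst s') (val ws \<rho> (snd s')) n)"
proof -
  define D where "D = (\<lambda>f. bit_at (ws ! fst s) (val ws \<rho> (snd s) + 2 * f))"
  define V where "V = (\<lambda>f. bit_at (ws ! fst s) (val ws \<rho> (snd s) + 2 * f + 1))"
  define D' where "D' = (\<lambda>f. bit_at (ws ! fst s') (val ws \<rho> (snd s') + 2 * f))"
  define V' where "V' = (\<lambda>f. bit_at (ws ! fst s') (val ws \<rho> (snd s') + 2 * f + 1))"
  define v where "v = max (fresh (snd s)) (fresh (snd s'))"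
  have v: "fresh (snd s) \<le> v" "fresh (snd s') \<le> v" by (simp_all add: v_def)
  have "tr ws \<rho> (gsub s s') \<longleftrightarrow> (\<forall>f<n. D f \<longrightarrow> D' f \<and> (V f \<longrightarrow> V' f) \<and> (V' f \<longrightarrow> V f))"
    using v by (simp add: gsub_def Let_def v_def[symmetric] assms D_def D'_def V_def V'_def)
  moreover have "subsumed (inst (ws ! fst s) (val ws \<rho> (snd s)) n)
      (inst (ws ! fst s') (val ws \<rho> (snd s')) n) \<longleftrightarrow>
    (\<forall>f<n. (if D f then Some (V f) else None) \<noteq> None \<longrightarrow>
      (if D f then Some (V f) else None) = (if D' f then Some (V' f) else None))"
    unfolding subsumed_def length_inst D_def D'_def V_def V'_def by (simp add: inst_def cong: if_cong)
  moreover have "((if D f then Some (V f) else None) \<noteq> None \<longrightarrow>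
      (if D f then Some (V f) else None) = (if D' f then Some (V' f) else None)) \<longleftrightarrow>
      (D f \<longrightarrow> D' f \<and> (V f \<longrightarrow> V' f) \<and> (V' f \<longrightarrow> V f))" for f
    by (cases "D f"; cases "D' f") auto
  ultimately show ?thesis by (simp only: )
qed

lemma subsumed_antisym: "subsumed d e \<and> subsumed e d \<longleftrightarrow> d = e"
proof
  assume a: "subsumed d e \<and> subsumed e d"
  show "d = e"
  proof (rule nth_equalityI)
    fix i assume i: "i < length d"
    moreover have "i < length e" using a i unfolding subsumed_def by metis
    ultimately have "d ! i \<noteq> None \<longrightarrow> d ! i = e ! i" "e ! i \<noteq> None \<longrightarrow> e ! i = d ! i"
      using a unfolding subsumed_def by blast+
    then show "d ! i = e ! i" by metis
  next
    show "length d = length e" using a unfolding subsumed_def by blast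
  qed
qed (simp add: subsumed_def)

text \<open>Prenex form: \<open>prefix_of\<close> lists the quantifiers (\<open>True\<close> is existential), \<open>matrix_holds\<close>
  evaluates the matrix where the j-th quantified instance is \<open>ds ! j\<close>.\<close>

fun prefix_of :: "foil \<Rightarrow> bool list" where
  "prefix_of (Neg \<phi>) = map Not (prefix_of \<phi>)"
| "prefix_of (And \<phi> \<psi>) = prefix_of \<phi> @ prefix_of \<psi>"
| "prefix_of (Or \<phi> \<psi>) = prefix_of \<phi> @ prefix_of \<psi>"
| "prefix_of (Ex x \<phi>) = True # prefix_of \<phi>"
| "prefix_of (All x \<phi>) = False # prefix_of \<phi>"
| "prefix_of _ = []"

fun matrix_holds :: "dtree \<Rightarrow> pinstance list \<Rightarrow> foil \<Rightarrow> (nat \<Rightarrow> pinstance) \<Rightarrow> nat \<Rightarrow> bool" where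
  "matrix_holds T ds (Pos x) \<sigma> j \<longleftrightarrow> positive T (\<sigma> x)"
| "matrix_holds T ds (Sub x y) \<sigma> j \<longleftrightarrow> subsumed (\<sigma> x) (\<sigma> y)"
| "matrix_holds T ds (Eq x y) \<sigma> j \<longleftrightarrow> \<sigma> x = \<sigma> y"
| "matrix_holds T ds (Neg \<phi>) \<sigma> j \<longleftrightarrow> \<not> matrix_holds T ds \<phi> \<sigma> j"
| "matrix_holds T ds (And \<phi> \<psi>) \<sigma> j \<longleftrightarrow>
     matrix_holds T ds \<phi> \<sigma> j \<and> matrix_holds T ds \<psi> \<sigma> (j + length (prefix_of \<phi>))"
| "matrix_holds T ds (Or \<phi> \<psi>) \<sigma> j \<longleftrightarrow>
     matrix_holds T ds \<phi> \<sigma> j \<or> matrix_holds T ds \<psi> \<sigma> (j + length (prefix_of \<phi>))"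
| "matrix_holds T ds (Ex x \<phi>) \<sigma> j \<longleftrightarrow> matrix_holds T ds \<phi> (\<sigma>(x := ds ! j)) (Suc j)"
| "matrix_holds T ds (All x \<phi>) \<sigma> j \<longleftrightarrow> matrix_holds T ds \<phi> (\<sigma>(x := ds ! j)) (Suc j)"

fun quantified :: "bool list \<Rightarrow> 'a set \<Rightarrow> ('a list \<Rightarrow> bool) \<Rightarrow> bool" where
  "quantified [] D R \<longleftrightarrow> R []"
| "quantified (b # bs) D R \<longleftrightarrow>
     (if b then \<exists>u\<in>D. quantified bs D (\<lambda>us. R (u # us)) else \<forall>u\<in>D. quantified bs D (\<lambda>us. R (u # us)))"

lemma quantified_cong:
  "(\<And>us. length us = length bs \<Longrightarrow> R us = R' us) \<Longrightarrow> quantified bs D R = quantified bs D R'"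
proof (induction bs arbitrary: R R')
  case (Cons b bs)
  have "quantified bs D (\<lambda>us. R (u # us)) = quantified bs D (\<lambda>us. R' (u # us))" for u
    by (rule Cons.IH) (simp add: Cons.prems)
  then show ?case by simp
qed simp

lemma quantified_Not: "quantified (map Not bs) D (\<lambda>us. \<not> R us) \<longleftrightarrow> \<not> quantified bs D R"
  by (induction bs arbitrary: R) auto

lemma quantified_append:
  "quantified (bs @ bs') D R \<longleftrightarrow> quantified bs D (\<lambda>us. quantified bs' D (\<lambda>us'. R (us @ us')))"
  by (induction bs arbitrary: R) auto

lemma quantified_conj: "D \<noteq> {} \<Longrightarrow> quantified bs D (\<lambda>us. P \<and> R us) \<longleftrightarrow> P \<and> quantified bs D R"
  by (induction bs arbitrary: R) auto

lemma quantified_disj: "D \<noteq> {} \<Longrightarrow> quantified bs D (\<lambda>us. P \<or> R us) \<longleftrightarrow> P \<or> quantified bs D R"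
  by (induction bs arbitrary: R) auto

lemma quantified_image: "quantified bs (f ` D) R \<longleftrightarrow> quantified bs D (\<lambda>us. R (map f us))"
  by (induction bs arbitrary: R) auto

lemma matrix_holds_cong:
  "(\<And>i. j \<le> i \<Longrightarrow> i < j + length (prefix_of \<phi>) \<Longrightarrow> ds ! i = ds' ! i) \<Longrightarrow>
     matrix_holds T ds \<phi> \<sigma> j = matrix_holds T ds' \<phi> \<sigma> j"
proof (induction \<phi> arbitrary: \<sigma> j)
  case (And \<phi> \<psi>)
  have "matrix_holds T ds \<phi> \<sigma> j = matrix_holds T ds' \<phi> \<sigma> j"
    "matrix_holds T ds \<psi> \<sigma> (j + length (prefix_of \<phi>)) = matrix_holds T ds' \<psi> \<sigma> (j + length (prefix_of \<phi>))"
    by (intro And.IH And.prems; simp)+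
  then show ?case by simp
next
  case (Or \<phi> \<psi>)
  have "matrix_holds T ds \<phi> \<sigma> j = matrix_holds T ds' \<phi> \<sigma> j"
    "matrix_holds T ds \<psi> \<sigma> (j + length (prefix_of \<phi>)) = matrix_holds T ds' \<psi> \<sigma> (j + length (prefix_of \<phi>))"
    by (intro Or.IH Or.prems; simp)+
  then show ?case by simp
next
  case (Ex x \<phi>)
  have "ds ! j = ds' ! j" using Ex.prems[of j] by simp
  moreover have "matrix_holds T ds \<phi> \<sigma>' (Suc j) = matrix_holds T ds' \<phi> \<sigma>' (Suc j)" for \<sigma>'
    by (intro Ex.IH Ex.prems; simp)
  ultimately show ?case by simp
next
  case (All x \<phi>)
  have "ds ! j = ds' ! j" using All.prems[of j] by simp
  moreover have "matrix_holds T ds \<phi> \<sigma>' (Suc j) = matrix_holds T ds' \<phi> \<sigma>' (Suc j)" for \<sigma>'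
    by (intro All.IH All.prems; simp)
  ultimately show ?case by simp
qed auto

lemma pinstances_nonempty: "pinstances n \<noteq> {}"
  using inst_in_pinstances by blast

text \<open>\<open>us\<close> and \<open>vs\<close> are instances of the surrounding prefix, so that
  the two sides of a connective address their own segments of one list. Quantifiers move out of a
  connective because the domain is nonempty.\<close>

lemma sat_quantified:
  "sat n T \<sigma> \<phi> \<longleftrightarrow> quantified (prefix_of \<phi>) (pinstances n)
     (\<lambda>ds. matrix_holds T (us @ ds @ vs) \<phi> \<sigma> (length us))"
proof (induction \<phi> arbitrary: \<sigma> us vs)
  case (Neg \<phi>)
  have "quantified (map Not (prefix_of \<phi>)) (pinstances n)
      (\<lambda>ds. \<not> matrix_holds T (us @ ds @ vs) \<phi> \<sigma> (length us)) \<longleftrightarrow> \<not> sat n T \<sigma> \<phi>"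
    by (simp only: quantified_Not Neg.IH[of \<sigma> us vs])
  then show ?case by simp
next
  case (And \<phi> \<psi>)
  let ?Q = "\<lambda>\<phi>. quantified (prefix_of \<phi>) (pinstances n)"
  have "?Q (And \<phi> \<psi>) (\<lambda>ds. matrix_holds T (us @ ds @ vs) (And \<phi> \<psi>) \<sigma> (length us)) \<longleftrightarrow>
     ?Q \<phi> (\<lambda>ds. ?Q \<psi> (\<lambda>ds'. matrix_holds T (us @ (ds @ ds') @ vs) \<phi> \<sigma> (length us) \<and>
       matrix_holds T (us @ (ds @ ds') @ vs) \<psi> \<sigma> (length us + length (prefix_of \<phi>))))"
    by (simp only: prefix_of.simps quantified_append matrix_holds.simps)
  also have "\<dots> \<longleftrightarrow> ?Q \<phi> (\<lambda>ds. sat n T \<sigma> \<psi> \<and> matrix_holds T (us @ ds @ vs) \<phi> \<sigma> (length us))"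
  proof (rule quantified_cong)
    fix ds :: "pinstance list" assume ds: "length ds = length (prefix_of \<phi>)"
    have "matrix_holds T (us @ (ds @ ds') @ vs) \<phi> \<sigma> (length us) =
        matrix_holds T (us @ ds @ vs) \<phi> \<sigma> (length us)" for ds'
      using ds by (intro matrix_holds_cong) (auto simp: nth_append)
    then have "?Q \<psi> (\<lambda>ds'. matrix_holds T (us @ (ds @ ds') @ vs) \<phi> \<sigma> (length us) \<and>
       matrix_holds T (us @ (ds @ ds') @ vs) \<psi> \<sigma> (length us + length (prefix_of \<phi>))) \<longleftrightarrow>
      ?Q \<psi> (\<lambda>ds'. matrix_holds T (us @ ds @ vs) \<phi> \<sigma> (length us) \<and>
       matrix_holds T ((us @ ds) @ ds' @ vs) \<psi> \<sigma> (length (us @ ds)))"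
      using ds by simp
    also have "\<dots> \<longleftrightarrow> matrix_holds T (us @ ds @ vs) \<phi> \<sigma> (length us) \<and> sat n T \<sigma> \<psi>"
      by (simp only: quantified_conj[OF pinstances_nonempty] And.IH(2)[of \<sigma> "us @ ds" vs])
    finally show "?Q \<psi> (\<lambda>ds'. matrix_holds T (us @ (ds @ ds') @ vs) \<phi> \<sigma> (length us) \<and>
       matrix_holds T (us @ (ds @ ds') @ vs) \<psi> \<sigma> (length us + length (prefix_of \<phi>))) \<longleftrightarrow>
       sat n T \<sigma> \<psi> \<and> matrix_holds T (us @ ds @ vs) \<phi> \<sigma> (length us)" by blast
  qed
  also have "\<dots> \<longleftrightarrow> sat n T \<sigma> \<psi> \<and> sat n T \<sigma> \<phi>"
    by (simp only: quantified_conj[OF pinstances_nonempty] And.IH(1)[of \<sigma> us vs])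
  finally show ?case by auto
next
  case (Or \<phi> \<psi>)
  let ?Q = "\<lambda>\<phi>. quantified (prefix_of \<phi>) (pinstances n)"
  have "?Q (Or \<phi> \<psi>) (\<lambda>ds. matrix_holds T (us @ ds @ vs) (Or \<phi> \<psi>) \<sigma> (length us)) \<longleftrightarrow>
     ?Q \<phi> (\<lambda>ds. ?Q \<psi> (\<lambda>ds'. matrix_holds T (us @ (ds @ ds') @ vs) \<phi> \<sigma> (length us) \<or>
       matrix_holds T (us @ (ds @ ds') @ vs) \<psi> \<sigma> (length us + length (prefix_of \<phi>))))"
    by (simp only: prefix_of.simps quantified_append matrix_holds.simps)
  also have "\<dots> \<longleftrightarrow> ?Q \<phi> (\<lambda>ds. sat n T \<sigma> \<psi> \<or> matrix_holds T (us @ ds @ vs) \<phi> \<sigma> (length us))"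
  proof (rule quantified_cong)
    fix ds :: "pinstance list" assume ds: "length ds = length (prefix_of \<phi>)"
    have "matrix_holds T (us @ (ds @ ds') @ vs) \<phi> \<sigma> (length us) =
        matrix_holds T (us @ ds @ vs) \<phi> \<sigma> (length us)" for ds'
      using ds by (intro matrix_holds_cong) (auto simp: nth_append)
    then have "?Q \<psi> (\<lambda>ds'. matrix_holds T (us @ (ds @ ds') @ vs) \<phi> \<sigma> (length us) \<or>
       matrix_holds T (us @ (ds @ ds') @ vs) \<psi> \<sigma> (length us + length (prefix_of \<phi>))) \<longleftrightarrow>
      ?Q \<psi> (\<lambda>ds'. matrix_holds T (us @ ds @ vs) \<phi> \<sigma> (length us) \<or>
       matrix_holds T ((us @ ds) @ ds' @ vs) \<psi> \<sigma> (length (us @ ds)))"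
      using ds by simp
    also have "\<dots> \<longleftrightarrow> matrix_holds T (us @ ds @ vs) \<phi> \<sigma> (length us) \<or> sat n T \<sigma> \<psi>"
      by (simp only: quantified_disj[OF pinstances_nonempty] Or.IH(2)[of \<sigma> "us @ ds" vs])
    finally show "?Q \<psi> (\<lambda>ds'. matrix_holds T (us @ (ds @ ds') @ vs) \<phi> \<sigma> (length us) \<or>
       matrix_holds T (us @ (ds @ ds') @ vs) \<psi> \<sigma> (length us + length (prefix_of \<phi>))) \<longleftrightarrow>
       sat n T \<sigma> \<psi> \<or> matrix_holds T (us @ ds @ vs) \<phi> \<sigma> (length us)" by blast
  qed
  also have "\<dots> \<longleftrightarrow> sat n T \<sigma> \<psi> \<or> sat n T \<sigma> \<phi>"
    by (simp only: quantified_disj[OF pinstances_nonempty] Or.IH(1)[of \<sigma> us vs])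
  finally show ?case by auto
next
  case (Ex x \<phi>)
  have "sat n T (\<sigma>(x := e)) \<phi> \<longleftrightarrow> quantified (prefix_of \<phi>) (pinstances n)
     (\<lambda>ds. matrix_holds T ((us @ [e]) @ ds @ vs) \<phi> (\<sigma>(x := e)) (length (us @ [e])))" for e
    by (rule Ex.IH)
  then show ?case by simp
next
  case (All x \<phi>)
  have "sat n T (\<sigma>(x := e)) \<phi> \<longleftrightarrow> quantified (prefix_of \<phi>) (pinstances n)
     (\<lambda>ds. matrix_holds T ((us @ [e]) @ ds @ vs) \<phi> (\<sigma>(x := e)) (length (us @ [e])))" for e
    by (rule All.IH)
  then show ?case by simp
qed auto

text \<open>A quantifier of the prefix uses every other quantifier of an alternating block of twice the
  length.\<close>

fun pick :: "bool list \<Rightarrow> 'a list \<Rightarrow> 'a list" where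
  "pick [] us = []"
| "pick (b # bs) us = us ! (if b then 0 else 1) # pick bs (drop 2 us)"

definition pick_index :: "bool list \<Rightarrow> nat \<Rightarrow> nat" where
  "pick_index bs j = 2 * j + (if bs ! j then 0 else 1)"

lemma length_pick [simp]: "length (pick bs us) = length bs"
  by (induction bs arbitrary: us) auto

lemma alternation_pick:
  "alternation True (2 * length bs) m (\<lambda>us. R (pick bs us)) \<longleftrightarrow> quantified bs {u. length u = m} R"
proof (induction bs arbitrary: R)
  case (Cons b bs)
  have ne: "\<exists>u :: bool list. length u = m" by (rule exI[of _ "replicate m False"]) simp
  have len: "2 * length (b # bs) = Suc (Suc (2 * length bs))" by simp
  have pick: "pick (b # bs) (u # u' # us) = (if b then u else u') # pick bs us" for u u' :: "bool list" and us
    by simp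
  have IH: "alternation True (2 * length bs) m (\<lambda>us. R (v # pick bs us)) \<longleftrightarrow>
      quantified bs {u. length u = m} (\<lambda>us. R (v # us))" for v
    by (rule Cons.IH)
  have "alternation True (2 * length (b # bs)) m (\<lambda>us. R (pick (b # bs) us)) \<longleftrightarrow>
    (\<exists>u. length u = m \<and> (\<forall>u'. length u' = m \<longrightarrow>
       quantified bs {u. length u = m} (\<lambda>us. R ((if b then u else u') # us))))"
    unfolding len alternation.simps by (simp only: pick IH)
  also have "\<dots> \<longleftrightarrow> quantified (b # bs) {u. length u = m} R"
    using ne by auto
  finally show ?case .
qed simp

lemma alternation_const: "alternation b k m (\<lambda>_. P) \<longleftrightarrow> P"
proof (induction k arbitrary: b)
  case (Suc k)
  have "\<exists>u :: bool list. length u = m" by (rule exI[of _ "replicate m False"]) simp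
  with Suc show ?case by (cases b) auto
qed simp

text \<open>The prenex formula is never built: a quantifier merely binds its variable to the next
  word, read from offset 0.\<close>

fun gmatrix :: "(nat \<Rightarrow> nat) \<Rightarrow> foil \<Rightarrow> (nat \<Rightarrow> nat \<times> gen) \<Rightarrow> nat \<Rightarrow> gen" where
  "gmatrix ix (Pos x) env j = gpos (env x)"
| "gmatrix ix (Sub x y) env j = gsub (env x) (env y)"
| "gmatrix ix (Eq x y) env j = gand (gsub (env x) (env y)) (gsub (env y) (env x))"
| "gmatrix ix (Neg \<phi>) env j = gnot (gmatrix ix \<phi> env j)"
| "gmatrix ix (And \<phi> \<psi>) env j =
     gand (gmatrix ix \<phi> env j) (gmatrix ix \<psi> env (j + length (prefix_of \<phi>)))"
| "gmatrix ix (Or \<phi> \<psi>) env j =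
     gor (gmatrix ix \<phi> env j) (gmatrix ix \<psi> env (j + length (prefix_of \<phi>)))"
| "gmatrix ix (Ex x \<phi>) env j = gmatrix ix \<phi> (env(x := (ix j, gzero))) (Suc j)"
| "gmatrix ix (All x \<phi>) env j = gmatrix ix \<phi> (env(x := (ix j, gzero))) (Suc j)"

lemma tr_gmatrix:
  assumes "valid_input l n T es" "ws ! 0 = enc_input n T es"
    "\<And>x. x \<in> free_vars \<phi> \<Longrightarrow> \<sigma> x = inst (ws ! fst (env x)) (val ws \<rho> (snd (env x))) n"
    "\<And>i. j \<le> i \<Longrightarrow> i < j + length (prefix_of \<phi>) \<Longrightarrow> ds ! i = inst (ws ! ix i) 0 n"
  shows "tr ws \<rho> (gmatrix ix \<phi> env j) \<longleftrightarrow> matrix_holds T ds \<phi> \<sigma> j"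
proof -
  interpret token_string "ws ! 0" n "toks T" "concat (map enc_pinstance es)"
    using valid_input_token_string[OF assms(1)] assms(2) by simp
  show ?thesis
    using assms(3,4)
  proof (induction \<phi> arbitrary: env j \<sigma>)
    case (Pos x)
    then show ?case using tr_gpos[OF assms(1,2)] by simp
  next
    case (Sub x y)
    then show ?case using tr_gsub[OF dim] by simp
  next
    case (Eq x y)
    then show ?case using tr_gsub[OF dim] subsumed_antisym by simp
  next
    case (Neg \<phi>)
    have "tr ws \<rho> (gmatrix ix \<phi> env j) \<longleftrightarrow> matrix_holds T ds \<phi> \<sigma> j"
      by (intro Neg.IH Neg.prems; simp)
    then show ?case by simp
  next
    case (And \<phi> \<psi>)
    have "tr ws \<rho> (gmatrix ix \<phi> env j) \<longleftrightarrow> matrix_holds T ds \<phi> \<sigma> j"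
      "tr ws \<rho> (gmatrix ix \<psi> env (j + length (prefix_of \<phi>))) \<longleftrightarrow>
         matrix_holds T ds \<psi> \<sigma> (j + length (prefix_of \<phi>))"
      by (intro And.IH And.prems; simp)+
    then show ?case by simp
  next
    case (Or \<phi> \<psi>)
    have "tr ws \<rho> (gmatrix ix \<phi> env j) \<longleftrightarrow> matrix_holds T ds \<phi> \<sigma> j"
      "tr ws \<rho> (gmatrix ix \<psi> env (j + length (prefix_of \<phi>))) \<longleftrightarrow>
         matrix_holds T ds \<psi> \<sigma> (j + length (prefix_of \<phi>))"
      by (intro Or.IH Or.prems; simp)+
    then show ?case by simp
  next
    case (Ex x \<phi>)
    have "ds ! j = inst (ws ! ix j) 0 n" using Ex.prems(2)[of j] by simp
    then have "tr ws \<rho> (gmatrix ix \<phi> (env(x := (ix j, gzero))) (Suc j)) \<longleftrightarrow>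
        matrix_holds T ds \<phi> (\<sigma>(x := ds ! j)) (Suc j)"
      by (intro Ex.IH) (auto simp: Ex.prems)
    then show ?case by simp
  next
    case (All x \<phi>)
    have "ds ! j = inst (ws ! ix j) 0 n" using All.prems(2)[of j] by simp
    then have "tr ws \<rho> (gmatrix ix \<phi> (env(x := (ix j, gzero))) (Suc j)) \<longleftrightarrow>
        matrix_holds T ds \<phi> (\<sigma>(x := ds ! j)) (Suc j)"
      by (intro All.IH) (auto simp: All.prems)
    then show ?case by simp
  qed
qed

lemmas gtoken_defs = gcap_def gones_def gdim_def gtoken_pos_def gtoken_head_def gtoken_label_def
  gtoken_bit_def gtoken_needs_def gdef_def gval_def gtree_scan_def gcheck_def gpos_def gsub_def

lemma word_indices_gpos: "word_indices (gpos s) = {0, fst s} \<union> word_indices (snd s)"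
  by (auto simp: gtoken_defs Let_def)

lemma word_indices_gsub:
  "word_indices (gsub s s') = {0, fst s, fst s'} \<union> word_indices (snd s) \<union> word_indices (snd s')"
  by (auto simp: gtoken_defs Let_def)

lemma word_indices_gcheck: "word_indices (gcheck l) = {0}"
  by (auto simp: gtoken_defs Let_def)

lemma word_indices_gmatrix:
  "0 \<in> W \<Longrightarrow> (\<And>x. x \<in> free_vars \<phi> \<Longrightarrow> fst (env x) \<in> W \<and> word_indices (snd (env x)) \<subseteq> W) \<Longrightarrow>
   (\<And>i. j \<le> i \<Longrightarrow> i < j + length (prefix_of \<phi>) \<Longrightarrow> ix i \<in> W) \<Longrightarrow> word_indices (gmatrix ix \<phi> env j) \<subseteq> W"
proof (induction \<phi> arbitrary: env j)
  case (And \<phi> \<psi>)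
  have "word_indices (gmatrix ix \<phi> env j) \<subseteq> W"
    "word_indices (gmatrix ix \<psi> env (j + length (prefix_of \<phi>))) \<subseteq> W"
    by (intro And.IH And.prems; simp)+
  then show ?case by simp
next
  case (Or \<phi> \<psi>)
  have "word_indices (gmatrix ix \<phi> env j) \<subseteq> W"
    "word_indices (gmatrix ix \<psi> env (j + length (prefix_of \<phi>))) \<subseteq> W"
    by (intro Or.IH Or.prems; simp)+
  then show ?case by simp
next
  case (Ex x \<phi>)
  have "word_indices (gmatrix ix \<phi> (env(x := (ix j, gzero))) (Suc j)) \<subseteq> W"
    using Ex.prems by (intro Ex.IH) auto
  then show ?case by simp
next
  case (All x \<phi>)
  have "word_indices (gmatrix ix \<phi> (env(x := (ix j, gzero))) (Suc j)) \<subseteq> W"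
    using All.prems by (intro All.IH) auto
  then show ?case by simp
qed (auto simp: word_indices_gpos word_indices_gsub)

lemma nth_pick: "j < length bs \<Longrightarrow> 2 * length bs \<le> length us \<Longrightarrow> pick bs us ! j = us ! pick_index bs j"
proof (induction bs arbitrary: us j)
  case (Cons b bs)
  show ?case
  proof (cases j)
    case 0
    then show ?thesis by (simp add: pick_index_def)
  next
    case (Suc j')
    have "pick bs (drop 2 us) ! j' = drop 2 us ! pick_index bs j'"
      using Cons Suc by (intro Cons.IH) auto
    with Suc Cons.prems show ?thesis by (simp add: pick_index_def)
  qed
qed simp

lemma alternation_cong:
  "(\<And>us. length us = k \<Longrightarrow> R us = R' us) \<Longrightarrow> alternation b k m R = alternation b k m R'"
proof (induction k arbitrary: b R R')
  case (Suc k)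
  have "alternation b' k m (\<lambda>us. R (u # us)) = alternation b' k m (\<lambda>us. R' (u # us))" for b' u
    by (rule Suc.IH) (simp add: Suc.prems)
  then show ?case by (cases b) auto
qed simp

theorem Eval_in_Sigma_P: "\<exists>k. Eval \<phi> \<in> Sigma_P k"
proof -
  define vl where "vl = var_list \<phi>"
  define l where "l = card (free_vars \<phi>)"
  define bs where "bs = prefix_of \<phi>"
  define ix where "ix = (\<lambda>j. Suc (pick_index bs j))"
  define idx where "idx = (\<lambda>x. SOME i. i < l \<and> vl ! i = x)"
  define env where "env = (\<lambda>x. (0 :: nat, Monus (Len 0) (grep (gnum (2 * (l - idx x))) gdim)))"
  define G where "G = gand (gcheck l) (gmatrix ix \<phi> env 0)"
  define R where "R = (\<lambda>ws. tr ws (\<lambda>_. 0) G)"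
  let ?k = "2 * length bs"
  have fin: "finite (free_vars \<phi>)" by (induction \<phi>) auto
  then have vl: "set vl = free_vars \<phi>" "distinct vl" "length vl = l"
    by (auto simp: vl_def var_list_def l_def)
  have idx: "idx x < l" "vl ! idx x = x" if "x \<in> free_vars \<phi>" for x
  proof -
    have "\<exists>i. i < l \<and> vl ! i = x"
      using that vl by (metis in_set_conv_nth)
    then show "idx x < l" "vl ! idx x = x"
      unfolding idx_def by (metis (mono_tags, lifting) someI_ex)+
  qed
  have "word_indices G \<subseteq> {..<Suc ?k}"
  proof -
    have "word_indices (gmatrix ix \<phi> env 0) \<subseteq> {..<Suc ?k}"
      by (rule word_indices_gmatrix)
        (auto simp: env_def gtoken_defs Let_def ix_def pick_index_def bs_def)
    then show ?thesis by (simp add: G_def word_indices_gcheck)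
  qed
  then have dec: "polytime_decidable (Suc ?k) R"
    by (rule polytime_decidable_tr) (simp add: R_def)
  \<comment> \<open>Words of length 2 * \<open>length x\<close> suffice: the dimension n is unary in
    x, so an instance needs 2n bits with n at most \<open>length x\<close>.\<close>
  have "x \<in> Eval \<phi> \<longleftrightarrow> alternation True ?k (poly [:0, 2:] (length x)) (\<lambda>us. R (x # us))" for x
  proof (cases "\<exists>n T es. valid_input l n T es \<and> x = enc_input n T es")
    case True
    then obtain n T es where v: "valid_input l n T es" and x: "x = enc_input n T es" by blast
    let ?\<sigma> = "\<lambda>x. the (map_of (zip vl es) x)"
    let ?m = "2 * length x"
    have n: "2 * n \<le> ?m" by (simp add: x enc_input_def enc_nat_def)
    have "R (x # us) \<longleftrightarrow> matrix_holds T ([] @ map (\<lambda>u. inst u 0 n) (pick bs us) @ []) \<phi> ?\<sigma> (length ([] :: pinstance list))"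
      if us: "length us = ?k" for us
    proof -
      have hd: "(x # us) ! 0 = enc_input n T es" by (simp add: x)
      interpret ts: token_string "(x # us) ! 0" n "toks T" "concat (map enc_pinstance es)"
        using valid_input_token_string[OF v] hd by simp
      have "tr (x # us) (\<lambda>_. 0) (gmatrix ix \<phi> env 0) \<longleftrightarrow>
          matrix_holds T (map (\<lambda>u. inst u 0 n) (pick bs us)) \<phi> ?\<sigma> 0"
      proof (rule tr_gmatrix[OF v hd])
        fix y assume y: "y \<in> free_vars \<phi>"
        have "es ! idx y = ?\<sigma> y"
          using map_of_zip_nth[of vl es "idx y"] idx[OF y] vl v by (simp add: valid_input_def)
        then show "?\<sigma> y = inst ((x # us) ! fst (env y)) (val (x # us) (\<lambda>_. 0) (snd (env y))) n"
          using inst_valid_input[OF v idx(1)[OF y]] ts.dim by (simp add: env_def x)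
      next
        fix i assume "i < 0 + length (prefix_of \<phi>)"
        then show "map (\<lambda>u. inst u 0 n) (pick bs us) ! i = inst ((x # us) ! ix i) 0 n"
          using us by (simp add: bs_def[symmetric] nth_pick ix_def)
      qed
      then show ?thesis
        using valid_input_gcheck[OF v hd] by (simp add: R_def G_def)
    qed
    then have "alternation True ?k ?m (\<lambda>us. R (x # us)) \<longleftrightarrow>
        alternation True ?k ?m (\<lambda>us. matrix_holds T ([] @ map (\<lambda>u. inst u 0 n) (pick bs us) @ []) \<phi> ?\<sigma> (length ([] :: pinstance list)))"
      by (rule alternation_cong)
    also have "\<dots> \<longleftrightarrow> sat n T ?\<sigma> \<phi>"
      unfolding alternation_pick[where R = "\<lambda>us. matrix_holds T ([] @ map (\<lambda>u. inst u 0 n) us @ []) \<phi> ?\<sigma> (length ([] :: pinstance list))"]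
      by (subst sat_quantified[where us = "[]" and vs = "[]"], subst inst_surj[OF n, symmetric])
        (simp add: quantified_image bs_def)
    also have "\<dots> \<longleftrightarrow> models n T \<phi> es" by (simp add: models_def vl_def)
    also have "\<dots> \<longleftrightarrow> x \<in> Eval \<phi>"
    proof
      assume "models n T \<phi> es"
      then show "x \<in> Eval \<phi>" using v by (auto simp: Eval_def x valid_input_def l_def)
    next
      assume "x \<in> Eval \<phi>"
      then obtain n' T' es' where "x = enc_input n' T' es'" "length es' = l" "set es' \<subseteq> pinstances n'"
        "models n' T' \<phi> es'" by (auto simp: Eval_def l_def)
      with v x show "models n T \<phi> es"
        using enc_input_inject[of es es' n n' T T'] by (simp add: valid_input_def)
    qed
    finally show ?thesis by (simp add: mult.commute)
  next
    \<comment> \<open>The check rejects x together with any words, so the alternation is over a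
      constantly false predicate.\<close>
    case False
    have "\<not> R (x # us)" for us
      using gcheck_valid_input[of "x # us" "\<lambda>_. 0" l] False by (auto simp: R_def G_def)
    moreover have "x \<notin> Eval \<phi>"
      using False by (auto simp: Eval_def valid_input_def l_def)
    ultimately show ?thesis by (simp add: alternation_const)
  qed
  then show ?thesis
    using dec unfolding Sigma_P_def by blast
qed

section \<open>The hard formulas\<close>

text \<open>\<open>trace_formula t e y w\<close> says that e is the meet of t and y, for an e below t.\<close>

definition trace_formula :: "nat \<Rightarrow> nat \<Rightarrow> nat \<Rightarrow> nat \<Rightarrow> foil" where
  "trace_formula t e y w = And (Sub e y) (All w (Or (Neg (Sub w t)) (Or (Neg (Sub w y)) (Sub w e))))"

text \<open>Truth is written with variable 0, which is free in the hard formulas anyway.\<close>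

fun conj_list :: "foil list \<Rightarrow> foil" where
  "conj_list [] = Eq 0 0"
| "conj_list (\<phi> # \<phi>s) = And \<phi> (conj_list \<phi>s)"

text \<open>The free variables are 0, for the fixed features, and \<open>1, \<dots>, k + 1\<close>, for the blocks of
  features over which the quantifiers range; the quantified variables for the blocks are
  \<open>k + 2, \<dots>, 2k + 2\<close>.\<close>

definition hard_matrix :: "nat \<Rightarrow> foil" where
  "hard_matrix k = (let y = 2 * k + 4; w = 2 * k + 5 in
     All y (Or (Neg (And (Sub 0 y)
       (conj_list (map (\<lambda>j. trace_formula j (k + 1 + j) y w) [1..<k + 2])))) (Neg (Pos y))))"

text \<open>The quantifiers are relativised to the instances below block j. The last one, for the
  tableau, is existential whatever b is.\<close>

fun hard_prefix :: "nat \<Rightarrow> bool \<Rightarrow> nat \<Rightarrow> nat \<Rightarrow> foil" where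
  "hard_prefix k b 0 j = Ex (k + 1 + j) (And (Sub (k + 1 + j) j) (hard_matrix k))"
| "hard_prefix k True (Suc r) j =
     Ex (k + 1 + j) (And (Sub (k + 1 + j) j) (hard_prefix k False r (Suc j)))"
| "hard_prefix k False (Suc r) j =
     All (k + 1 + j) (Or (Neg (Sub (k + 1 + j) j)) (hard_prefix k True r (Suc j)))"

definition hard_formula :: "nat \<Rightarrow> foil" where
  "hard_formula k = hard_prefix k True k 1"

lemma free_vars_conj_list: "free_vars (conj_list \<phi>s) = \<Union> (free_vars ` set \<phi>s) \<union> {0}"
  by (induction \<phi>s) auto

lemma free_vars_hard_matrix: "free_vars (hard_matrix k) = {..<2 * k + 3}"
proof -
  let ?U = "\<Union>j\<in>{1..<k + 2}. free_vars (trace_formula j (k + 1 + j) (2 * k + 4) (2 * k + 5))"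
  have "?U - {2 * k + 4} = {1..<k + 2} \<union> (\<lambda>j. k + 1 + j) ` {1..<k + 2}"
    by (auto simp: trace_formula_def)
  also have "(\<lambda>j. k + 1 + j) ` {1..<k + 2} = {k + 2..<2 * k + 3}"
    by (simp only: image_add_atLeastLessThan) (rule arg_cong2[where f = atLeastLessThan], simp_all)
  also have "{1..<k + 2} \<union> {k + 2..<2 * k + 3} = {1..<2 * k + 3}"
    by (rule ivl_disj_un_two(3)) simp_all
  finally have U: "?U - {2 * k + 4} = {1..<2 * k + 3}" .
  have "free_vars (hard_matrix k) = {0} \<union> (?U - {2 * k + 4})"
    unfolding hard_matrix_def Let_def by (auto simp: free_vars_conj_list simp del: upt_Suc)
  also have "\<dots> = {..<2 * k + 3}"
    unfolding U by (rule set_eqI) (simp, arith)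
  finally show ?thesis .
qed

lemma free_vars_hard_prefix:
  "r + j = k + 1 \<Longrightarrow> free_vars (hard_prefix k b r j) = {..<k + 1 + j}"
proof (induction r arbitrary: b j)
  case 0
  then show ?case by (auto simp: free_vars_hard_matrix)
next
  case (Suc r)
  have "free_vars (hard_prefix k b' r (Suc j)) = {..<k + 1 + Suc j}" for b'
    using Suc by simp
  then show ?case using Suc.prems by (cases b) auto
qed

lemma free_vars_hard_formula: "free_vars (hard_formula k) = {..<k + 2}"
  unfolding hard_formula_def by (subst free_vars_hard_prefix) auto

section \<open>Sets of features as partial instances\<close>

definition mark :: "nat \<Rightarrow> (nat \<Rightarrow> bool) \<Rightarrow> pinstance" where
  "mark N P = map (\<lambda>f. if P f then Some True else None) [0..<N]"

lemma length_mark [simp]: "length (mark N P) = N"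
  by (simp add: mark_def)

lemma mark_in_pinstances [simp]: "mark N P \<in> pinstances N"
  by (simp add: pinstances_def)

lemma nth_mark [simp]: "f < N \<Longrightarrow> mark N P ! f = (if P f then Some True else None)"
  by (simp add: mark_def)

lemma subsumed_mark_left:
  "length y = N \<Longrightarrow> subsumed (mark N P) y \<longleftrightarrow> (\<forall>f<N. P f \<longrightarrow> y ! f = Some True)"
  by (auto simp: subsumed_def)

text \<open>Below a mark the only freedom is which of its features stay defined, so these instances
  are the subsets of P.\<close>

lemma subsumed_mark_right:
  assumes "length e = N"
  shows "subsumed e (mark N P) \<longleftrightarrow> (\<exists>A. e = mark N (\<lambda>f. P f \<and> A f))"
proof
  assume s: "subsumed e (mark N P)"
  have "e = mark N (\<lambda>f. P f \<and> e ! f = Some True)"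
  proof (rule nth_equalityI)
    fix f assume "f < length e"
    then have "f < N" "e ! f \<noteq> None \<Longrightarrow> e ! f = mark N P ! f"
      using s assms by (auto simp: subsumed_def)
    then show "e ! f = mark N (\<lambda>f. P f \<and> e ! f = Some True) ! f"
      by (cases "e ! f") (auto split: if_splits)
  qed (simp add: assms)
  then show "\<exists>A. e = mark N (\<lambda>f. P f \<and> A f)"
    by (rule exI[of _ "\<lambda>f. e ! f = Some True"])
next
  assume "\<exists>A. e = mark N (\<lambda>f. P f \<and> A f)"
  then show "subsumed e (mark N P)" by (auto simp: subsumed_def split: if_splits)
qed

text \<open>\<open>Sub e y\<close> makes y have the value 1 on A. The quantifier over w, applied to
  the mark of a single feature of P, forbids further 1s in P. For a y without undefined features,
  which is all that \<open>Pos\<close> admits, not being 1 means being 0.\<close>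

lemma sat_trace_formula:
  assumes "distinct [t, e, y, w]" "\<sigma> t = mark N P" "\<sigma> e = mark N A" "\<And>f. A f \<Longrightarrow> P f"
    "length (\<sigma> y) = N"
  shows "sat N T \<sigma> (trace_formula t e y w) \<longleftrightarrow>
    (\<forall>f<N. P f \<longrightarrow> (\<sigma> y ! f = Some True \<longleftrightarrow> A f))"
proof -
  have sat: "sat N T \<sigma> (trace_formula t e y w) \<longleftrightarrow> subsumed (mark N A) (\<sigma> y) \<and>
     (\<forall>d\<in>pinstances N. subsumed d (mark N P) \<longrightarrow> subsumed d (\<sigma> y) \<longrightarrow> subsumed d (mark N A))"
    using assms(1-3) by (auto simp: trace_formula_def)
  show ?thesis
    unfolding sat
  proof (rule iffI)
    assume s: "subsumed (mark N A) (\<sigma> y) \<and>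
     (\<forall>d\<in>pinstances N. subsumed d (mark N P) \<longrightarrow> subsumed d (\<sigma> y) \<longrightarrow> subsumed d (mark N A))"
    show "\<forall>f<N. P f \<longrightarrow> (\<sigma> y ! f = Some True \<longleftrightarrow> A f)"
    proof (intro allI impI)
      fix f assume f: "f < N" "P f"
      show "\<sigma> y ! f = Some True \<longleftrightarrow> A f"
      proof
        assume "\<sigma> y ! f = Some True"
        then have "subsumed (mark N (\<lambda>g. g = f)) (mark N P)" "subsumed (mark N (\<lambda>g. g = f)) (\<sigma> y)"
          using f assms(5) by (auto simp: subsumed_mark_left)
        then have "subsumed (mark N (\<lambda>g. g = f)) (mark N A)" using s by simp
        then show "A f" using f by (auto simp: subsumed_mark_left split: if_splits)
      next
        assume "A f"
        then show "\<sigma> y ! f = Some True" using s f assms(5) by (auto simp: subsumed_mark_left)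
      qed
    qed
  next
    assume y: "\<forall>f<N. P f \<longrightarrow> (\<sigma> y ! f = Some True \<longleftrightarrow> A f)"
    have "subsumed d (mark N A)"
      if d: "d \<in> pinstances N" "subsumed d (mark N P)" "subsumed d (\<sigma> y)" for d
    proof -
      obtain A' where A': "d = mark N (\<lambda>f. P f \<and> A' f)"
        using d subsumed_mark_right[of d N P] by (auto simp: pinstances_def)
      then show ?thesis
        using y d(3) assms(5) by (auto simp: subsumed_mark_left)
    qed
    moreover have "subsumed (mark N A) (\<sigma> y)"
      using y assms(4,5) by (simp add: subsumed_mark_left)
    ultimately show "subsumed (mark N A) (\<sigma> y) \<and>
     (\<forall>d\<in>pinstances N. subsumed d (mark N P) \<longrightarrow> subsumed d (\<sigma> y) \<longrightarrow> subsumed d (mark N A))"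
      by blast
  qed
qed

lemma sat_conj_list: "sat n T \<sigma> (conj_list \<phi>s) \<longleftrightarrow> (\<forall>\<phi>\<in>set \<phi>s. sat n T \<sigma> \<phi>)"
  by (induction \<phi>s) auto

text \<open>Block j consists of the features \<open>pos j h\<close> for \<open>h < m\<close>, which carry the j-th quantified
  word; the last block is \<open>Z\<close>.\<close>

locale hard_input =
  fixes k N m :: nat and T :: dtree and e0 :: pinstance and pos :: "nat \<Rightarrow> nat \<Rightarrow> nat"
    and Z :: "nat \<Rightarrow> bool"
  assumes length_e0: "length e0 = N"
    and pos_inj: "\<And>j h h'. pos j h = pos j h' \<Longrightarrow> h = h'"
begin

definition block :: "nat \<Rightarrow> nat \<Rightarrow> bool" where
  "block j f \<longleftrightarrow> (if j \<le> k then \<exists>h<m. f = pos j h else Z f)"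

definition word_block :: "nat \<Rightarrow> bool list \<Rightarrow> nat \<Rightarrow> bool" where
  "word_block j u f \<longleftrightarrow> (\<exists>h<m. f = pos j h \<and> u ! h)"

definition matrix_sem :: "bool list list \<Rightarrow> (nat \<Rightarrow> bool) \<Rightarrow> bool" where
  "matrix_sem us A \<longleftrightarrow> (\<forall>y\<in>pinstances N. subsumed e0 y \<longrightarrow>
     (\<forall>j\<in>{1..k}. \<forall>h<m. pos j h < N \<longrightarrow> (y ! pos j h = Some True \<longleftrightarrow> us ! (j - 1) ! h)) \<longrightarrow>
     (\<forall>f<N. Z f \<longrightarrow> (y ! f = Some True \<longleftrightarrow> A f)) \<longrightarrow> \<not> positive T y)"

text \<open>An instance below block j chooses a set of features \<open>pos j h\<close>, that is, the
  1s of a word of length m. So a quantifier relativised to the block is a quantifier over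
  words.\<close>

lemma subsumed_block:
  assumes "length e = N" "j \<le> k"
  shows "subsumed e (mark N (block j)) \<longleftrightarrow> (\<exists>u. length u = m \<and> e = mark N (word_block j u))"
proof
  assume "subsumed e (mark N (block j))"
  then obtain A where A: "e = mark N (\<lambda>f. block j f \<and> A f)"
    using subsumed_mark_right assms(1) by blast
  have "(\<lambda>f. block j f \<and> A f) = word_block j (map (\<lambda>h. A (pos j h)) [0..<m])"
    using assms(2) by (auto simp: fun_eq_iff block_def word_block_def)
  with A show "\<exists>u. length u = m \<and> e = mark N (word_block j u)"
    by (intro exI[of _ "map (\<lambda>h. A (pos j h)) [0..<m]"]) simp
next
  assume "\<exists>u. length u = m \<and> e = mark N (word_block j u)"
  then obtain u where u: "e = mark N (word_block j u)" by blast
  have "block j f" if "word_block j u f" for f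
    using that assms(2) unfolding block_def word_block_def by auto
  then show "subsumed e (mark N (block j))"
    unfolding u by (simp add: subsumed_mark_left)
qed

lemma sat_hard_matrix:
  assumes "\<sigma> 0 = e0" "\<And>j. 1 \<le> j \<Longrightarrow> j \<le> k + 1 \<Longrightarrow> \<sigma> j = mark N (block j)"
    "\<And>j. 1 \<le> j \<Longrightarrow> j \<le> k \<Longrightarrow> \<sigma> (k + 1 + j) = mark N (word_block j (us ! (j - 1)))"
    "\<sigma> (2 * k + 2) = mark N (\<lambda>f. Z f \<and> A f)"
  shows "sat N T \<sigma> (hard_matrix k) \<longleftrightarrow> matrix_sem us A"
proof -
  let ?y = "2 * k + 4" and ?w = "2 * k + 5"
  have trace: "sat N T (\<sigma>(?y := y)) (trace_formula j (k + 1 + j) ?y ?w) \<longleftrightarrow>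
      (\<forall>h<m. pos j h < N \<longrightarrow> (y ! pos j h = Some True \<longleftrightarrow> us ! (j - 1) ! h))"
    if "1 \<le> j" "j \<le> k" "length y = N" for j y
  proof -
    have "sat N T (\<sigma>(?y := y)) (trace_formula j (k + 1 + j) ?y ?w) \<longleftrightarrow>
      (\<forall>f<N. block j f \<longrightarrow> ((\<sigma>(?y := y)) ?y ! f = Some True \<longleftrightarrow> word_block j (us ! (j - 1)) f))"
    proof (rule sat_trace_formula)
      show "block j f" if "word_block j (us ! (j - 1)) f" for f
        using that \<open>j \<le> k\<close> unfolding block_def word_block_def by auto
    qed (use that assms(2,3)[of j] in simp_all)
    also have "\<dots> \<longleftrightarrow> (\<forall>h<m. pos j h < N \<longrightarrow> (y ! pos j h = Some True \<longleftrightarrow> us ! (j - 1) ! h))"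
      using that(2) by (auto simp: block_def word_block_def dest: pos_inj)
    finally show ?thesis .
  qed
  have traceZ: "sat N T (\<sigma>(?y := y)) (trace_formula (k + 1) (k + 1 + (k + 1)) ?y ?w) \<longleftrightarrow>
      (\<forall>f<N. Z f \<longrightarrow> (y ! f = Some True \<longleftrightarrow> A f))" if "length y = N" for y
  proof -
    have block: "block (k + 1) = Z" by (simp add: block_def fun_eq_iff)
    have "sat N T (\<sigma>(?y := y)) (trace_formula (k + 1) (k + 1 + (k + 1)) ?y ?w) \<longleftrightarrow>
      (\<forall>f<N. Z f \<longrightarrow> ((\<sigma>(?y := y)) ?y ! f = Some True \<longleftrightarrow> Z f \<and> A f))"
    proof (rule sat_trace_formula)
      have "\<sigma> (k + 1) = mark N Z" using assms(2)[of "k + 1"] unfolding block by simp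
      then show "(\<sigma>(?y := y)) (k + 1) = mark N Z" by simp
      have idx: "k + 1 + (k + 1) = 2 * k + 2" by simp
      show "(\<sigma>(?y := y)) (k + 1 + (k + 1)) = mark N (\<lambda>f. Z f \<and> A f)"
        unfolding idx using assms(4) by simp
    qed (use that in auto)
    then show ?thesis unfolding fun_upd_same by blast
  qed
  have "{1..<k + 2} = insert (k + 1) {1..k}" by auto
  then have conj: "sat N T s (conj_list (map \<phi> [1..<k + 2])) \<longleftrightarrow>
      sat N T s (\<phi> (k + 1)) \<and> (\<forall>j\<in>{1..k}. sat N T s (\<phi> j))" for s \<phi>
    by (simp only: sat_conj_list set_map set_upt ball_simps)
  have zero: "(\<sigma>(?y := y)) 0 = e0" for y
    using assms(1) by simp
  have "sat N T \<sigma> (hard_matrix k) \<longleftrightarrow> (\<forall>y\<in>pinstances N. \<not> (subsumed e0 y \<and>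
      sat N T (\<sigma>(?y := y)) (trace_formula (k + 1) (k + 1 + (k + 1)) ?y ?w) \<and>
      (\<forall>j\<in>{1..k}. sat N T (\<sigma>(?y := y)) (trace_formula j (k + 1 + j) ?y ?w))) \<or> \<not> positive T y)"
    unfolding hard_matrix_def Let_def sat.simps conj zero fun_upd_same ..
  also have "\<dots> \<longleftrightarrow> matrix_sem us A"
    unfolding matrix_sem_def
  proof (rule ball_cong[OF refl])
    fix y assume "y \<in> pinstances N"
    then have y: "length y = N" by (simp add: pinstances_def)
    have "(\<forall>j\<in>{1..k}. sat N T (\<sigma>(?y := y)) (trace_formula j (k + 1 + j) ?y ?w)) \<longleftrightarrow>
       (\<forall>j\<in>{1..k}. \<forall>h<m. pos j h < N \<longrightarrow> (y ! pos j h = Some True \<longleftrightarrow> us ! (j - 1) ! h))"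
      by (rule ball_cong[OF refl]) (rule trace, use y in auto)
    then show "\<not> (subsumed e0 y \<and>
      sat N T (\<sigma>(?y := y)) (trace_formula (k + 1) (k + 1 + (k + 1)) ?y ?w) \<and>
      (\<forall>j\<in>{1..k}. sat N T (\<sigma>(?y := y)) (trace_formula j (k + 1 + j) ?y ?w))) \<or> \<not> positive T y \<longleftrightarrow>
      (subsumed e0 y \<longrightarrow>
     (\<forall>j\<in>{1..k}. \<forall>h<m. pos j h < N \<longrightarrow> (y ! pos j h = Some True \<longleftrightarrow> us ! (j - 1) ! h)) \<longrightarrow>
     (\<forall>f<N. Z f \<longrightarrow> (y ! f = Some True \<longleftrightarrow> A f)) \<longrightarrow> \<not> positive T y)"
      unfolding traceZ[OF y] by blast
  qed
  finally show ?thesis .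
qed

text \<open>The words \<open>us\<close> chosen so far are the values of the variables k + 2, ..., k
  + j. At r = 0 only the tableau block is left, and its instance becomes the set A.\<close>

lemma sat_hard_prefix:
  assumes "r + j = k + 1" "length us = j - 1" "1 \<le> j"
    "\<sigma> 0 = e0" "\<And>i. 1 \<le> i \<Longrightarrow> i \<le> k + 1 \<Longrightarrow> \<sigma> i = mark N (block i)"
    "\<And>i. 1 \<le> i \<Longrightarrow> i < j \<Longrightarrow> \<sigma> (k + 1 + i) = mark N (word_block i (us ! (i - 1)))"
  shows "sat N T \<sigma> (hard_prefix k b r j) \<longleftrightarrow> alternation b r m (\<lambda>us'. \<exists>A. matrix_sem (us @ us') A)"
  using assms
proof (induction r arbitrary: b j us \<sigma>)
  case 0
  then have j: "j = k + 1" by simp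
  have "sat N T \<sigma> (hard_prefix k b 0 j) \<longleftrightarrow> (\<exists>e\<in>pinstances N. subsumed e (mark N Z) \<and>
      sat N T (\<sigma>(2 * k + 2 := e)) (hard_matrix k))"
    using 0(5)[of "k + 1"] j by (simp add: block_def mult_2)
  also have "\<dots> \<longleftrightarrow> (\<exists>A. sat N T (\<sigma>(2 * k + 2 := mark N (\<lambda>f. Z f \<and> A f))) (hard_matrix k))"
  proof -
    have "subsumed e (mark N Z) \<longleftrightarrow> (\<exists>A. e = mark N (\<lambda>f. Z f \<and> A f))" if "e \<in> pinstances N" for e
      using that subsumed_mark_right by (simp add: pinstances_def)
    then show ?thesis by (metis mark_in_pinstances)
  qed
  also have "\<dots> \<longleftrightarrow> (\<exists>A. matrix_sem us A)"
  proof -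
    have "sat N T (\<sigma>(2 * k + 2 := mark N (\<lambda>f. Z f \<and> A f))) (hard_matrix k) = matrix_sem us A" for A
      using 0 j by (intro sat_hard_matrix) auto
    then show ?thesis by simp
  qed
  finally show ?case by simp
next
  case (Suc r)
  let ?v = "k + 1 + j"
  have j: "j \<le> k" using Suc.prems by simp
  have IH: "sat N T (\<sigma>(?v := mark N (word_block j u))) (hard_prefix k b' r (Suc j)) \<longleftrightarrow>
      alternation b' r m (\<lambda>us'. \<exists>A. matrix_sem ((us @ [u]) @ us') A)" for b' u
  proof (rule Suc.IH)
    fix i assume i: "1 \<le> i" "i < Suc j"
    show "(\<sigma>(?v := mark N (word_block j u))) (k + 1 + i) = mark N (word_block i ((us @ [u]) ! (i - 1)))"
      using i Suc.prems(2) Suc.prems(6)[of i] by (cases "i = j") (auto simp: nth_append)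
  next
    fix i assume "1 \<le> i" "i \<le> k + 1"
    then show "(\<sigma>(?v := mark N (word_block j u))) i = mark N (block i)"
      using Suc.prems(3,5) by simp
  qed (use Suc.prems in auto)
  have tj: "(\<sigma>(?v := e)) j = mark N (block j)" for e
    using Suc.prems(3,5) j by simp
  have sub: "subsumed e (mark N (block j)) \<longleftrightarrow> (\<exists>u. length u = m \<and> e = mark N (word_block j u))"
    if "e \<in> pinstances N" for e
    using that subsumed_block j by (simp add: pinstances_def)
  show ?case
  proof (cases b)
    case True
    have "sat N T \<sigma> (hard_prefix k True (Suc r) j) \<longleftrightarrow> (\<exists>e\<in>pinstances N. subsumed e (mark N (block j)) \<and>
        sat N T (\<sigma>(?v := e)) (hard_prefix k False r (Suc j)))"
      using tj by simp
    also have "\<dots> \<longleftrightarrow> (\<exists>u. length u = m \<and>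
        sat N T (\<sigma>(?v := mark N (word_block j u))) (hard_prefix k False r (Suc j)))"
      using sub by (metis mark_in_pinstances)
    finally show ?thesis unfolding IH using True by simp
  next
    case False
    have "sat N T \<sigma> (hard_prefix k False (Suc r) j) \<longleftrightarrow> (\<forall>e\<in>pinstances N. subsumed e (mark N (block j)) \<longrightarrow>
        sat N T (\<sigma>(?v := e)) (hard_prefix k True r (Suc j)))"
      unfolding hard_prefix.simps sat.simps fun_upd_same tj imp_conv_disj ..
    also have "\<dots> \<longleftrightarrow> (\<forall>u. length u = m \<longrightarrow>
        sat N T (\<sigma>(?v := mark N (word_block j u))) (hard_prefix k True r (Suc j)))"
      using sub by (metis mark_in_pinstances)
    finally show ?thesis unfolding IH using False by simp
  qed
qed

lemma models_hard_formula:
  "models N T (hard_formula k) (e0 # map (\<lambda>j. mark N (block j)) [1..<k + 2]) \<longleftrightarrow>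
     alternation True k m (\<lambda>us. \<exists>A. matrix_sem us A)"
proof -
  let ?es = "e0 # map (\<lambda>j. mark N (block j)) [1..<k + 2]"
  have vl: "var_list (hard_formula k) = [0..<k + 2]"
    by (simp only: var_list_def free_vars_hard_formula lessThan_atLeast0 sorted_list_of_set_range)
  have len: "length ?es = k + 2" by simp
  have env: "the (map_of (zip [0..<k + 2] ?es) i) = ?es ! i" if "i < k + 2" for i
    using map_of_zip_nth[of "[0..<k + 2]" ?es i] that len by (simp del: upt_Suc)
  have "sat N T (\<lambda>x. the (map_of (zip [0..<k + 2] ?es) x)) (hard_prefix k True k 1) \<longleftrightarrow>
      alternation True k m (\<lambda>us. \<exists>A. matrix_sem ([] @ us) A)"
  proof (rule sat_hard_prefix)
    show "the (map_of (zip [0..<k + 2] ?es) 0) = e0"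
      using env[of 0] by simp
    show "the (map_of (zip [0..<k + 2] ?es) i) = mark N (block i)" if "1 \<le> i" "i \<le> k + 1" for i
      using env[of i] that by (simp del: upt_Suc add: nth_Cons')
  qed auto
  then show ?thesis
    unfolding models_def vl unfolding hard_formula_def by simp
qed

end

section \<open>Tableaux of machine runs\<close>

text \<open>A halted machine makes an explicit idle move, so that the rows after halting obey the
  same rule and the tableau can have fixed height.\<close>

definition successor :: "tm \<Rightarrow> nat \<Rightarrow> nat list \<Rightarrow> nat \<times> (nat \<times> move) list" where
  "successor M q ss = (if q = halt_state M then (q, map (\<lambda>s. (s, Stay)) ss) else delta M q ss)"

section \<open>Configurations of a run as functions of time\<close>

locale machine_run =
  fixes M :: tm and ws :: "bool list list"
  assumes wf: "wf_tm M"
begin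

definition cfg :: "nat \<Rightarrow> config" where "cfg t = (step M ^^ t) (init_config M ws)"
definition state :: "nat \<Rightarrow> nat" where "state t = fst (cfg t)"
definition content :: "nat \<Rightarrow> nat \<Rightarrow> int \<Rightarrow> nat" where "content t j i = fst (snd (cfg t) ! j) i"
definition head :: "nat \<Rightarrow> nat \<Rightarrow> int" where "head t j = snd (snd (cfg t) ! j)"
definition scanned :: "nat \<Rightarrow> nat list" where
  "scanned t = map (\<lambda>j. content t j (head t j)) [0..<num_tapes M]"
definition next_state :: "nat \<Rightarrow> nat" where "next_state t = fst (successor M (state t) (scanned t))"
definition actions :: "nat \<Rightarrow> (nat \<times> move) list" where
  "actions t = snd (successor M (state t) (scanned t))"

lemma cfg_Suc: "cfg (Suc t) = step M (cfg t)"
  by (simp add: cfg_def)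

text \<open>One induction gives all of these: \<open>wf_tm\<close> constrains \<open>delta\<close>
  only on proper states and symbol lists, so the bounds are needed to control the next step, and
  that step to carry them on.\<close>

lemma length_tapes: "length (snd (cfg t)) = num_tapes M"
  and state_less: "state t < num_states M"
  and content_less: "j < num_tapes M \<Longrightarrow> content t j i < num_symbols M"
  and length_actions: "length (actions t) = num_tapes M"
  and content_Suc: "j < num_tapes M \<Longrightarrow>
     content (Suc t) j i = (if i = head t j then fst (actions t ! j) else content t j i)"
  and head_Suc: "j < num_tapes M \<Longrightarrow> head (Suc t) j = move_head (snd (actions t ! j)) (head t j)"
  and state_Suc: "state (Suc t) = next_state t"
proof -
  have 0: "length (snd (cfg 0)) = num_tapes M \<and> state 0 < num_states M \<and>
      (\<forall>j<num_tapes M. \<forall>i. content 0 j i < num_symbols M)"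
    using wf by (auto simp: cfg_def init_config_def state_def content_def wf_tm_def tape_of_def bit_symbol_def)
  have Suc: "length (snd (cfg (Suc t))) = num_tapes M \<and> state (Suc t) < num_states M \<and>
      (\<forall>j<num_tapes M. \<forall>i. content (Suc t) j i < num_symbols M) \<and>
      length (actions t) = num_tapes M \<and> state (Suc t) = next_state t \<and>
      (\<forall>j<num_tapes M. (\<forall>i. content (Suc t) j i =
         (if i = head t j then fst (actions t ! j) else content t j i)) \<and>
       head (Suc t) j = move_head (snd (actions t ! j)) (head t j))"
    if IH: "length (snd (cfg t)) = num_tapes M \<and> state t < num_states M \<and>
      (\<forall>j<num_tapes M. \<forall>i. content t j i < num_symbols M)" for t
  proof -
    obtain q tps where c: "cfg t = (q, tps)" by (cases "cfg t")
    have sc: "map (\<lambda>(t, h). t h) tps = scanned t"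
      using IH c by (intro nth_equalityI) (auto simp: scanned_def content_def head_def split_beta)
    have len: "length tps = num_tapes M" "q < num_states M"
      using IH c by (auto simp: state_def)
    have scan: "length (scanned t) = num_tapes M" "set (scanned t) \<subseteq> {..<num_symbols M}"
      using IH by (auto simp: scanned_def)
    have next_ok: "next_state t < num_states M \<and> length (actions t) = num_tapes M \<and>
        (\<forall>j<num_tapes M. fst (actions t ! j) < num_symbols M)"
    proof (cases "q = halt_state M")
      case True
      then show ?thesis
        using c IH len by (auto simp: next_state_def actions_def successor_def state_def scanned_def)
    next
      case False
      then have s: "successor M (state t) (scanned t) = delta M q (scanned t)"
        by (simp add: successor_def state_def c)
      have "fst (delta M q (scanned t)) < num_states M \<and>
          length (snd (delta M q (scanned t))) = num_tapes M \<and>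
          fst ` set (snd (delta M q (scanned t))) \<subseteq> {..<num_symbols M}"
        using wf len(2) scan unfolding wf_tm_def by blast
      then show ?thesis
        unfolding next_state_def actions_def s image_subset_iff by (metis lessThan_iff nth_mem)
    qed
    have act: "act (actions t ! j) (tps ! j) =
        ((fst (tps ! j))(head t j := fst (actions t ! j)), move_head (snd (actions t ! j)) (head t j))" for j
      by (cases "actions t ! j"; cases "tps ! j") (simp add: head_def c)
    have cS: "cfg (Suc t) = (next_state t, map2 act (actions t) tps)"
    proof (cases "q = halt_state M")
      case True
      have "map2 act (actions t) tps = tps"
      proof (rule nth_equalityI)
        fix j assume "j < length (map2 act (actions t) tps)"
        then have j: "j < num_tapes M" using len by simp
        then have "actions t ! j = (fst (tps ! j) (head t j), Stay)"
          using True c by (simp add: actions_def successor_def state_def scanned_def content_def)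
        then show "map2 act (actions t) tps ! j = tps ! j"
          using act[of j] j len next_ok by (simp add: head_def c)
      qed (use len next_ok in simp)
      then show ?thesis
        using True c by (simp add: cfg_Suc step_def next_state_def successor_def state_def)
    next
      case False
      then show ?thesis
        by (simp add: cfg_Suc c step_def sc next_state_def actions_def successor_def state_def split_beta)
    qed
    have nth: "snd (cfg (Suc t)) ! j = act (actions t ! j) (tps ! j)" if "j < num_tapes M" for j
      using that len next_ok by (simp add: cS)
    have content: "content (Suc t) j i = (if i = head t j then fst (actions t ! j) else content t j i)"
      if "j < num_tapes M" for j i
      using nth[OF that] act[of j] by (simp add: content_def c)
    moreover have "head (Suc t) j = move_head (snd (actions t ! j)) (head t j)" if "j < num_tapes M" for j
      using nth[OF that] act[of j] by (simp add: head_def)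
    moreover have "content (Suc t) j i < num_symbols M" if "j < num_tapes M" for j i
      using content[OF that] next_ok IH that by simp
    moreover have "length (snd (cfg (Suc t))) = num_tapes M" "state (Suc t) = next_state t"
      using cS len next_ok by (auto simp: state_def)
    ultimately show ?thesis using next_ok by simp
  qed
  have all: "length (snd (cfg t)) = num_tapes M \<and> state t < num_states M \<and>
      (\<forall>j<num_tapes M. \<forall>i. content t j i < num_symbols M)" for t
    by (induction t) (use 0 Suc in blast)+
  show "length (snd (cfg t)) = num_tapes M" "state t < num_states M"
    "j < num_tapes M \<Longrightarrow> content t j i < num_symbols M"
    using all by blast+
  show "length (actions t) = num_tapes M"
    "j < num_tapes M \<Longrightarrow> content (Suc t) j i = (if i = head t j then fst (actions t ! j) else content t j i)"
    "j < num_tapes M \<Longrightarrow> head (Suc t) j = move_head (snd (actions t ! j)) (head t j)"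
    "state (Suc t) = next_state t"
    using Suc[OF all] by blast+
qed

lemma state_0: "state 0 = start_state M"
  by (simp add: state_def cfg_def init_config_def)

lemma content_0: "j < num_tapes M \<Longrightarrow> content 0 j i =
    (if j < length ws \<and> 0 \<le> i \<and> i < int (length (ws ! j)) then bit_symbol (ws ! j ! nat i) else 0)"
  by (auto simp: content_def cfg_def init_config_def tape_of_def)

lemma head_0: "j < num_tapes M \<Longrightarrow> head 0 j = 0"
  by (simp add: head_def cfg_def init_config_def tape_of_def)

lemma head_le: "j < num_tapes M \<Longrightarrow> \<bar>head t j\<bar> \<le> int t"
proof (induction t)
  case (Suc t)
  then show ?case by (cases "snd (actions t ! j)") (auto simp: head_Suc)
qed (simp add: head_0)

end

text \<open>A cell is a map from slots to bits. For each tape it has a number below \<open>B\<close>, as the count of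
  true bits among \<open>B\<close> slots, and a flag. Column 0 of row t of the tableau has the scanned symbols
  and, as entry K, the state at time t; column c has the symbols and head flags at tape position
  \<open>c - orig\<close>.\<close>

locale tableau_shape =
  fixes M :: tm and T :: nat
begin

definition K :: nat where "K = num_tapes M"
definition B :: nat where "B = max (num_symbols M) (num_states M)"
definition D :: nat where "D = (K + 1) * (B + 1)"
text \<open>The distance to the border is T for the head, which moves at most one cell per step,
  plus T for errors that creep in from the border, plus a margin of 2.\<close>

definition orig :: nat where "orig = 2 * T + 2"
definition width :: nat where "width = 4 * T + 4"

text \<open>By counting, every bit pattern denotes some number, so no constraint has to exclude
  invalid codes.\<close>

definition num :: "(nat \<Rightarrow> bool) \<Rightarrow> nat \<Rightarrow> nat" where
  "num g j = card {b. b < B \<and> g (j * (B + 1) + b)}"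
definition flag :: "(nat \<Rightarrow> bool) \<Rightarrow> nat \<Rightarrow> bool" where
  "flag g j = g (j * (B + 1) + B)"

text \<open>\<open>r\<close> and \<open>r'\<close> are the columns 0 of two successive rows,
  \<open>cl\<close>, \<open>cm\<close>, \<open>cr\<close> three neighbouring cells and
  \<open>cm'\<close> the cell below the middle one. The move is computed from the symbols claimed in
  \<open>r\<close>; the window around the head of tape j is the one that checks the claim for
  j.\<close>

definition window_ok :: "(nat \<Rightarrow> bool) \<Rightarrow> (nat \<Rightarrow> bool) \<Rightarrow> (nat \<Rightarrow> bool) \<Rightarrow> (nat \<Rightarrow> bool) \<Rightarrow>
    (nat \<Rightarrow> bool) \<Rightarrow> (nat \<Rightarrow> bool) \<Rightarrow> bool" where
  "window_ok r r' cl cm cr cm' \<longleftrightarrow>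
     (let s = successor M (num r K) (map (num r) [0..<K]); as = snd s in
       num r' K = fst s \<and>
       (\<forall>j<K. (flag cm j \<longrightarrow> num cm j = num r j) \<and>
         num cm' j = (if flag cm j then fst (as ! j) else num cm j) \<and>
         (flag cm' j \<longleftrightarrow> flag cl j \<and> snd (as ! j) = Move_Right \<or> flag cm j \<and> snd (as ! j) = Stay \<or>
            flag cr j \<and> snd (as ! j) = Move_Left)))"

definition windows_ok :: "(nat \<Rightarrow> nat \<Rightarrow> nat \<Rightarrow> bool) \<Rightarrow> bool" where
  "windows_ok G \<longleftrightarrow> (\<forall>t<T. \<forall>c<width - 2. window_ok (G t 0) (G (Suc t) 0)
     (G t (c + 1)) (G t (c + 2)) (G t (c + 3)) (G (Suc t) (c + 2)))"

definition position :: "nat \<Rightarrow> int" where "position c = int c - int orig"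

end

locale tableau = machine_run M ws + tableau_shape M T for M ws T
begin

definition cell_correct :: "(nat \<Rightarrow> nat \<Rightarrow> nat \<Rightarrow> bool) \<Rightarrow> nat \<Rightarrow> nat \<Rightarrow> bool" where
  "cell_correct G t c \<longleftrightarrow> (\<forall>j<K. num (G t c) j = content t j (position c) \<and>
     (flag (G t c) j \<longleftrightarrow> head t j = position c))"

definition state_correct :: "(nat \<Rightarrow> nat \<Rightarrow> nat \<Rightarrow> bool) \<Rightarrow> nat \<Rightarrow> bool" where
  "state_correct G t \<longleftrightarrow> num (G t 0) K = state t"

definition scanned_correct :: "(nat \<Rightarrow> nat \<Rightarrow> nat \<Rightarrow> bool) \<Rightarrow> nat \<Rightarrow> bool" where
  "scanned_correct G t \<longleftrightarrow> (\<forall>j<K. num (G t 0) j = content t j (head t j))"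

lemma successor_correct:
  "state_correct G t \<Longrightarrow> scanned_correct G t \<Longrightarrow>
     successor M (num (G t 0) K) (map (num (G t 0)) [0..<K]) = (next_state t, actions t)"
proof -
  assume *: "state_correct G t" "scanned_correct G t"
  then have "map (num (G t 0)) [0..<K] = scanned t"
    by (auto simp: scanned_correct_def scanned_def K_def)
  with * show ?thesis
    by (simp add: state_correct_def next_state_def actions_def)
qed

text \<open>The windows say nothing about the leftmost and rightmost columns, so that errors may spread
  inwards by one column per step; they do not reach column \<open>orig\<close> in T steps.\<close>

lemma windows_sound:
  assumes "windows_ok G" "state_correct G 0"
    "\<And>c. 1 \<le> c \<Longrightarrow> c \<le> width \<Longrightarrow> cell_correct G 0 c" "t \<le> T"
  shows "state_correct G t \<and> (\<forall>c. 1 + t \<le> c \<and> c + t \<le> width \<longrightarrow> cell_correct G t c)"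
  using assms(4)
proof (induction t)
  case 0
  then show ?case using assms(2,3) by simp
next
  case (Suc t)
  then have t: "t < T" by simp
  have state: "state_correct G t"
    and cell: "\<And>c. 1 + t \<le> c \<Longrightarrow> c + t \<le> width \<Longrightarrow> cell_correct G t c"
    using Suc by auto
  have win: "window_ok (G t 0) (G (Suc t) 0) (G t (c - 1)) (G t c) (G t (c + 1)) (G (Suc t) c)"
    if c: "2 \<le> c" "c < width" for c
  proof -
    have "window_ok (G t 0) (G (Suc t) 0) (G t (c - 2 + 1)) (G t (c - 2 + 2)) (G t (c - 2 + 3))
        (G (Suc t) (c - 2 + 2))"
      using assms(1) t c unfolding windows_ok_def by (meson diff_less_mono)
    moreover have "c - 2 + 1 = c - 1" "c - 2 + 2 = c" "c - 2 + 3 = c + 1" using c by auto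
    ultimately show ?thesis by simp
  qed
  have "num (G t 0) j = content t j (head t j)" if j: "j < K" for j
  proof -
    \<comment> \<open>The column of the head on tape j. It is at a safe distance from the border, so
      its flag and symbol are correct and its window forces the claimed symbol to be the scanned
      one.\<close>
    define c where "c = nat (int orig + head t j)"
    have h: "\<bar>head t j\<bar> \<le> int t" using head_le j by (simp add: K_def)
    then have p: "position c = head t j" and c: "2 + t \<le> c" "c + t < width"
      using t by (auto simp: c_def position_def orig_def width_def)
    then have "cell_correct G t c" using cell[of c] by simp
    then have "num (G t c) j = content t j (head t j)" "flag (G t c) j"
      using j p by (auto simp: cell_correct_def)
    moreover have "flag (G t c) j \<longrightarrow> num (G t c) j = num (G t 0) j"
      using win[of c] c j by (auto simp: window_ok_def Let_def)
    ultimately show ?thesis by simp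
  qed
  then have sc: "scanned_correct G t" by (simp add: scanned_correct_def)
  note succ = successor_correct[OF state sc]
  have "num (G (Suc t) 0) K = next_state t"
    using win[of 2] succ by (simp add: window_ok_def Let_def width_def)
  then have "state_correct G (Suc t)" by (simp add: state_correct_def state_Suc)
  moreover have "cell_correct G (Suc t) c" if c: "1 + Suc t \<le> c" "c + Suc t \<le> width" for c
    unfolding cell_correct_def
  proof (intro allI impI)
    fix j assume j: "j < K"
    then have jM: "j < num_tapes M" by (simp add: K_def)
    have pos: "position (c - 1) = position c - 1" "position (c + 1) = position c + 1"
      using c by (auto simp: position_def)
    have cc: "cell_correct G t c" "cell_correct G t (c - 1)" "cell_correct G t (c + 1)"
      using c by (auto intro!: cell)
    then have f: "flag (G t c) j \<longleftrightarrow> head t j = position c"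
       "flag (G t (c - 1)) j \<longleftrightarrow> head t j = position c - 1"
       "flag (G t (c + 1)) j \<longleftrightarrow> head t j = position c + 1"
       "num (G t c) j = content t j (position c)"
      using j pos by (auto simp: cell_correct_def)
    have w: "num (G (Suc t) c) j = (if flag (G t c) j then fst (actions t ! j) else num (G t c) j)"
      "flag (G (Suc t) c) j \<longleftrightarrow> flag (G t (c - 1)) j \<and> snd (actions t ! j) = Move_Right \<or>
         flag (G t c) j \<and> snd (actions t ! j) = Stay \<or>
            flag (G t (c + 1)) j \<and> snd (actions t ! j) = Move_Left"
      using win[of c] c j unfolding window_ok_def succ Let_def by auto
    have "flag (G (Suc t) c) j \<longleftrightarrow> head (Suc t) j = position c"
      unfolding w(2) f head_Suc[OF jM] by (cases "snd (actions t ! j)") auto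
    moreover have "num (G (Suc t) c) j = content (Suc t) j (position c)"
      unfolding w(1) f content_Suc[OF jM] by auto
    ultimately show "num (G (Suc t) c) j = content (Suc t) j (position c) \<and>
        (flag (G (Suc t) c) j \<longleftrightarrow> head (Suc t) j = position c)" by simp
  qed
  ultimately show ?case by simp
qed

lemma windows_complete:
  assumes "\<And>t. t \<le> T \<Longrightarrow> state_correct G t \<and> scanned_correct G t"
    "\<And>t c. t \<le> T \<Longrightarrow> 1 \<le> c \<Longrightarrow> c \<le> width \<Longrightarrow> cell_correct G t c"
  shows "windows_ok G"
  unfolding windows_ok_def
proof (intro allI impI)
  fix t c assume t: "t < T" and c: "c < width - 2"
  have succ: "successor M (num (G t 0) K) (map (num (G t 0)) [0..<K]) = (next_state t, actions t)"
    using assms(1)[of t] t by (intro successor_correct) auto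
  have "num (G (Suc t) 0) K = next_state t"
    using assms(1)[of "Suc t"] t by (simp add: state_correct_def state_Suc)
  moreover have "(flag (G t (c + 2)) j \<longrightarrow> num (G t (c + 2)) j = num (G t 0) j) \<and>
      num (G (Suc t) (c + 2)) j = (if flag (G t (c + 2)) j then fst (actions t ! j) else num (G t (c + 2)) j) \<and>
      (flag (G (Suc t) (c + 2)) j \<longleftrightarrow> flag (G t (c + 1)) j \<and> snd (actions t ! j) = Move_Right \<or>
         flag (G t (c + 2)) j \<and> snd (actions t ! j) = Stay \<or>
            flag (G t (c + 3)) j \<and> snd (actions t ! j) = Move_Left)" if j: "j < K" for j
  proof -
    have jM: "j < num_tapes M" using j by (simp add: K_def)
    have pos: "position (c + 1) = position (c + 2) - 1" "position (c + 3) = position (c + 2) + 1"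
      by (auto simp: position_def)
    have "cell_correct G t (c + 1)" "cell_correct G t (c + 2)" "cell_correct G t (c + 3)"
      "cell_correct G (Suc t) (c + 2)"
      using t c by (auto intro!: assms(2))
    then have f: "flag (G t (c + 2)) j \<longleftrightarrow> head t j = position (c + 2)"
       "flag (G t (c + 1)) j \<longleftrightarrow> head t j = position (c + 2) - 1"
       "flag (G t (c + 3)) j \<longleftrightarrow> head t j = position (c + 2) + 1"
       "num (G t (c + 2)) j = content t j (position (c + 2))"
       "num (G (Suc t) (c + 2)) j = content (Suc t) j (position (c + 2))"
       "flag (G (Suc t) (c + 2)) j \<longleftrightarrow> head (Suc t) j = position (c + 2)"
      using j pos by (auto simp: cell_correct_def)
    have "num (G t 0) j = content t j (head t j)"
      using assms(1)[of t] t j by (simp add: scanned_correct_def)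
    then show ?thesis
      unfolding f content_Suc[OF jM] head_Suc[OF jM] by (cases "snd (actions t ! j)") auto
  qed
  ultimately show "window_ok (G t 0) (G (Suc t) 0) (G t (c + 1)) (G t (c + 2)) (G t (c + 3)) (G (Suc t) (c + 2))"
    unfolding window_ok_def succ Let_def by simp
qed

text \<open>The bits of the actual run. A number v is coded by its first v slots being true, one
  pattern among those that \<open>num\<close> reads as v.\<close>

definition code :: "nat \<Rightarrow> nat \<Rightarrow> nat \<Rightarrow> bool" where
  "code t c s = (let j = s div (B + 1); b = s mod (B + 1) in
     if c = 0 then b < (if j = K then state t else content t j (head t j))
     else if b = B then head t j = position c else b < content t j (position c))"

definition agrees :: "(nat \<Rightarrow> nat \<Rightarrow> nat \<Rightarrow> bool) \<Rightarrow> nat \<Rightarrow> nat \<Rightarrow> nat \<Rightarrow> bool" where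
  "agrees G t c j \<longleftrightarrow> (\<forall>b\<le>B. G t c (j * (B + 1) + b) = code t c (j * (B + 1) + b))"

lemma slot_div_mod: "b \<le> B \<Longrightarrow> (j * (B + 1) + b) div (B + 1) = j"
  "b \<le> B \<Longrightarrow> (j * (B + 1) + b) mod (B + 1) = b"
  by (subst div_mult_self3; simp) (subst mod_mult_self3; simp)

lemma card_below: "v \<le> n \<Longrightarrow> card {b. b < n \<and> b < v} = (v :: nat)"
proof -
  assume "v \<le> n"
  then have "{b. b < n \<and> b < v} = {..<v}" by auto
  then show ?thesis by simp
qed

lemma num_agrees:
  assumes "\<And>b. b < B \<Longrightarrow> G t c (j * (B + 1) + b) = (b < v)" "v \<le> B"
  shows "num (G t c) j = v"
proof -
  have "{b. b < B \<and> G t c (j * (B + 1) + b)} = {b. b < B \<and> b < v}"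
    using assms(1) by blast
  then show ?thesis using card_below[OF assms(2)] by (simp add: num_def)
qed

lemma symbol_le: "j < K \<Longrightarrow> content t j i \<le> B"
  using content_less[of j t i] by (simp add: K_def B_def)

lemma state_le: "state t \<le> B"
  using state_less[of t] by (simp add: B_def)

lemma agrees_state: "agrees G t 0 K \<Longrightarrow> state_correct G t"
  unfolding state_correct_def
  by (rule num_agrees[OF _ state_le]) (simp add: agrees_def code_def slot_div_mod del: add_Suc_right)

lemma agrees_scanned: "(\<And>j. j < K \<Longrightarrow> agrees G t 0 j) \<Longrightarrow> scanned_correct G t"
  unfolding scanned_correct_def
  by (intro allI impI num_agrees[OF _ symbol_le])
    (simp_all add: agrees_def code_def slot_div_mod del: add_Suc_right)

lemma agrees_cell: "0 < c \<Longrightarrow> (\<And>j. j < K \<Longrightarrow> agrees G t c j) \<Longrightarrow> cell_correct G t c"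
  unfolding cell_correct_def
proof (intro allI impI conjI)
  fix j assume "0 < c" and a: "\<And>j. j < K \<Longrightarrow> agrees G t c j" and j: "j < K"
  show "num (G t c) j = content t j (position c)"
    by (rule num_agrees[OF _ symbol_le[OF j]])
      (use a[OF j] \<open>0 < c\<close> in \<open>simp add: agrees_def code_def slot_div_mod Let_def del: add_Suc_right\<close>)
  show "flag (G t c) j \<longleftrightarrow> head t j = position c"
    using a[OF j] \<open>0 < c\<close> by (simp add: flag_def agrees_def code_def slot_div_mod Let_def del: add_Suc_right)
qed

end

section \<open>Decision trees for tableaux\<close>

fun full_tree :: "nat list \<Rightarrow> (bool list \<Rightarrow> bool) \<Rightarrow> dtree" where
  "full_tree [] P = Leaf (P [])"
| "full_tree (f # fs) P =
     Node f (full_tree fs (\<lambda>bs. P (False # bs))) (full_tree fs (\<lambda>bs. P (True # bs)))"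

fun chain :: "(nat \<times> dtree) list \<Rightarrow> dtree" where
  "chain [] = Leaf False"
| "chain ((s, C) # cs) = Node s C (chain cs)"

lemma classify_full_tree: "classify (full_tree fs P) e = P (map ((!) e) fs)"
  by (induction fs arbitrary: P) auto

lemma dtree_over_full_tree: "distinct fs \<Longrightarrow> set fs \<subseteq> F \<Longrightarrow> dtree_over F (full_tree fs P)"
proof (induction fs arbitrary: P F)
  case (Cons f fs)
  then have "set fs \<subseteq> F - {f}" by auto
  with Cons show ?case by simp
qed simp

lemma dtree_over_chain:
  assumes "distinct (map fst cs)" "set (map fst cs) \<subseteq> F"
    "\<And>s C. (s, C) \<in> set cs \<Longrightarrow> dtree_over E C" "E \<subseteq> F" "E \<inter> set (map fst cs) = {}"
  shows "dtree_over F (chain cs)"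
  using assms
proof (induction cs arbitrary: F rule: chain.induct)
  case (2 s C cs)
  have "dtree_over (F - {s}) (chain cs)"
    using "2.prems" by (intro "2.IH") auto
  moreover have "dtree_over E C" "E \<subseteq> F - {s}"
    using "2.prems" by auto
  then have "dtree_over (F - {s}) C"
    unfolding dtree_over_toks by blast
  ultimately show ?case using "2.prems"(2) by simp
qed simp

lemma classify_chain_imp: "classify (chain cs) e \<Longrightarrow> \<exists>(s, C)\<in>set cs. classify C e"
  by (induction cs rule: chain.induct) (auto split: if_splits)

lemma classify_chain_select:
  "(s, C) \<in> set cs \<Longrightarrow> distinct (map fst cs) \<Longrightarrow> (\<And>s'. s' \<in> fst ` set cs \<Longrightarrow> e ! s' \<longleftrightarrow> s' \<noteq> s) \<Longrightarrow>
     classify (chain cs) e = classify C e"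
proof (induction cs rule: chain.induct)
  case (2 s' C' cs)
  show ?case
  proof (cases "s' = s")
    case True
    then have "C = C'"
      using "2.prems"(1,2) by (force simp: image_iff)
    then show ?thesis using "2.prems"(3)[of s'] True by simp
  next
    case False
    then have "(s, C) \<in> set cs" using "2.prems"(1) by auto
    then have "classify (chain cs) e = classify C e"
      using "2.prems"(2,3) by (intro "2.IH") auto
    then show ?thesis using "2.prems"(3)[of s'] False by simp
  qed
qed simp

lemma concat_uniform_nth:
  "i < length gs \<Longrightarrow> s < d \<Longrightarrow> concat (map (\<lambda>g. map (h g) [0..<d]) gs) ! (i * d + s) = h (gs ! i) s"
proof (induction gs arbitrary: i)
  case (Cons g gs)
  then show ?case by (cases i) (auto simp: nth_append)
qed simp

lemma concat_map_upt:
  "concat (map (\<lambda>a. map (\<lambda>b. h (a * n + b)) [0..<n]) [0..<m]) = map h [0..<m * n]"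
proof (induction m)
  case (Suc m)
  have "map h [m * n..<m * n + n] = map (\<lambda>b. h (m * n + b)) [0..<n]"
    by (rule nth_equalityI) auto
  moreover have "[0..<Suc m * n] = [0..<m * n] @ [m * n..<m * n + n]"
    using upt_add_eq_append[of 0 "m * n" n] by (simp add: add.commute)
  ultimately have "map h [0..<Suc m * n] = map h [0..<m * n] @ map (\<lambda>b. h (m * n + b)) [0..<n]"
    by (simp only: map_append)
  then show ?case by (simp only: Suc.IH upt_Suc_append[OF le0] map_append concat_append list.map concat.simps append_Nil2)
qed simp

context tableau_shape begin

section \<open>Numbering of the features and the tree of all constraints\<close>

definition cell_no :: "nat \<Rightarrow> nat \<Rightarrow> nat" where "cell_no t c = t * (width + 1) + c"
definition feature :: "nat \<Rightarrow> nat \<Rightarrow> nat \<Rightarrow> nat" where "feature t c s = cell_no t c * D + s"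
definition cell_count :: nat where "cell_count = (T + 1) * (width + 1)"
definition selectors :: nat where "selectors = cell_count * D"
definition dim :: nat where "dim = selectors + (T * (width - 2) + 1)"

definition group_features :: "nat list \<Rightarrow> nat list" where
  "group_features gs = concat (map (\<lambda>g. map (\<lambda>s. g * D + s) [0..<D]) gs)"

definition cell_bits :: "bool list \<Rightarrow> nat \<Rightarrow> nat \<Rightarrow> bool" where
  "cell_bits bs i s \<longleftrightarrow> s < D \<and> bs ! (i * D + s)"

definition window_groups :: "nat \<Rightarrow> nat \<Rightarrow> nat list" where
  "window_groups t c = [cell_no t 0, cell_no (t + 1) 0, cell_no t (c + 1), cell_no t (c + 2), cell_no t (c + 3),
     cell_no (t + 1) (c + 2)]"

definition bad_window :: "bool list \<Rightarrow> bool" where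
  "bad_window bs \<longleftrightarrow> \<not> window_ok (cell_bits bs 0) (cell_bits bs 1) (cell_bits bs 2) (cell_bits bs 3)
     (cell_bits bs 4) (cell_bits bs 5)"

text \<open>Symbol 2 is the bit 1; acceptance puts it into cell 0, which is column
  \<open>orig\<close>, of the last tape, whose index is K - 1.\<close>

definition bad_output :: "bool list \<Rightarrow> bool" where
  "bad_output bs \<longleftrightarrow> num (cell_bits bs 0) (K - 1) \<noteq> 2"

text \<open>A full tree for a window has 2 to the power 6 * D leaves, but D depends on the machine
  only, so the whole tree grows polynomially with T.\<close>

definition constraints :: "(nat \<times> dtree) list" where
  "constraints = concat (map (\<lambda>t. map (\<lambda>c. (selectors + (t * (width - 2) + c),
       full_tree (group_features (window_groups t c)) bad_window)) [0..<width - 2]) [0..<T]) @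
     [(selectors + T * (width - 2), full_tree (group_features [cell_no T orig]) bad_output)]"

definition tree :: dtree where "tree = chain constraints"

definition cells :: "(nat \<Rightarrow> bool) \<Rightarrow> nat \<Rightarrow> nat \<Rightarrow> nat \<Rightarrow> bool" where
  "cells a t c s \<longleftrightarrow> s < D \<and> a (feature t c s)"

lemma D_pos: "0 < D" by (simp add: D_def)

lemma cell_no_div_mod: "c \<le> width \<Longrightarrow> cell_no t c div (width + 1) = t" "c \<le> width \<Longrightarrow> cell_no t c mod (width + 1) = c"
  unfolding cell_no_def by (subst div_mult_self3; simp) (subst mod_mult_self3; simp)

lemma feature_div_mod: "s < D \<Longrightarrow> feature t c s div D = cell_no t c" "s < D \<Longrightarrow> feature t c s mod D = s"
  unfolding feature_def by (subst div_mult_self3; simp) (subst mod_mult_self3; simp)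

lemma cell_no_less: "t \<le> T \<Longrightarrow> c \<le> width \<Longrightarrow> cell_no t c < cell_count"
proof -
  assume "t \<le> T" "c \<le> width"
  then have "cell_no t c < (t + 1) * (width + 1)" by (simp add: cell_no_def)
  also have "\<dots> \<le> cell_count"
    unfolding cell_count_def using \<open>t \<le> T\<close> by (intro mult_le_mono1) simp
  finally show ?thesis .
qed

lemma group_feature_less: "g < cell_count \<Longrightarrow> s < D \<Longrightarrow> g * D + s < selectors"
proof -
  assume "g < cell_count" "s < D"
  then have "g * D + s < (g + 1) * D" by simp
  also have "\<dots> \<le> cell_count * D"
    using \<open>g < cell_count\<close> by (intro mult_le_mono1) simp
  finally show ?thesis by (simp only: selectors_def)
qed

lemma feature_less: "t \<le> T \<Longrightarrow> c \<le> width \<Longrightarrow> s < D \<Longrightarrow> feature t c s < selectors"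
  unfolding feature_def by (intro group_feature_less cell_no_less)

lemma set_group_features: "set (group_features gs) = (\<Union>g\<in>set gs. (\<lambda>s. g * D + s) ` {..<D})"
  by (simp add: group_features_def atLeast0LessThan)

lemma distinct_group_features: "distinct gs \<Longrightarrow> distinct (group_features gs)"
proof (induction gs)
  case (Cons g gs)
  have "set (map (\<lambda>s. g * D + s) [0..<D]) \<inter> set (group_features gs) = {}"
  proof -
    have "g = g'" if "g * D + s = g' * D + s'" "s < D" "s' < D" for g' s s'
    proof -
      have "(h * D + u) div D = h" if "u < D" for h u
        using that D_pos by (subst div_mult_self3) auto
      with that show ?thesis by metis
    qed
    note g_eq = this
    have "x \<notin> set (group_features gs)" if x: "x \<in> set (map (\<lambda>s. g * D + s) [0..<D])" for x
    proof
      assume "x \<in> set (group_features gs)"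
      then obtain g' s' where "g' \<in> set gs" "s' < D" "x = g' * D + s'"
        unfolding set_group_features by blast
      moreover obtain s where "s < D" "x = g * D + s"
        using x unfolding set_map set_upt by (metis atLeastLessThan_iff imageE)
      ultimately have "g = g'" using g_eq by metis
      with \<open>g' \<in> set gs\<close> Cons.prems show False by simp
    qed
    then show ?thesis by blast
  qed
  moreover have "group_features (g # gs) = map (\<lambda>s. g * D + s) [0..<D] @ group_features gs"
    by (simp add: group_features_def)
  ultimately show ?case
    using Cons by (simp only: distinct_append) (simp add: distinct_map)
qed (simp add: group_features_def)

lemma cell_bits_group_features:
  "i < length gs \<Longrightarrow> cell_bits (map a (group_features gs)) i = (\<lambda>s. s < D \<and> a (gs ! i * D + s))"
proof
  fix s assume i: "i < length gs"
  have "length (group_features gs) = length gs * D"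
    by (simp add: group_features_def length_concat o_def sum_list_triv)
  moreover have "i * D + s < length gs * D" if "s < D"
  proof -
    have "i * D + s < (i + 1) * D" using that by simp
    also have "\<dots> \<le> length gs * D" using i by (intro mult_le_mono1) simp
    finally show ?thesis .
  qed
  moreover have "group_features gs ! (i * D + s) = gs ! i * D + s" if "s < D"
    unfolding group_features_def using i that by (rule concat_uniform_nth)
  ultimately show "cell_bits (map a (group_features gs)) i s \<longleftrightarrow> s < D \<and> a (gs ! i * D + s)"
    by (auto simp: cell_bits_def)
qed

lemma cell_no_eq_iff: "c \<le> width \<Longrightarrow> c' \<le> width \<Longrightarrow> cell_no t c = cell_no t' c' \<longleftrightarrow> t = t' \<and> c = c'"
  using cell_no_div_mod by metis

lemma distinct_window_groups: "c < width - 2 \<Longrightarrow> distinct (window_groups t c)"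
  by (auto simp: window_groups_def cell_no_eq_iff)

lemma window_groups_less: "t < T \<Longrightarrow> c < width - 2 \<Longrightarrow> g \<in> set (window_groups t c) \<Longrightarrow>
    g < cell_count"
  by (auto simp: window_groups_def intro!: cell_no_less)

lemma orig_le: "orig \<le> width"
  by (simp add: orig_def width_def)

lemma selectors_constraints: "map fst constraints = map (\<lambda>i. selectors + i) [0..<T * (width - 2) + 1]"
proof -
  have "map fst constraints = concat (map (\<lambda>t. map (\<lambda>c. selectors + (t * (width - 2) + c)) [0..<width - 2]) [0..<T]) @
      [selectors + T * (width - 2)]"
    by (simp add: constraints_def map_concat o_def)
  then show ?thesis
    by (simp only: concat_map_upt) simp
qed

lemma constraints_cases:
  assumes "(s, C) \<in> set constraints"
  obtains t c where "t < T" "c < width - 2" "C = full_tree (group_features (window_groups t c)) bad_window"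
  | "C = full_tree (group_features [cell_no T orig]) bad_output"
  using assms by (auto simp: constraints_def)

lemma dtree_over_constraint:
  assumes "(s, C) \<in> set constraints"
  shows "dtree_over {..<selectors} C"
  using assms
proof (cases rule: constraints_cases)
  case (1 t c)
  show ?thesis
    unfolding 1(3) using window_groups_less[OF 1(1,2)] distinct_window_groups[OF 1(2)]
    by (intro dtree_over_full_tree distinct_group_features) (auto simp: set_group_features group_feature_less)
next
  case 2
  show ?thesis
    unfolding 2 using cell_no_less[OF le_refl orig_le]
    by (intro dtree_over_full_tree distinct_group_features) (auto simp: set_group_features group_feature_less)
qed

lemma dtree_of_dim_tree: "dtree_of_dim dim tree"
  unfolding dtree_of_dim_def tree_def
proof (rule dtree_over_chain[OF _ _ dtree_over_constraint])
  show "distinct (map fst constraints)"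
    unfolding selectors_constraints by (simp add: distinct_map)
  show "set (map fst constraints) \<subseteq> {..<dim}" "{..<selectors} \<inter> set (map fst constraints) = {}"
    unfolding selectors_constraints by (auto simp: dim_def)
qed (auto simp: dim_def)

lemma classify_bad_window: "classify (full_tree (group_features (window_groups t c)) bad_window) e \<longleftrightarrow>
    \<not> window_ok (cells ((!) e) t 0) (cells ((!) e) (Suc t) 0) (cells ((!) e) t (c + 1))
      (cells ((!) e) t (c + 2)) (cells ((!) e) t (c + 3)) (cells ((!) e) (Suc t) (c + 2))"
proof -
  have "cells ((!) e) t' c' = (\<lambda>s. s < D \<and> e ! (cell_no t' c' * D + s))" for t' c'
    by (auto simp: cells_def feature_def)
  then show ?thesis
    unfolding classify_full_tree bad_window_def
    by (simp add: cell_bits_group_features window_groups_def)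
qed

lemma classify_bad_output: "classify (full_tree (group_features [cell_no T orig]) bad_output) e \<longleftrightarrow>
    num (cells ((!) e) T orig) (K - 1) \<noteq> 2"
proof -
  have "cells ((!) e) t' c' = (\<lambda>s. s < D \<and> e ! (cell_no t' c' * D + s))" for t' c'
    by (auto simp: cells_def feature_def)
  then show ?thesis
    unfolding classify_full_tree bad_output_def by (simp add: cell_bits_group_features)
qed

definition tableau_ok :: "(nat \<Rightarrow> bool) \<Rightarrow> bool" where
  "tableau_ok a \<longleftrightarrow> windows_ok (cells a) \<and> num (cells a T orig) (K - 1) = 2"

text \<open>Whichever constraint the chain leads to is satisfied, and with all selectors 1 the chain
  ends in \<open>Leaf False\<close>.\<close>

lemma tableau_ok_not_classify: "tableau_ok ((!) e) \<Longrightarrow> \<not> classify tree e"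
proof
  assume ok: "tableau_ok ((!) e)" and "classify tree e"
  then obtain s C where "(s, C) \<in> set constraints" "classify C e"
    using classify_chain_imp unfolding tree_def by blast
  then show False
    using ok by (cases rule: constraints_cases)
      (auto simp: classify_bad_window classify_bad_output tableau_ok_def windows_ok_def)
qed

lemma not_tableau_ok_classify:
  assumes "\<not> tableau_ok a"
  shows "\<exists>e. length e = dim \<and> (\<forall>f<selectors. e ! f = a f) \<and> classify tree e"
proof -
  \<comment> \<open>All selectors but s are 1, so that the chain leads to the constraint of s; s
    will be the selector of a violated one.\<close>
  define e where "e = (\<lambda>s. map (\<lambda>f. if f < selectors then a f else f \<noteq> s) [0..<dim])"
  have sel: "selectors \<le> dim" by (simp add: dim_def)
  then have e: "length (e s) = dim" "\<forall>f<selectors. e s ! f = a f" for s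
    by (auto simp: e_def)
  have cells: "cells ((!) (e s)) t c = cells a t c" if "t \<le> T" "c \<le> width" for t c s
    using e(2)[of s] feature_less[OF that] by (auto simp: cells_def fun_eq_iff)
  have classify: "classify tree (e s) = classify C (e s)" if "(s, C) \<in> set constraints" for s C
    unfolding tree_def using that
  proof (rule classify_chain_select)
    show "distinct (map fst constraints)"
      unfolding selectors_constraints by (simp add: distinct_map)
    fix s' assume "s' \<in> fst ` set constraints"
    then have "s' \<in> set (map fst constraints)" by simp
    then have "selectors \<le> s'" "s' < dim"
      unfolding selectors_constraints by (auto simp: dim_def)
    then show "e s ! s' \<longleftrightarrow> s' \<noteq> s" by (simp add: e_def)
  qed
  have "\<exists>s C. (s, C) \<in> set constraints \<and> classify C (e s)"
  proof (cases "windows_ok (cells a)")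
    case True
    let ?s = "selectors + T * (width - 2)"
    have "num (cells ((!) (e ?s)) T orig) (K - 1) \<noteq> 2"
      using assms True cells[of T orig ?s] orig_le by (simp add: tableau_ok_def)
    then have "classify (full_tree (group_features [cell_no T orig]) bad_output) (e ?s)"
      by (simp add: classify_bad_output)
    then show ?thesis by (auto simp: constraints_def)
  next
    case False
    then obtain t c where t: "t < T" "c < width - 2" and w: "\<not> window_ok (cells a t 0) (cells a (Suc t) 0)
     (cells a t (c + 1)) (cells a t (c + 2)) (cells a t (c + 3)) (cells a (Suc t) (c + 2))"
      by (auto simp: windows_ok_def)
    let ?s = "selectors + (t * (width - 2) + c)"
    have "classify (full_tree (group_features (window_groups t c)) bad_window) (e ?s)"
      unfolding classify_bad_window using w t by (simp add: cells)
    moreover have "(?s, full_tree (group_features (window_groups t c)) bad_window) \<in> set constraints"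
    proof -
      have "(?s, full_tree (group_features (window_groups t c)) bad_window) \<in>
          set (map (\<lambda>c. (selectors + (t * (width - 2) + c),
            full_tree (group_features (window_groups t c)) bad_window)) [0..<width - 2])"
        using t(2) by (auto intro: image_eqI[of _ _ c])
      then show ?thesis
        unfolding constraints_def set_append set_concat set_map[of _ "[0..<T]"] set_upt
        using t(1) by (intro UnI1 UN_I[OF imageI[of t]]) simp_all
    qed
    ultimately show ?thesis by blast
  qed
  then show ?thesis using classify e by blast
qed

end

section \<open>Correctness of the reduction\<close>

lemma concat_concat: "concat (concat xs) = concat (map concat xs)"
  by (induction xs) auto

context tableau_shape begin

text \<open>Nested over rows, columns and slots, in the order in which a generator emits them. The
  selectors stay undefined, so that y may set them freely.\<close>

definition build :: "(nat \<Rightarrow> nat \<Rightarrow> nat \<Rightarrow> bool option) \<Rightarrow> pinstance" where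
  "build v = concat (map (\<lambda>t. concat (map (\<lambda>c. map (v t c) [0..<D]) [0..<width + 1])) [0..<T + 1]) @
     replicate (T * (width - 2) + 1) None"

lemma build_eq: "build v =
    map (\<lambda>f. v (f div D div (width + 1)) (f div D mod (width + 1)) (f mod D)) [0..<selectors] @
    replicate (T * (width - 2) + 1) None"
proof -
  define h where "h = (\<lambda>f. v (f div D div (width + 1)) (f div D mod (width + 1)) (f mod D))"
  define cell where "cell = (\<lambda>g. map (\<lambda>s. h (g * D + s)) [0..<D])"
  have "map (v t c) [0..<D] = cell (t * (width + 1) + c)" if "c < width + 1" for t c
  proof (rule nth_equalityI)
    fix s assume "s < length (map (v t c) [0..<D])"
    then have s: "s < D" by simp
    have "feature t c s div D = cell_no t c" "feature t c s mod D = s"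
      using s by (simp_all add: feature_div_mod)
    then show "map (v t c) [0..<D] ! s = cell (t * (width + 1) + c) ! s"
      using that s cell_no_div_mod[of c t]
      by (simp add: cell_def h_def feature_def cell_no_def del: add_Suc_right)
  qed (simp add: cell_def)
  then have "concat (map (\<lambda>c. map (v t c) [0..<D]) [0..<width + 1]) =
      concat (map (\<lambda>c. cell (t * (width + 1) + c)) [0..<width + 1])" for t
    by (intro arg_cong[where f = concat] map_cong) auto
  then have "concat (map (\<lambda>t. concat (map (\<lambda>c. map (v t c) [0..<D]) [0..<width + 1])) [0..<T + 1]) =
      concat (concat (map (\<lambda>t. map (\<lambda>c. cell (t * (width + 1) + c)) [0..<width + 1]) [0..<T + 1]))"
    by (simp only: concat_concat map_map o_def)
  also have "\<dots> = concat (map cell [0..<(T + 1) * (width + 1)])"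
    by (simp only: concat_map_upt)
  also have "\<dots> = map h [0..<selectors]"
    unfolding cell_def by (simp only: concat_map_upt selectors_def cell_count_def)
  finally show ?thesis by (simp only: build_def h_def)
qed

lemma length_build [simp]: "length (build v) = dim"
  by (simp add: build_eq dim_def)

lemma nth_build: "t \<le> T \<Longrightarrow> c \<le> width \<Longrightarrow> s < D \<Longrightarrow> build v ! feature t c s = v t c s"
  using feature_less[of t c s] feature_div_mod[of s t c] cell_no_div_mod[of c t]
  by (simp add: build_eq nth_append)

lemma nth_build_selectors: "selectors \<le> f \<Longrightarrow> f < dim \<Longrightarrow> build v ! f = None"
  by (simp add: build_eq nth_append dim_def del: replicate_Suc)

lemma feature_cases:
  assumes "f < selectors"
  obtains t c s where "t \<le> T" "c \<le> width" "s < D" "f = feature t c s"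
proof -
  let ?g = "f div D"
  have "?g < cell_count"
    using assms by (simp add: selectors_def less_mult_imp_div_less)
  then have "?g div (width + 1) < T + 1"
    by (simp add: cell_count_def less_mult_imp_div_less)
  moreover have "?g mod (width + 1) < width + 1" by simp
  moreover have "feature (?g div (width + 1)) (?g mod (width + 1)) (f mod D) = f"
    unfolding feature_def cell_no_def by (simp only: div_mult_mod_eq)
  ultimately show ?thesis
    using that[of "?g div (width + 1)" "?g mod (width + 1)" "f mod D"] D_pos by simp
qed

lemma mark_eq_build:
  assumes "\<And>f. P f \<Longrightarrow> f < selectors"
  shows "mark dim P = build (\<lambda>t c s. if P (feature t c s) then Some True else None)"
proof (rule nth_equalityI)
  fix f assume "f < length (mark dim P)"
  then have f: "f < dim" by simp
  show "mark dim P ! f = build (\<lambda>t c s. if P (feature t c s) then Some True else None) ! f"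
  proof (cases "f < selectors")
    case True
    then obtain t c s where "t \<le> T" "c \<le> width" "s < D" "f = feature t c s"
      by (rule feature_cases)
    then show ?thesis using f by (simp add: nth_build)
  next
    case False
    then show ?thesis using f assms[of f] by (auto simp: nth_build_selectors)
  qed
qed simp

end

text \<open>T bounds the lengths of the words too, so that they fit into the columns from
  \<open>orig\<close> on.\<close>

locale reduction = tableau_shape M T for M T +
  fixes k m :: nat and x :: "bool list" and R :: "bool list list \<Rightarrow> bool"
  assumes wf: "wf_tm M" and tapes: "Suc k \<le> num_tapes M"
    and computes: "\<And>us. length us = k \<Longrightarrow> (\<And>u. u \<in> set us \<Longrightarrow> length u = m) \<Longrightarrow>
      computes_within M (x # us) [R (x # us)] T"
    and len: "length x \<le> T" "m \<le> T"
begin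

definition word_len :: "nat \<Rightarrow> nat" where "word_len j = (if j = 0 then length x else m)"

text \<open>Row 0 as far as x determines it. Inside a word the symbols are 1 and 2, so slot 0 is
  true and slot 1 is the bit itself: one feature per bit. For the quantified words slot 1 is left
  undefined; it is the feature given by \<open>word_pos\<close>.\<close>

definition fixed :: "nat \<Rightarrow> nat \<Rightarrow> nat \<Rightarrow> bool option" where
  "fixed t c s = (let j = s div (B + 1); b = s mod (B + 1) in
     if 0 < t then None
     else if c = 0 then if j = K then Some (b < start_state M) else None
     else if K \<le> j then None
     else if b = B then Some (c = orig)
     else if 2 \<le> b \<or> k < j \<or> c < orig \<or> orig + word_len j \<le> c then Some False
     else if b = 0 then Some True
     else if j = 0 then Some (bit_at x (c - orig)) else None)"

definition word_pos :: "nat \<Rightarrow> nat \<Rightarrow> nat" where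
  "word_pos j h = feature 0 (orig + h) (j * (B + 1) + 1)"

text \<open>The tableau block: all rows after row 0 and, in row 0, the scanned symbols in column 0,
  which may depend on the quantified words.\<close>

definition free_feature :: "nat \<Rightarrow> bool" where
  "free_feature f \<longleftrightarrow> f < selectors \<and> ((width + 1) * D \<le> f \<or> f < K * (B + 1))"

sublocale hard_input k dim m tree "build fixed" word_pos free_feature
proof
  show "h = h'" if "word_pos j h = word_pos j h'" for j h h'
    using that D_pos by (simp add: word_pos_def feature_def cell_no_def)
qed simp

lemma K_ge: "k < K" "0 < K"
  using tapes by (auto simp: K_def)

lemma B_ge: "3 \<le> B"
  using wf by (simp add: wf_tm_def B_def le_max_iff_disj)

lemma slot_less: "j \<le> K \<Longrightarrow> b \<le> B \<Longrightarrow> j * (B + 1) + b < D"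
proof -
  assume "j \<le> K" "b \<le> B"
  then have "j * (B + 1) + b < (j + 1) * (B + 1)" by simp
  also have "\<dots> \<le> (K + 1) * (B + 1)" using \<open>j \<le> K\<close> by (intro mult_le_mono1) simp
  finally show ?thesis by (simp only: D_def)
qed

lemma free_feature_iff:
  assumes "t \<le> T" "c \<le> width" "s < D"
  shows "free_feature (feature t c s) \<longleftrightarrow> 0 < t \<or> c = 0 \<and> s < K * (B + 1)"
proof (cases t)
  case 0
  have "feature 0 c s < (c + 1) * D" using assms(3) by (simp add: feature_def cell_no_def)
  also have "\<dots> \<le> (width + 1) * D" using assms(2) by (intro mult_le_mono1) simp
  finally have "feature 0 c s < (width + 1) * D" .
  moreover have "K * (B + 1) \<le> feature 0 c s" if "0 < c"
  proof -
    have "K * (B + 1) \<le> 1 * D" by (simp add: D_def)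
    also have "\<dots> \<le> c * D" using that by (intro mult_le_mono1) simp
    finally show ?thesis by (simp add: feature_def cell_no_def)
  qed
  moreover have "feature 0 0 s = s" by (simp add: feature_def cell_no_def)
  ultimately show ?thesis
    using 0 feature_less[OF assms] by (cases "c = 0") (auto simp: free_feature_def)
next
  case (Suc t')
  have "(width + 1) * D \<le> cell_no t c * D"
    using Suc by (intro mult_le_mono1) (simp add: cell_no_def)
  then have "(width + 1) * D \<le> feature t c s" by (simp add: feature_def)
  then show ?thesis using Suc feature_less[OF assms] by (simp add: free_feature_def)
qed

context
  fixes us :: "bool list list"
  assumes us: "length us = k" "\<And>u. u \<in> set us \<Longrightarrow> length u = m"
begin

interpretation tableau M "x # us" T
  by unfold_locales (rule wf)

lemma word_length: "j \<le> k \<Longrightarrow> length ((x # us) ! j) = word_len j"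
  using us by (cases j) (auto simp: word_len_def)

lemma output_correct: "content T (K - 1) 0 = (if R (x # us) then 2 else 1)"
proof -
  have "has_output (cfg T) [R (x # us)]"
    using computes[OF us] by (simp add: computes_within_def cfg_def Let_def)
  then have "fst (last (snd (cfg T))) 0 = bit_symbol (R (x # us))"
    by (simp add: has_output_def Let_def)
  moreover have "last (snd (cfg T)) = snd (cfg T) ! (K - 1)"
    using length_tapes[of T] K_ge by (simp add: K_def last_conv_nth flip: length_0_conv)
  ultimately show ?thesis by (simp add: content_def bit_symbol_def)
qed

lemma code_cell_0:
  assumes "0 < c" "j < K" "b < B"
  shows "code 0 c (j * (B + 1) + b) \<longleftrightarrow> j \<le> k \<and> orig \<le> c \<and> c < orig + word_len j \<and>
    (b = 0 \<or> b = 1 \<and> (x # us) ! j ! (c - orig))"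
proof -
  have "code 0 c (j * (B + 1) + b) \<longleftrightarrow> b < content 0 j (position c)"
    using assms by (simp add: code_def Let_def slot_div_mod del: add_Suc_right)
  also have "content 0 j (position c) = (if j \<le> k \<and> orig \<le> c \<and> c < orig + word_len j
      then bit_symbol ((x # us) ! j ! (c - orig)) else 0)"
    using assms us(1) word_length[of j]
    by (auto simp: content_0 K_def position_def nat_diff_distrib' simp flip: of_nat_diff)
  finally show ?thesis
    by (auto simp: bit_symbol_def)
qed

text \<open>The second premise selects the slots of row 0 that the windows read and the tableau
  block does not cover. Each of them either is fixed with its value in the run or carries one bit of
  a quantified word.\<close>

lemma fixed_code:
  assumes "b \<le> B" "c = 0 \<and> j = K \<or> 0 < c \<and> j < K"
  shows "case fixed 0 c (j * (B + 1) + b) of Some v \<Rightarrow> code 0 c (j * (B + 1) + b) = v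
    | None \<Rightarrow> 1 \<le> j \<and> j \<le> k \<and> b = 1 \<and> orig \<le> c \<and> c < orig + m \<and>
        code 0 c (j * (B + 1) + b) = us ! (j - 1) ! (c - orig)"
proof (cases "c = 0")
  case True
  with assms show ?thesis
    by (simp add: fixed_def code_def Let_def slot_div_mod state_0 del: add_Suc_right)
next
  case c: False
  then have j: "j < K" using assms by simp
  show ?thesis
  proof (cases "b = B")
    case True
    then show ?thesis
      using c j by (simp add: fixed_def code_def Let_def slot_div_mod head_0 K_def position_def
        eq_commute[of orig] del: add_Suc_right)
  next
    case False
    then have "b < B" using assms(1) by simp
    note code = code_cell_0[OF _ j this, of c]
    have "fixed 0 c (j * (B + 1) + b) = (if 2 \<le> b \<or> k < j \<or> c < orig \<or> orig + word_len j \<le> c then Some False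
       else if b = 0 then Some True
       else if j = 0 then Some (bit_at x (c - orig)) else None)"
      using c j \<open>b < B\<close> unfolding fixed_def Let_def slot_div_mod[OF less_imp_le[OF \<open>b < B\<close>]] by simp
    then show ?thesis
      using code c by (cases "j = 0") (auto simp: word_len_def bit_at_def split: if_splits)
  qed
qed

text \<open>If R holds, A is taken as the code of the actual run: every full y that conforms to it
  codes the run wherever a constraint looks, and violates none. Conversely, correct windows force
  the output of the run, so if R fails, any A leaves a violated constraint, and a y with the
  matching selector is positive.\<close>

lemma matrix_sem_iff: "(\<exists>A. matrix_sem us A) \<longleftrightarrow> R (x # us)"
proof
  assume R: "R (x # us)"
  define A where "A = (\<lambda>f. code (f div D div (width + 1)) (f div D mod (width + 1)) (f mod D))"
  have A: "A (feature t c s) = code t c s" if "c \<le> width" "s < D" for t c s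
    using that by (simp add: A_def feature_div_mod cell_no_div_mod del: One_nat_def add_Suc_right)
  have "matrix_sem us A"
    unfolding matrix_sem_def
  proof (intro ballI impI notI)
    fix y assume y: "y \<in> pinstances dim" and e0: "subsumed (build fixed) y"
      and words: "\<forall>j\<in>{1..k}. \<forall>h<m. word_pos j h < dim \<longrightarrow> (y ! word_pos j h = Some True \<longleftrightarrow> us ! (j - 1) ! h)"
      and free: "\<forall>f<dim. free_feature f \<longrightarrow> (y ! f = Some True \<longleftrightarrow> A f)"
      and pos: "positive tree y"
    let ?b = "map the y"
    have len_y: "length y = dim" using y by (simp add: pinstances_def)
    \<comment> \<open>A positive y has no undefined feature, so a feature that is not 1 is
      0.\<close>
    have b: "?b ! f \<longleftrightarrow> y ! f = Some True" if "f < dim" for f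
    proof -
      have "y ! f \<noteq> None" using pos that len_y by (metis nth_mem positive_def)
      then show ?thesis using that len_y by auto
    qed
    have less: "feature t c s < dim" if "t \<le> T" "c \<le> width" "s < D" for t c s
      using feature_less[OF that] by (simp add: dim_def)
    let ?G = "cells ((!) ?b)"
    have free_code: "?G t c s = code t c s"
      if "t \<le> T" "c \<le> width" "s < D" "free_feature (feature t c s)" for t c s
      using that b[OF less] free less A by (simp add: cells_def)
    have fixed_slot: "?G 0 c (j * (B + 1) + b) = code 0 c (j * (B + 1) + b)"
      if c: "c \<le> width" and bj: "b \<le> B" "c = 0 \<and> j = K \<or> 0 < c \<and> j < K" for c j b
    proof -
      let ?s = "j * (B + 1) + b"
      have s: "?s < D" using bj by (intro slot_less) auto
      have nth: "build fixed ! feature 0 c ?s = fixed 0 c ?s"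
        using c s by (intro nth_build) auto
      show ?thesis
      proof (cases "fixed 0 c ?s")
        case (Some v)
        then have "y ! feature 0 c ?s = Some v"
          using e0 nth less[of 0 c ?s] c s by (auto simp: subsumed_def)
        then show ?thesis
          using fixed_code[OF bj] Some s b[OF less[of 0 c ?s]] c by (simp add: cells_def)
      next
        case None
        have n: "1 \<le> j \<and> j \<le> k \<and> b = 1 \<and> orig \<le> c \<and> c < orig + m \<and>
            code 0 c ?s = us ! (j - 1) ! (c - orig)"
          using fixed_code[OF bj] unfolding None option.case .
        then have "feature 0 c ?s = word_pos j (c - orig)" by (simp add: word_pos_def)
        moreover have "y ! word_pos j (c - orig) = Some True \<longleftrightarrow> us ! (j - 1) ! (c - orig)"
          using words n less[of 0 c ?s] c s calculation by auto
        ultimately have "?G 0 c ?s \<longleftrightarrow> us ! (j - 1) ! (c - orig)"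
          using s b[OF less[of 0 c ?s]] c by (simp only: cells_def simp_thms le0)
        then show ?thesis using n by blast
      qed
    qed
    have st: "state_correct ?G t \<and> scanned_correct ?G t" if t: "t \<le> T" for t
    proof
      show "state_correct ?G t"
      proof (rule agrees_state, unfold agrees_def, intro allI impI)
        fix b assume "b \<le> B"
        then show "?G t 0 (K * (B + 1) + b) = code t 0 (K * (B + 1) + b)"
          using fixed_slot[of 0 b K] free_code[of t 0 "K * (B + 1) + b"] slot_less[of K b] t
          by (cases "t = 0") (simp_all add: free_feature_iff)
      qed
      show "scanned_correct ?G t"
      proof (rule agrees_scanned, unfold agrees_def, intro allI impI)
        fix j b assume jb: "j < K" "b \<le> B"
        then have "j * (B + 1) + b < (j + 1) * (B + 1)" by simp
        also have "\<dots> \<le> K * (B + 1)" using jb by (intro mult_le_mono1) simp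
        finally show "?G t 0 (j * (B + 1) + b) = code t 0 (j * (B + 1) + b)"
          using slot_less[of j b] jb t by (intro free_code) (simp_all add: free_feature_iff)
      qed
    qed
    have cell: "cell_correct ?G t c" if t: "t \<le> T" and c: "1 \<le> c" "c \<le> width" for t c
    proof (rule agrees_cell, use c in simp, unfold agrees_def, intro allI impI)
      fix j b assume jb: "j < K" "b \<le> B"
      then show "?G t c (j * (B + 1) + b) = code t c (j * (B + 1) + b)"
        using fixed_slot[of c b j] free_code[of t c "j * (B + 1) + b"] slot_less[of j b] t c
        by (cases "t = 0") (simp_all add: free_feature_iff)
    qed
    have "windows_ok ?G" using st cell by (rule windows_complete)
    moreover have "num (?G T orig) (K - 1) = 2"
      using cell[of T orig] orig_le K_ge output_correct R
      by (simp add: cell_correct_def position_def orig_def)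
    ultimately have "tableau_ok ((!) ?b)" by (simp add: tableau_ok_def)
    then show False
      using tableau_ok_not_classify pos by (simp add: positive_def)
  qed
  then show "\<exists>A. matrix_sem us A" by (rule exI[of _ A])
next
  assume "\<exists>A. matrix_sem us A"
  then obtain A where A: "matrix_sem us A" by blast
  define C where "C = (\<lambda>f. code (f div D div (width + 1)) (f div D mod (width + 1)) (f mod D))"
  have C: "C (feature t c s) = code t c s" if "c \<le> width" "s < D" for t c s
    using that by (simp add: C_def feature_div_mod cell_no_div_mod del: One_nat_def add_Suc_right)
  \<comment> \<open>Features that are neither fixed nor free, which include the word bits, get the
    value they have in the run.\<close>
  define a where "a = (\<lambda>f. case build fixed ! f of Some v \<Rightarrow> v
    | None \<Rightarrow> if free_feature f then A f else C f)"
  have fixed_free: "build fixed ! feature t c s = None"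
    if f: "t \<le> T" "c \<le> width" "s < D" "free_feature (feature t c s)" for t c s
  proof -
    have "0 < t \<or> c = 0 \<and> s < K * (B + 1)" using f by (simp add: free_feature_iff)
    moreover have "s div (B + 1) \<noteq> K" if "s < K * (B + 1)"
      using less_mult_imp_div_less[OF that] by simp
    ultimately have "fixed t c s = None"
      unfolding fixed_def Let_def by (elim disjE) simp_all
    then show ?thesis using f by (simp add: nth_build)
  qed
  have slot: "cells a 0 c (j * (B + 1) + b) = code 0 c (j * (B + 1) + b)"
    if c: "c \<le> width" and bj: "b \<le> B" "c = 0 \<and> j = K \<or> 0 < c \<and> j < K" for c j b
  proof -
    let ?s = "j * (B + 1) + b"
    have s: "?s < D" using bj by (intro slot_less) auto
    have "\<not> free_feature (feature 0 c ?s)"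
      using c s bj by (auto simp: free_feature_iff)
    moreover have "build fixed ! feature 0 c ?s = fixed 0 c ?s"
      using c s by (intro nth_build) simp_all
    ultimately have "cells a 0 c ?s \<longleftrightarrow> (case fixed 0 c ?s of Some v \<Rightarrow> v | None \<Rightarrow> code 0 c ?s)"
      using s C[OF c s] by (simp add: cells_def a_def cong: option.case_cong)
    then show ?thesis
      using fixed_code[OF bj] by (cases "fixed 0 c ?s") simp_all
  qed
  have "R (x # us)" if "tableau_ok a"
  proof -
    have "state_correct (cells a) 0"
      by (rule agrees_state) (use slot in \<open>auto simp: agrees_def\<close>)
    moreover have "cell_correct (cells a) 0 c" if "1 \<le> c" "c \<le> width" for c
      by (rule agrees_cell) (use that slot in \<open>auto simp: agrees_def\<close>)
    ultimately have "cell_correct (cells a) T orig"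
      using windows_sound[of "cells a" T] that
      by (simp add: tableau_ok_def orig_def width_def)
    then have "content T (K - 1) 0 = 2"
      using that K_ge by (simp add: cell_correct_def tableau_ok_def position_def)
    then show ?thesis using output_correct by (simp split: if_splits)
  qed
  moreover have False if bad: "\<not> tableau_ok a"
  proof -
    obtain e where e: "length e = dim" "\<forall>f<selectors. e ! f = a f" "classify tree e"
      using not_tableau_ok_classify[OF bad] by blast
    let ?y = "map Some e"
    have "subsumed (build fixed) ?y"
      unfolding subsumed_def
    proof (intro conjI allI impI)
      fix f assume f: "f < length (build fixed)" "build fixed ! f \<noteq> None"
      then have "f < selectors" using nth_build_selectors[of f fixed] by fastforce
      with f e show "build fixed ! f = ?y ! f" by (auto simp: a_def)
    qed (simp add: e)
    moreover have "?y ! word_pos j h = Some True \<longleftrightarrow> us ! (j - 1) ! h"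
      if j: "j \<in> {1..k}" and h: "h < m" for j h
    proof -
      let ?c = "orig + h" and ?s = "j * (B + 1) + 1"
      have c: "?c \<le> width" using h len by (simp add: orig_def width_def)
      have s: "?s < D" using j K_ge B_ge by (intro slot_less) auto
      have less: "feature 0 ?c ?s < selectors" using c s by (intro feature_less) auto
      have "cells a 0 ?c ?s = code 0 ?c ?s"
        using c j K_ge B_ge by (intro slot) (auto simp: orig_def)
      moreover have "code 0 ?c ?s = (x # us) ! j ! h"
        using j h K_ge B_ge by (subst code_cell_0) (auto simp: orig_def word_len_def)
      ultimately show ?thesis
        using j s e less by (simp add: cells_def word_pos_def dim_def nth_Cons')
    qed
    moreover have "?y ! f = Some True \<longleftrightarrow> A f" if f: "free_feature f" for f
    proof -
      have "f < selectors" using f by (simp add: free_feature_def)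
      then obtain t c s where "t \<le> T" "c \<le> width" "s < D" "f = feature t c s"
        by (rule feature_cases)
      then have "a f = A f" using f fixed_free by (simp add: a_def)
      then show ?thesis using e \<open>f < selectors\<close> by (simp add: dim_def)
    qed
    moreover have "positive tree ?y"
      using e by (simp add: positive_def o_def image_iff)
    moreover have "?y \<in> pinstances dim" using e by (simp add: pinstances_def)
    ultimately show False
      using A unfolding matrix_sem_def by blast
  qed
  ultimately show "R (x # us)" by blast
qed

end

lemma alternation_word_cong:
  "(\<And>us. length us = r \<Longrightarrow> (\<And>u. u \<in> set us \<Longrightarrow> length u = m) \<Longrightarrow> P us = P' us) \<Longrightarrow>
     alternation b r m P = alternation b r m P'"
proof (induction r arbitrary: b P P')
  case (Suc r)
  have "alternation b' r m (\<lambda>us. P (u # us)) = alternation b' r m (\<lambda>us. P' (u # us))"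
    if "length u = m" for b' u
    using that by (intro Suc.IH Suc.prems) auto
  then show ?case by (cases b) auto
qed simp

theorem models_tableau: "models dim tree (hard_formula k)
    (build fixed # map (\<lambda>j. mark dim (block j)) [1..<k + 2]) \<longleftrightarrow> alternation True k m (\<lambda>us. R (x # us))"
  unfolding models_hard_formula by (rule alternation_word_cong) (rule matrix_sem_iff)

end

section \<open>Generating the reduction\<close>

fun ghorner :: "nat list \<Rightarrow> gen" where
  "ghorner [] = gzero"
| "ghorner (c # cs) = Cat (gnum c) (grep (Len 0) (ghorner cs))"

definition gpoly :: "nat poly \<Rightarrow> gen" where "gpoly p = ghorner (coeffs p)"

lemma val_ghorner: "val ws \<rho> (ghorner cs) = horner_sum id (length (ws ! 0)) cs"
  by (induction cs) auto

lemma val_gpoly [simp]: "val ws \<rho> (gpoly p) = poly p (length (ws ! 0))"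
  by (simp add: gpoly_def val_ghorner poly_def)

lemma word_indices_gpoly: "word_indices (gpoly p) \<subseteq> {0}"
proof -
  have "word_indices (ghorner cs) \<subseteq> {0}" for cs by (induction cs) auto
  then show ?thesis by (simp add: gpoly_def)
qed

definition genc_nat :: "gen \<Rightarrow> gen" where
  "genc_nat g = Cat (grep g (Emit True)) (Emit False)"

lemma sem_genc_nat [simp]: "sem ws \<rho> (genc_nat g) = enc_nat (val ws \<rho> g)"
proof -
  have "concat (replicate n [True]) = replicate n True" for n by (induction n) auto
  then show ?thesis by (simp add: genc_nat_def enc_nat_def)
qed

fun gcats :: "gen list \<Rightarrow> gen" where
  "gcats [] = gzero"
| "gcats (g # gs) = Cat g (gcats gs)"

lemma sem_gzero [simp]: "sem ws \<rho> gzero = []"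
  by (simp add: gzero_def)

lemma sem_gcats [simp]: "sem ws \<rho> (gcats gs) = concat (map (sem ws \<rho>) gs)"
  by (induction gs) auto

lemma word_indices_gcats [simp]: "word_indices (gcats gs) = (\<Union>g\<in>set gs. word_indices g)"
  by (induction gs) auto

declare sem.simps(7) [simp del]

lemma sem_For [simp]: "sem ws \<rho> (For v g h) = concat (map (\<lambda>i. sem ws (\<rho>(v := i)) h) [0..<val ws \<rho> g])"
  by (simp add: val_def sem.simps(7))

text \<open>The tree is unrolled when the generator is formed, and P is evaluated in the logic and
  not by the machine. This works because the number of features read by a constraint depends on M
  only; their indices are computed at run time.\<close>

fun gfull_tree :: "gen list \<Rightarrow> (bool list \<Rightarrow> bool) \<Rightarrow> gen" where
  "gfull_tree [] P = gcats [Emit False, Emit (P [])]"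
| "gfull_tree (f # fs) P = gcats [Emit True, genc_nat f,
     gfull_tree fs (\<lambda>bs. P (False # bs)), gfull_tree fs (\<lambda>bs. P (True # bs))]"

lemma sem_gfull_tree [simp]:
  "sem ws \<rho> (gfull_tree fs P) = enc_dtree (full_tree (map (val ws \<rho>) fs) P)"
  by (induction fs arbitrary: P) auto

lemma word_indices_gfull_tree: "word_indices (gfull_tree fs P) \<subseteq> (\<Union>f\<in>set fs. word_indices f)"
  by (induction fs arbitrary: P) (auto simp: genc_nat_def)

lemma enc_dtree_chain:
  "enc_dtree (chain cs) = concat (map (\<lambda>(s, C). True # enc_nat s @ enc_dtree C) cs) @ [False, False]"
  by (induction cs rule: chain.induct) auto

definition gnone :: gen where "gnone = gcats [Emit False, Emit False]"
definition gsome :: "gen \<Rightarrow> gen" where "gsome g = Cat (Emit True) (gif g (Emit True) (Emit False))"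
definition gbool :: "bool \<Rightarrow> gen" where "gbool b = (if b then Emit True else gzero)"

lemma sem_gnone [simp]: "sem ws \<rho> gnone = enc_value None"
  by (simp add: gnone_def)

lemma sem_gsome [simp]: "sem ws \<rho> (gsome g) = enc_value (Some (tr ws \<rho> g))"
  by (simp add: gsome_def)

lemma tr_Emit [simp]: "tr ws \<rho> (Emit a)"
  by (simp add: tr_def)

lemma tr_gzero [simp]: "\<not> tr ws \<rho> gzero"
  by (simp add: tr_def)

lemma tr_gbool [simp]: "tr ws \<rho> (gbool b) \<longleftrightarrow> b"
  by (simp add: gbool_def tr_def)

lemma word_indices_values [simp]: "word_indices gnone = {}" "word_indices (gsome g) = word_indices g"
  "word_indices (gbool b) = {}" "word_indices (genc_nat g) = word_indices g"
  by (auto simp: gnone_def gsome_def gbool_def genc_nat_def)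

text \<open>The generators below are defined from M, k, p and q alone; x and \<open>ws\<close> enter
  through their correctness. So a single generator serves all inputs.\<close>

locale reduction_program = reduction M T k m x R for M T k m x R +
  fixes p q :: "nat poly" and ws :: "bool list list"
  assumes T: "T = poly p (length x)" and m: "m = poly q (length x)" and ws: "ws ! 0 = x"
begin

definition gtime :: gen where "gtime = gpoly p"
definition gwidth :: gen where "gwidth = Cat (grep (gnum 4) gtime) (gnum 4)"
definition gorig :: gen where "gorig = Cat (grep (gnum 2) gtime) (gnum 2)"
definition gselectors :: gen where
  "gselectors = grep (grep (Cat gtime (Emit True)) (Cat gwidth (Emit True))) (gnum D)"
definition ginner :: gen where "ginner = Monus gwidth (gnum 2)"
definition gconstraints :: gen where "gconstraints = Cat (grep gtime ginner) (Emit True)"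
definition gcell_no :: "gen \<Rightarrow> gen \<Rightarrow> gen" where
  "gcell_no t c = Cat (grep t (Cat gwidth (Emit True))) c"
definition ggroup_features :: "gen list \<Rightarrow> gen list" where
  "ggroup_features gs = concat (map (\<lambda>g. map (\<lambda>s. Cat (grep g (gnum D)) (gnum s)) [0..<D]) gs)"

definition gwindow :: gen where
  "gwindow = (let t = Var 0; c = Var 1; t' = Cat t (Emit True) in
     gcats [Emit True, genc_nat (Cat gselectors (Cat (grep t ginner) c)),
       gfull_tree (ggroup_features [gcell_no t gzero, gcell_no t' gzero, gcell_no t (Cat c (gnum 1)),
         gcell_no t (Cat c (gnum 2)), gcell_no t (Cat c (gnum 3)), gcell_no t' (Cat c (gnum 2))])
         bad_window])"

definition gtree :: gen where
  "gtree = gcats [For 0 gtime (For 1 ginner gwindow), Emit True,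
     genc_nat (Cat gselectors (grep gtime ginner)),
     gfull_tree (ggroup_features [gcell_no gtime gorig]) bad_output, Emit False, Emit False]"

text \<open>Rows and columns depend on the input and need loops; the slots are unrolled, D being a
  constant of the machine, so that v can distinguish them in the logic.\<close>

definition gbuild :: "(nat \<Rightarrow> gen) \<Rightarrow> gen" where
  "gbuild v = gcats [For 0 (Cat gtime (Emit True)) (For 1 (Cat gwidth (Emit True))
     (gcats (map v [0..<D]))), grep gconstraints gnone]"

definition gword_len :: "nat \<Rightarrow> gen" where "gword_len j = (if j = 0 then Len 0 else gpoly q)"

definition gfixed :: "nat \<Rightarrow> gen" where
  "gfixed s = (let j = s div (B + 1); b = s mod (B + 1); t = Var 0; c = Var 1 in
     gif (glt gzero t) gnone
     (gif (geq c gzero) (if j = K then gsome (gbool (b < start_state M)) else gnone)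
     (if K \<le> j then gnone
      else if b = B then gsome (geq c gorig)
      else if 2 \<le> b \<or> k < j then gsome gzero
      else gif (gor (glt c gorig) (gleq (Cat gorig (gword_len j)) c)) (gsome gzero)
        (if b = 0 then gsome (Emit True)
         else if j = 0 then gsome (Bit 0 (Monus c gorig)) else gnone))))"

definition gblock :: "nat \<Rightarrow> nat \<Rightarrow> gen" where
  "gblock j s = (let t = Var 0; c = Var 1 in
     if k < j then gif (gor (glt gzero t) (gand (geq c gzero) (gbool (s < K * (B + 1))))) (gsome (Emit True)) gnone
     else if s = j * (B + 1) + 1
       then gif (gand (geq t gzero) (gand (gleq gorig c) (glt c (Cat gorig (gpoly q))))) (gsome (Emit True)) gnone
       else gnone)"

definition greduction :: gen where
  "greduction = gcats [genc_nat (Cat gselectors gconstraints), gtree, gbuild gfixed,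
     gcats (map (\<lambda>j. gbuild (gblock j)) [1..<k + 2])]"

lemma vals [simp]:
  "val ws \<rho> gtime = T" "val ws \<rho> gwidth = width" "val ws \<rho> gorig = orig"
  "val ws \<rho> gselectors = selectors" "val ws \<rho> ginner = width - 2"
  "val ws \<rho> gconstraints = T * (width - 2) + 1"
  "val ws \<rho> (gcell_no t c) = cell_no (val ws \<rho> t) (val ws \<rho> c)"
proof -
  show T: "val ws \<rho> gtime = T" for \<rho> by (simp add: gtime_def T ws)
  show w: "val ws \<rho> gwidth = width" for \<rho> by (simp add: gwidth_def T width_def)
  show "val ws \<rho> gorig = orig" by (simp add: gorig_def T orig_def)
  show "val ws \<rho> gselectors = selectors" by (simp add: gselectors_def T w selectors_def cell_count_def)
  show i: "val ws \<rho> ginner = width - 2" for \<rho> by (simp add: ginner_def w)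
  show "val ws \<rho> gconstraints = T * (width - 2) + 1" by (simp add: gconstraints_def T i)
  show "val ws \<rho> (gcell_no t c) = cell_no (val ws \<rho> t) (val ws \<rho> c)"
    by (simp add: gcell_no_def w cell_no_def)
qed

lemma val_ggroup_features: "map (val ws \<rho>) (ggroup_features gs) = group_features (map (val ws \<rho>) gs)"
  by (simp add: ggroup_features_def group_features_def map_concat o_def)

lemma sem_gwindow: "sem ws (\<rho>(0 := t, Suc 0 := c)) gwindow =
    True # enc_nat (selectors + (t * (width - 2) + c)) @
    enc_dtree (full_tree (group_features (window_groups t c)) bad_window)"
  by (simp add: gwindow_def Let_def val_ggroup_features window_groups_def numeral_2_eq_2)

lemma sem_gtree: "sem ws \<rho> gtree = enc_dtree tree"
proof -
  have "enc_dtree tree = concat (map (\<lambda>t. concat (map (\<lambda>c. True # enc_nat (selectors + (t * (width - 2) + c)) @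
      enc_dtree (full_tree (group_features (window_groups t c)) bad_window)) [0..<width - 2])) [0..<T]) @
    (True # enc_nat (selectors + T * (width - 2)) @
      enc_dtree (full_tree (group_features [cell_no T orig]) bad_output)) @ [False, False]"
    unfolding tree_def enc_dtree_chain constraints_def
    by (simp add: map_concat concat_concat o_def)
  then show ?thesis
    unfolding gtree_def by (simp add: sem_gwindow val_ggroup_features)
qed

lemma sem_gbuild:
  assumes "\<And>\<rho> s. s < D \<Longrightarrow> \<rho> 0 \<le> T \<Longrightarrow> \<rho> 1 \<le> width \<Longrightarrow> sem ws \<rho> (v s) = enc_value (pv (\<rho> 0) (\<rho> 1) s)"
  shows "sem ws \<rho> (gbuild v) = enc_pinstance (build pv)"
proof -
  have cell: "sem ws (\<rho>(0 := t, 1 := c)) (gcats (map v [0..<D])) = enc_pinstance (map (pv t c) [0..<D])"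
    if "t \<le> T" "c \<le> width" for t c
  proof -
    have "map (\<lambda>s. sem ws (\<rho>(0 := t, 1 := c)) (v s)) [0..<D] = map (\<lambda>s. enc_value (pv t c s)) [0..<D]"
      using that assms[of _ "\<rho>(0 := t, 1 := c)"] by (intro map_cong) auto
    then show ?thesis by (simp only: sem_gcats map_map o_def enc_pinstance_def)
  qed
  have row: "concat (map (\<lambda>c. sem ws (\<rho>(0 := t, 1 := c)) (gcats (map v [0..<D]))) [0..<width + 1]) =
      concat (map (\<lambda>c. enc_pinstance (map (pv t c) [0..<D])) [0..<width + 1])" if "t \<le> T" for t
    by (intro arg_cong[where f = concat] map_cong refl cell) (use that in auto)
  have 1: "concat (map (\<lambda>t. concat (map (\<lambda>c. sem ws (\<rho>(0 := t, 1 := c)) (gcats (map v [0..<D])))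
      [0..<width + 1])) [0..<T + 1]) =
      concat (map (\<lambda>t. concat (map (\<lambda>c. enc_pinstance (map (pv t c) [0..<D])) [0..<width + 1])) [0..<T + 1])"
    by (rule arg_cong[where f = concat], rule map_cong[OF refl], rule row) auto
  have enc: "concat (map (\<lambda>t. enc_pinstance (f t)) ts) = enc_pinstance (concat (map f ts))" for f and ts :: "nat list"
    using enc_pinstances_concat[of "map f ts"] by (simp add: o_def)
  have "sem ws \<rho> (gbuild v) = concat (map (\<lambda>t. concat (map (\<lambda>c. sem ws (\<rho>(0 := t, 1 := c)) (gcats (map v [0..<D])))
      [0..<width + 1])) [0..<T + 1]) @ concat (replicate (T * (width - 2) + 1) (enc_value None))"
    unfolding gbuild_def by (simp del: upt_Suc replicate_Suc)
  also have "concat (replicate n (enc_value None)) = enc_pinstance (replicate n None)" for n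
    by (simp add: enc_pinstance_def)
  finally show ?thesis
    unfolding 1 enc build_def by (simp only: enc_pinstance_def map_append concat_append)
qed

lemma sem_gfixed: "sem ws \<rho> (gfixed s) = enc_value (fixed (\<rho> 0) (\<rho> 1) s)"
proof -
  have "val ws \<rho> (gword_len j) = word_len j" for j
    by (simp add: gword_len_def word_len_def ws flip: m)
  then show ?thesis
    unfolding gfixed_def fixed_def Let_def by (simp add: ws)
qed

lemma sem_gblock:
  assumes "s < D" "\<rho> 0 \<le> T" "\<rho> 1 \<le> width"
  shows "sem ws \<rho> (gblock j s) =
    enc_value (if block j (feature (\<rho> 0) (\<rho> 1) s) then Some True else None)"
proof (cases "j \<le> k")
  case True
  have "block j (feature (\<rho> 0) (\<rho> 1) s) \<longleftrightarrow>
      s = j * (B + 1) + 1 \<and> \<rho> 0 = 0 \<and> orig \<le> \<rho> 1 \<and> \<rho> 1 < orig + m"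
  proof
    assume "block j (feature (\<rho> 0) (\<rho> 1) s)"
    then obtain h where h: "h < m" "feature (\<rho> 0) (\<rho> 1) s = feature 0 (orig + h) (j * (B + 1) + 1)"
      using True by (auto simp: block_def word_pos_def)
    have "orig + h \<le> width"
      using h(1) len by (simp add: orig_def width_def)
    moreover have "j * (B + 1) + 1 < D"
      using True K_ge B_ge by (intro slot_less) simp_all
    ultimately have "cell_no (\<rho> 0) (\<rho> 1) = cell_no 0 (orig + h)" "s = j * (B + 1) + 1"
      using h(2) assms(1) feature_div_mod by metis+
    then show "s = j * (B + 1) + 1 \<and> \<rho> 0 = 0 \<and> orig \<le> \<rho> 1 \<and> \<rho> 1 < orig + m"
      using assms(3) \<open>orig + h \<le> width\<close> h(1) by (simp add: cell_no_eq_iff)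
  next
    assume "s = j * (B + 1) + 1 \<and> \<rho> 0 = 0 \<and> orig \<le> \<rho> 1 \<and> \<rho> 1 < orig + m"
    then show "block j (feature (\<rho> 0) (\<rho> 1) s)"
      using True unfolding block_def word_pos_def by (auto intro!: exI[of _ "\<rho> 1 - orig"])
  qed
  then show ?thesis
    using True by (simp add: gblock_def Let_def ws flip: m)
next
  case False
  then have "block j (feature (\<rho> 0) (\<rho> 1) s) \<longleftrightarrow> 0 < \<rho> 0 \<or> \<rho> 1 = 0 \<and> s < K * (B + 1)"
    using free_feature_iff[OF assms(2,3,1)] by (simp add: block_def)
  then show ?thesis
    using False by (simp add: gblock_def Let_def)
qed

lemma block_less:
  assumes "block j f"
  shows "f < selectors"
proof (cases "j \<le> k")
  case True
  then obtain h where "h < m" "f = feature 0 (orig + h) (j * (B + 1) + 1)"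
    using assms by (auto simp: block_def word_pos_def)
  moreover have "j * (B + 1) + 1 < D"
    using True K_ge B_ge by (intro slot_less) simp_all
  ultimately show ?thesis
    using len by (auto simp: orig_def width_def intro!: feature_less)
next
  case False
  then show ?thesis using assms by (simp add: block_def free_feature_def)
qed

lemma sem_greduction: "sem ws \<rho> greduction =
    enc_input dim tree (build fixed # map (\<lambda>j. mark dim (block j)) [1..<k + 2])"
proof -
  have "sem ws \<rho> (gbuild (gblock j)) = enc_pinstance (mark dim (block j))" for j
  proof -
    have eq: "mark dim (block j) = build (\<lambda>t c s. if block j (feature t c s) then Some True else None)"
      by (rule mark_eq_build) (rule block_less)
    show ?thesis unfolding eq by (rule sem_gbuild) (rule sem_gblock)
  qed
  moreover have "sem ws \<rho> (gbuild gfixed) = enc_pinstance (build fixed)"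
    by (rule sem_gbuild) (rule sem_gfixed)
  ultimately show ?thesis
    unfolding greduction_def by (simp add: enc_input_def sem_gtree dim_def o_def del: upt_Suc)
qed

lemma word_indices_greduction: "word_indices greduction \<subseteq> {0}"
proof -
  note P = word_indices_gpoly
  have 1: "word_indices gtime \<subseteq> {0}" using P by (simp add: gtime_def)
  then have 2: "word_indices gwidth \<subseteq> {0}" "word_indices gorig \<subseteq> {0}"
    by (simp_all add: gwidth_def gorig_def)
  then have 3: "word_indices gselectors \<subseteq> {0}" "word_indices ginner \<subseteq> {0}"
    using 1 by (simp_all add: gselectors_def ginner_def)
  then have 4: "word_indices gconstraints \<subseteq> {0}" using 1 by (simp add: gconstraints_def)
  have cell: "word_indices (gcell_no t c) \<subseteq> word_indices t \<union> word_indices c \<union> {0}" for t c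
    using 2 by (auto simp: gcell_no_def)
  have full: "word_indices (gfull_tree (ggroup_features gs) Q) \<subseteq> {0}"
    if "\<forall>g\<in>set gs. word_indices g \<subseteq> {0}" for gs Q
    using that by (intro order_trans[OF word_indices_gfull_tree]) (auto simp: ggroup_features_def)
  have "word_indices gwindow \<subseteq> {0}"
  proof -
    have "word_indices (gcell_no t c) \<subseteq> {0}" if "word_indices t = {}" "word_indices c = {}" for t c
      using cell[of t c] that by simp
    then show ?thesis
      using 3 unfolding gwindow_def Let_def by (simp add: full)
  qed
  moreover have "word_indices (gcell_no gtime gorig) \<subseteq> {0}"
    using cell[of gtime gorig] 1 2 by auto
  ultimately have tree: "word_indices gtree \<subseteq> {0}"
    using 1 3 by (simp add: gtree_def full)
  have build: "word_indices (gbuild v) \<subseteq> {0}" if "\<And>s. word_indices (v s) \<subseteq> {0}" for v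
    using 1 2 4 that by (simp add: gbuild_def UN_subset_iff)
  have "word_indices (gfixed s) \<subseteq> {0}" for s
    using 2 P by (auto simp: gfixed_def Let_def gword_len_def)
  then have "word_indices (gbuild gfixed) \<subseteq> {0}"
    by (rule build)
  moreover have "word_indices (gblock j s) \<subseteq> {0}" for j s
    using 2 P by (auto simp: gblock_def Let_def)
  then have "word_indices (gbuild (gblock j)) \<subseteq> {0}" for j
    by (rule build)
  ultimately show ?thesis
    using 3 4 tree by (simp add: greduction_def UN_subset_iff del: upt_Suc)
qed

end

theorem hard_formula_hard: "Sigma_P_hard k (Eval (hard_formula k))"
  unfolding Sigma_P_hard_def
proof
  fix L assume "L \<in> Sigma_P k"
  then obtain R and q :: "nat poly" where R: "polytime_decidable (Suc k) R"
    and L: "\<And>x. x \<in> L \<longleftrightarrow> alternation True k (poly q (length x)) (\<lambda>us. R (x # us))"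
    by (auto simp: Sigma_P_def)
  then obtain M and p0 :: "nat poly" where M: "wf_tm M" "Suc k \<le> num_tapes M"
    and comp: "\<And>ws. length ws = Suc k \<Longrightarrow> computes_within M ws [R ws] (poly p0 (sum_list (map length ws)))"
    by (auto simp: polytime_decidable_def polytime_computable_def)
  \<comment> \<open>The arguments have total length \<open>length x\<close> plus k times the value
    of q there, at which the time bound p0 is taken; the last two summands make T bound the lengths
    of the words as well.\<close>
  define p where "p = pcompose p0 ([:0, 1:] + smult k q) + [:0, 1:] + q"
  have red: "reduction_program M (poly p (length x)) k (poly q (length x)) x R p q [x]" for x
  proof
    fix us :: "bool list list" assume us: "length us = k" "\<And>u. u \<in> set us \<Longrightarrow> length u = poly q (length x)"
    have "sum_list (map length us) = k * poly q (length x)"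
    proof -
      have "map length us = replicate k (poly q (length x))"
        using us by (intro replicate_eqI) auto
      then show ?thesis by (simp add: sum_list_replicate)
    qed
    then have "poly p0 (sum_list (map length (x # us))) \<le> poly p (length x)"
      by (simp add: p_def poly_pcompose)
    then show "computes_within M (x # us) [R (x # us)] (poly p (length x))"
      using comp[of "x # us"] us(1) computes_within_mono by simp
  qed (use M in \<open>simp_all add: p_def\<close>)
  define G where "G = reduction_program.greduction M k p q"
  define f where "f = (\<lambda>x. sem [x] (\<lambda>_. 0) G)"
  have "polytime_computable 1 (\<lambda>ws. sem ws (\<lambda>_. 0) G)"
    using reduction_program.word_indices_greduction[OF red]
    by (intro polytime_computable_sem) (auto simp: G_def)
  moreover have "f (hd ws) = sem ws (\<lambda>_. 0) G" if "length ws = 1" for ws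
    using that by (cases ws) (auto simp: f_def)
  ultimately have "polytime_computable 1 (\<lambda>ws. f (hd ws))"
    by (simp add: polytime_computable_def)
  moreover have "x \<in> L \<longleftrightarrow> f x \<in> Eval (hard_formula k)" for x
  proof -
    interpret reduction_program M "poly p (length x)" k "poly q (length x)" x R p q "[x]"
      by (rule red)
    let ?es = "build fixed # map (\<lambda>j. mark dim (block j)) [1..<k + 2]"
    have f: "f x = enc_input dim tree ?es"
      unfolding f_def G_def by (rule sem_greduction)
    have es: "length ?es = card (free_vars (hard_formula k))" "set ?es \<subseteq> pinstances dim"
      by (auto simp: free_vars_hard_formula pinstances_def simp del: upt_Suc)
    have "f x \<in> Eval (hard_formula k) \<longleftrightarrow> models dim tree (hard_formula k) ?es"
    proof
      assume "models dim tree (hard_formula k) ?es"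
      then show "f x \<in> Eval (hard_formula k)"
        unfolding f Eval_def using es dtree_of_dim_tree by blast
    next
      assume "f x \<in> Eval (hard_formula k)"
      then obtain n S ds where "enc_input dim tree ?es = enc_input n S ds"
        "length ds = card (free_vars (hard_formula k))" "set ds \<subseteq> pinstances n" "models n S (hard_formula k) ds"
        unfolding f Eval_def by blast
      then show "models dim tree (hard_formula k) ?es"
        using enc_input_inject[of ?es ds dim n tree S] es by metis
    qed
    then show ?thesis
      using models_tableau L by simp
  qed
  ultimately show "polytime_reducible L (Eval (hard_formula k))"
    unfolding polytime_reducible_def by blast
qed

theorem theorem2:
  "(\<forall>\<phi> :: foil. \<exists>k. Eval \<phi> \<in> Sigma_P k) \<and>
   (\<forall>k. \<exists>\<phi> :: foil. Sigma_P_hard k (Eval \<phi>))"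
  using Eval_in_Sigma_P hard_formula_hard by blast

end
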